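(* Assume that $H$ is finite-dimensional, and let $A$ be the operator on $X=L^2([0,1];H)$ given by $Ax=\sum_{k=0}^N P_k \frac{\partial^k x}{\partial \zeta^k}$ with domain $D(A)=\{x\in \mathcal{W}^{N,2}([0,1];H)\mid \hat W_B\Phi(x)=0\}$, and let $W_B=\begin{bmatrix} W_1 & W_2\end{bmatrix}$, $Q$, $\Sigma$ and $\mathcal{H}$ be as in the context. Then the following statements are equivalent: 1. The operator $A\mathcal{H}$ with domain $D(A\mathcal{H})=\mathcal{H}^{-1}D(A)=\{x\in X\mid \mathcal{H}x\in \mathcal{W}^{N,2}([0,1];H)\text{ and }\hat W_B\Phi(\mathcal{H}x)=0\}$ generates a contraction semigroup on $(X,\langle\cdot,\mathcal{H}\cdot\rangle)$; 2. $A$ is dissipative, that is, $\operatorname{Re}\langle Ax,x\rangle\le 0$ for every $x\in D(A)$; 3. $\operatorname{Re}P_0\le 0$, $W_1+W_2$ is injective and $W_B\Sigma W_B^*\ge 0$; 4. $\operatorname{Re}P_0\le 0$, $W_1+W_2$ is injective and there exists $V\in\mathcal{L}(H^N)$ with $\|V\|\le 1$ such that $W_B=\frac12(W_1+W_2)\begin{bmatrix} I+V & I-V\end{bmatrix}$; 5. $\operatorname{Re}P_0\le 0$ and $u^*Qu-y^*Qy\le 0$ for every $\begin{bmatrix} u\\ y\end{bmatrix}\in\ker\hat W_B$; 6. $\operatorname{Re}P_0\le 0$, $W_B$ is surjective and $W_B\Sigma W_B^*\ge 0$; 7. $\operatorname{Re}P_0\le 0$, $W_B$ is surjective and there exists $V\in\mathcal{L}(H^N)$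 with $\|V\|\le 1$ such that $W_B=\frac12(W_1+W_2)\begin{bmatrix} I+V & I-V\end{bmatrix}$.
   Context: $H$ is a Hilbert space, $\mathcal{L}(\cdot)$ and $\mathcal{L}(\cdot,\cdot)$ denote bounded linear operators, and $N\ge 1$ is an integer. $P_0,\dots,P_N\in\mathcal{L}(H)$, $P_N$ is invertible, and $P_k^*=(-1)^{k+1}P_k$ for $k=1,\dots,N$ (no symmetry condition on $P_0$). For a.e. $\zeta\in[0,1]$, $\mathcal{H}(\zeta)$ is a positive operator on $H$, and $\mathcal{H},\mathcal{H}^{-1}\in L^\infty([0,1];\mathcal{L}(H))$; $\mathcal{H}$ also denotes the induced multiplication operator on $X=L^2([0,1];H)$. $\langle\cdot,\cdot\rangle$ is the standard inner product of $L^2([0,1];H)$, and $(X,\langle\cdot,\mathcal{H}\cdot\rangle)$ is $X$ equipped with the inner product $(x,z)\mapsto\langle x,\mathcal{H}z\rangle$. $\mathcal{W}^{N,2}([0,1];H)$ is the Sobolev space of order $N$. Boundary map: $\Phi:\mathcal{W}^{N,2}([0,1];H)\to H^{2N}$, $\Phi(x)=\begin{bmatrix}\Phi_1(x)\\ \Phi_0(x)\end{bmatrix}$ with $\Phi_i(x)=\left[x(i),\ \frac{dx}{d\zeta}(i),\dots,\frac{d^{N-1}x}{d\zeta^{N-1}}(i)\right]^T\in H^N$ for $i\in\{0,1\}$. The boundary operator is some $\hat W_B\in\mathcal{L}(H^{2N},H^N)$. $Q=(Q_{ij})_{1\le i,j\le N}\in\mathcal{L}(H^N)$ is the block operator matrix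 with $Q_{ij}=(-1)^{i-1}P_{i+j-1}$ if $i+j\le N+1$ and $Q_{ij}=0$ otherwise; it is selfadjoint and invertible. Define $W_B=\begin{bmatrix}W_1&W_2\end{bmatrix}:=\hat W_B\begin{bmatrix}Q&-Q\\ I&I\end{bmatrix}^{-1}$ with $W_1,W_2\in\mathcal{L}(H^N)$, and $\Sigma=\begin{bmatrix}0&I\\ I&0\end{bmatrix}\in\mathcal{L}(H^N\times H^N)$. $\operatorname{Re}P=\frac12(P+P^* )$; $P\le0$ means $\langle x,Px\rangle\le 0$ for all $x$ (similarly $\ge$). For $u\in H^N$, $u^*Qu$ denotes $\langle u,Qu\rangle_{H^N}$. A contraction semigroup is a $C_0$-semigroup of contractions. *)

theory Defs
  imports "HOL-Analysis.Analysis"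
begin

section \<open>Complex inner product spaces\<close>

text \<open>The library only has real inner products. A complex inner product space is a real inner
  product space with a compatible complex structure: the inherited \<^const>\<open>inner\<close> is the real part
  of the Hermitian product, so the inherited norm is the Hilbert norm. Together with
  \<^class>\<open>euclidean_space\<close> this gives the (nonzero) finite-dimensional complex Hilbert spaces.\<close>

class complex_inner = real_inner +
  fixes scaleC :: "complex \<Rightarrow> 'a \<Rightarrow> 'a" (infixr "*\<^sub>C" 75)
    and cinner :: "'a \<Rightarrow> 'a \<Rightarrow> complex"
  assumes scaleC_add_right: "c *\<^sub>C (x + y) = c *\<^sub>C x + c *\<^sub>C y"
    and scaleC_add_left: "(c + d) *\<^sub>C x = c *\<^sub>C x + d *\<^sub>C x"
    and scaleC_scaleC: "c *\<^sub>C (d *\<^sub>C x) = (c * d) *\<^sub>C x"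
    and scaleC_of_real: "of_real r *\<^sub>C x = r *\<^sub>R x"
    and cinner_commute: "cinner x y = cnj (cinner y x)"
    and cinner_add_left: "cinner (x + y) z = cinner x z + cinner y z"
    and cinner_scaleC_left: "cinner (c *\<^sub>C x) y = c * cinner x y"
    and Re_cinner: "Re (cinner x y) = inner x y"

lemma cinner_eq: "cinner x y = Complex (inner x y) (- inner (\<i> *\<^sub>C x) y)"
  using cinner_scaleC_left[of \<i> x y] Re_cinner[of "\<i> *\<^sub>C x" y]
  by (simp add: complex_eq_iff Re_cinner)

lemma scaleC_scaleR: "c *\<^sub>C (r *\<^sub>R x) = r *\<^sub>R (c *\<^sub>C (x::'a::complex_inner))"
  by (metis scaleC_of_real scaleC_scaleC mult.commute)

lemma scaleC_zero_right [simp]: "c *\<^sub>C (0::'a::complex_inner) = 0"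
  using scaleC_scaleR[of c 0 "0::'a"] by simp

lemma linear_scaleC: "linear (\<lambda>x::'a::complex_inner. c *\<^sub>C x)"
  by (rule linearI) (simp_all add: scaleC_add_right scaleC_scaleR)

lemma norm_scaleC: "norm (c *\<^sub>C (x::'a::complex_inner)) = cmod c * norm x"
proof -
  have "cinner (c *\<^sub>C x) (c *\<^sub>C x) = c * cnj (c * cinner x x)"
    by (metis cinner_scaleC_left cinner_commute)
  also have "\<dots> = of_real ((cmod c)\<^sup>2) * cinner x x"
    by (metis cinner_commute complex_cnj_mult complex_norm_square mult.assoc of_real_power)
  finally have "Re (cinner (c *\<^sub>C x) (c *\<^sub>C x)) = (cmod c)\<^sup>2 * Re (cinner x x)"
    by simp
  then show ?thesis
    by (simp add: Re_cinner norm_eq_sqrt_inner real_sqrt_mult)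
qed

instantiation complex :: complex_inner
begin
definition scaleC_complex_def: "c *\<^sub>C (x::complex) = c * x"
definition cinner_complex_def: "cinner (x::complex) y = x * cnj y"
instance
  by standard
    (auto simp: scaleC_complex_def cinner_complex_def inner_complex_def complex_eq_iff algebra_simps)
end

instantiation prod :: (complex_inner, complex_inner) complex_inner
begin
definition scaleC_prod_def: "c *\<^sub>C x = (c *\<^sub>C fst x, c *\<^sub>C snd x)"
definition cinner_prod_def: "cinner x y = cinner (fst x) (fst y) + cinner (snd x) (snd y)"
instance
proof (standard, goal_cases)
  case (5 x y)
  show ?case
    by (simp add: cinner_prod_def cinner_commute[of "fst x"] cinner_commute[of "snd x"])
qed (auto simp: scaleC_prod_def cinner_prod_def inner_prod_def scaleC_add_right scaleC_add_left
      scaleC_scaleC scaleC_of_real cinner_add_left cinner_scaleC_left Re_cinner algebra_simps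
      prod_eq_iff)
end

instantiation vec :: (complex_inner, finite) complex_inner
begin
definition scaleC_vec_def: "c *\<^sub>C x = (\<chi> i. c *\<^sub>C (x $ i))"
definition cinner_vec_def: "cinner x y = (\<Sum>i\<in>UNIV. cinner (x $ i) (y $ i))"
instance
proof (standard, goal_cases)
  case (5 x y)
  show ?case
    unfolding cinner_vec_def cnj_sum by (intro sum.cong refl cinner_commute)
qed (auto simp: scaleC_vec_def cinner_vec_def inner_vec_def scaleC_add_right scaleC_add_left
      scaleC_scaleC scaleC_of_real cinner_add_left cinner_scaleC_left Re_cinner vec_eq_iff
      sum.distrib sum_distrib_left)
end


section \<open>Operators\<close>

definition bounded_clinear :: "('a::complex_inner \<Rightarrow> 'b::complex_inner) \<Rightarrow> bool" where
  "bounded_clinear f \<longleftrightarrow> bounded_linear f \<and> (\<forall>c x. f (c *\<^sub>C x) = c *\<^sub>C f x)"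

definition cadjoint :: "('a::complex_inner \<Rightarrow> 'b::complex_inner) \<Rightarrow> 'b \<Rightarrow> 'a" where
  "cadjoint f = (SOME g. \<forall>x y. cinner (f x) y = cinner x (g y))"

definition Re_op :: "('a::complex_inner \<Rightarrow> 'a) \<Rightarrow> 'a \<Rightarrow> 'a" where
  "Re_op f x = (1/2) *\<^sub>R (f x + cadjoint f x)"

definition op_nonneg :: "('a::complex_inner \<Rightarrow> 'a) \<Rightarrow> bool" where
  "op_nonneg f \<longleftrightarrow> (\<forall>x. cinner x (f x) \<in> \<real>\<^sub>\<ge>\<^sub>0)"

definition op_nonpos :: "('a::complex_inner \<Rightarrow> 'a) \<Rightarrow> bool" where
  "op_nonpos f \<longleftrightarrow> (\<forall>x. cinner x (f x) \<in> \<real>\<^sub>\<le>\<^sub>0)"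


section \<open>The space $L^2([0,1];H)$\<close>

definition square_integrable :: "(real \<Rightarrow> 'a::euclidean_space) \<Rightarrow> bool" where
  "square_integrable f \<longleftrightarrow> f \<in> borel_measurable (lebesgue_on {0..1}) \<and>
     integrable (lebesgue_on {0..1}) (\<lambda>t. (norm (f t))\<^sup>2)"

definition l2_rel :: "(real \<Rightarrow> 'a::euclidean_space) \<Rightarrow> (real \<Rightarrow> 'a) \<Rightarrow> bool" where
  "l2_rel f g \<longleftrightarrow> square_integrable f \<and> square_integrable g \<and>
     (AE t in lebesgue_on {0..1}. f t = g t)"

lemma square_integrable_zero: "square_integrable (\<lambda>t. 0)"
  by (simp add: square_integrable_def)

lemma square_integrable_add:
  assumes "square_integrable f" "square_integrable g"
  shows "square_integrable (\<lambda>t. f t + g t)"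
proof -
  have [measurable]: "f \<in> borel_measurable (lebesgue_on {0..1})"
      "g \<in> borel_measurable (lebesgue_on {0..1})"
    using assms by (auto simp: square_integrable_def)
  have "(norm (f t + g t))\<^sup>2 \<le> 2 * (norm (f t))\<^sup>2 + 2 * (norm (g t))\<^sup>2" for t
  proof -
    have "(norm (f t + g t))\<^sup>2 \<le> (norm (f t) + norm (g t))\<^sup>2"
      by (intro power_mono norm_triangle_ineq) auto
    also have "\<dots> \<le> 2 * (norm (f t))\<^sup>2 + 2 * (norm (g t))\<^sup>2"
      using sum_squares_bound[of "norm (f t)" "norm (g t)"] by (simp add: power2_sum)
    finally show ?thesis .
  qed
  note bound = this
  have "integrable (lebesgue_on {0..1}) (\<lambda>t. 2 * (norm (f t))\<^sup>2 + 2 * (norm (g t))\<^sup>2)"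
    using assms by (simp add: square_integrable_def)
  then have "integrable (lebesgue_on {0..1}) (\<lambda>t. (norm (f t + g t))\<^sup>2)"
    by (rule Bochner_Integration.integrable_bound) (use bound in \<open>simp_all add: abs_of_nonneg\<close>)
  then show ?thesis
    by (simp add: square_integrable_def)
qed

lemma square_integrable_scaleR:
  assumes "square_integrable f" shows "square_integrable (\<lambda>t. r *\<^sub>R f t)"
  using assms by (auto simp: square_integrable_def power_mult_distrib)

lemma square_integrable_scaleC:
  fixes f :: "real \<Rightarrow> 'a::{complex_inner, euclidean_space}"
  assumes "square_integrable f" shows "square_integrable (\<lambda>t. c *\<^sub>C f t)"
proof -
  have "(\<lambda>x::'a. c *\<^sub>C x) \<in> borel_measurable borel"
    by (intro borel_measurable_continuous_onI linear_continuous_on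
          linear_conv_bounded_linear[THEN iffD1] linear_scaleC)
  then have "(\<lambda>t. c *\<^sub>C f t) \<in> borel_measurable (lebesgue_on {0..1})"
    using assms by (auto simp: square_integrable_def intro: measurable_compose)
  then show ?thesis
    using assms by (auto simp: square_integrable_def norm_scaleC power_mult_distrib)
qed

lemma integrable_inner:
  assumes "square_integrable f" "square_integrable g"
  shows "integrable (lebesgue_on {0..1}) (\<lambda>t. inner (f t) (g t))"
proof -
  have [measurable]: "f \<in> borel_measurable (lebesgue_on {0..1})"
      "g \<in> borel_measurable (lebesgue_on {0..1})"
    using assms by (auto simp: square_integrable_def)
  have *: "\<bar>inner (f t) (g t)\<bar> \<le> (norm (f t))\<^sup>2 + (norm (g t))\<^sup>2" for t
  proof -
    have "0 \<le> norm (f t) * norm (g t)" by simp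
    then show ?thesis
      using Cauchy_Schwarz_ineq2[of "f t" "g t"] sum_squares_bound[of "norm (f t)" "norm (g t)"]
      by linarith
  qed
  have "integrable (lebesgue_on {0..1}) (\<lambda>t. (norm (f t))\<^sup>2 + (norm (g t))\<^sup>2)"
    using assms by (simp add: square_integrable_def)
  then show ?thesis
    by (rule Bochner_Integration.integrable_bound) (use * in \<open>simp_all add: abs_of_nonneg\<close>)
qed

lemma integrable_cinner:
  fixes f g :: "real \<Rightarrow> 'a::{complex_inner, euclidean_space}"
  assumes "square_integrable f" "square_integrable g"
  shows "integrable (lebesgue_on {0..1}) (\<lambda>t. cinner (f t) (g t))"
proof -
  have "integrable (lebesgue_on {0..1})
      (\<lambda>t. complex_of_real (inner (f t) (g t)) - \<i> * of_real (inner (\<i> *\<^sub>C f t) (g t)))"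
    using assms
    by (intro Bochner_Integration.integrable_diff integrable_mult_right integrable_of_real
          integrable_inner square_integrable_scaleC)
  then show ?thesis
    by (simp add: cinner_eq Complex_eq)
qed

lemma l2_rel_lift1:
  assumes "l2_rel f g" and "\<And>h. square_integrable h \<Longrightarrow> square_integrable (\<lambda>t. F (h t))"
  shows "l2_rel (\<lambda>t. F (f t)) (\<lambda>t. F (g t))"
proof -
  have "AE t in lebesgue_on {0..1}. f t = g t"
    using assms by (simp add: l2_rel_def)
  then have "AE t in lebesgue_on {0..1}. F (f t) = F (g t)"
    by eventually_elim simp
  with assms show ?thesis
    by (simp add: l2_rel_def)
qed

lemma l2_rel_AE2:
  assumes "l2_rel f f'" "l2_rel g g'"
  shows "AE t in lebesgue_on {0..1}. F (f t) (g t) = F (f' t) (g' t)"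
proof -
  have "AE t in lebesgue_on {0..1}. f t = f' t" "AE t in lebesgue_on {0..1}. g t = g' t"
    using assms by (simp_all add: l2_rel_def)
  then show ?thesis
    by eventually_elim simp
qed

lemma part_equivp_l2_rel: "part_equivp (l2_rel :: (real \<Rightarrow> 'a::euclidean_space) \<Rightarrow> _)"
proof (rule part_equivpI)
  show "\<exists>f. l2_rel f (f :: real \<Rightarrow> 'a)"
    by (rule exI[of _ "\<lambda>t. 0"]) (simp add: l2_rel_def square_integrable_zero)
  show "symp (l2_rel :: (real \<Rightarrow> 'a) \<Rightarrow> _)"
    by (simp add: symp_def l2_rel_def eq_commute)
  show "transp (l2_rel :: (real \<Rightarrow> 'a) \<Rightarrow> _)"
  proof (rule transpI)
    fix f g h :: "real \<Rightarrow> 'a"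
    assume *: "l2_rel f g" "l2_rel g h"
    then have "AE t in lebesgue_on {0..1}. f t = g t" "AE t in lebesgue_on {0..1}. g t = h t"
      by (simp_all add: l2_rel_def)
    then have "AE t in lebesgue_on {0..1}. f t = h t"
      by eventually_elim simp
    with * show "l2_rel f h"
      by (simp add: l2_rel_def)
  qed
qed

quotient_type (overloaded) 'a l2 = "real \<Rightarrow> 'a::euclidean_space" / partial: l2_rel
  morphisms rep_l2 abs_l2
  by (rule part_equivp_l2_rel)

instantiation l2 :: (euclidean_space) real_inner
begin

lift_definition zero_l2 :: "'a l2" is "\<lambda>t. 0"
  by (simp add: l2_rel_def square_integrable_zero)

lift_definition plus_l2 :: "'a l2 \<Rightarrow> 'a l2 \<Rightarrow> 'a l2" is "\<lambda>f g t. f t + g t"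
  by (use l2_rel_AE2[where F = "(+)"] in \<open>auto simp: l2_rel_def square_integrable_add\<close>)

lift_definition scaleR_l2 :: "real \<Rightarrow> 'a l2 \<Rightarrow> 'a l2" is "\<lambda>r f t. r *\<^sub>R f t"
  by (rule l2_rel_lift1) (auto intro: square_integrable_scaleR)

definition uminus_l2 :: "'a l2 \<Rightarrow> 'a l2" where "uminus_l2 x = (-1) *\<^sub>R x"

definition minus_l2 :: "'a l2 \<Rightarrow> 'a l2 \<Rightarrow> 'a l2" where "minus_l2 x y = x + (-1) *\<^sub>R y"

lift_definition inner_l2 :: "'a l2 \<Rightarrow> 'a l2 \<Rightarrow> real"
  is "\<lambda>f g. LINT t|lebesgue_on {0..1}. inner (f t) (g t)"
  by (rule Bochner_Integration.integral_cong_AE)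
    (auto simp: l2_rel_def intro: borel_measurable_integrable integrable_inner
      l2_rel_AE2[where F = inner, unfolded l2_rel_def])

definition norm_l2 :: "'a l2 \<Rightarrow> real" where "norm_l2 x = sqrt (inner x x)"

definition sgn_l2 :: "'a l2 \<Rightarrow> 'a l2" where "sgn_l2 x = inverse (norm x) *\<^sub>R x"

definition dist_l2 :: "'a l2 \<Rightarrow> 'a l2 \<Rightarrow> real" where "dist_l2 x y = norm (x - y)"

definition uniformity_l2 :: "('a l2 \<times> 'a l2) filter" where
  "uniformity_l2 = (INF e\<in>{0<..}. principal {(x, y). dist x y < e})"

definition open_l2 :: "'a l2 set \<Rightarrow> bool" where
  "open_l2 U \<longleftrightarrow> (\<forall>x\<in>U. \<forall>\<^sub>F (x', y) in uniformity. x' = x \<longrightarrow> y \<in> U)"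

instance
proof
  fix x y z :: "'a l2" and a b :: real
  show "x + y + z = x + (y + z)"
    by transfer (auto simp: l2_rel_def add.assoc intro!: square_integrable_add)
  show "x + y = y + x"
    by transfer (auto simp: l2_rel_def add.commute intro!: square_integrable_add)
  show "0 + x = x"
    by transfer (auto simp: l2_rel_def)
  show "- x + x = 0"
    unfolding uminus_l2_def
    by transfer (auto simp: l2_rel_def square_integrable_zero)
  show "x - y = x + - y"
    by (simp add: minus_l2_def uminus_l2_def)
  show "a *\<^sub>R (x + y) = a *\<^sub>R x + a *\<^sub>R y"
    by transfer (auto simp: l2_rel_def scaleR_add_right
        intro!: square_integrable_add square_integrable_scaleR)
  show "(a + b) *\<^sub>R x = a *\<^sub>R x + b *\<^sub>R x"
    by transfer (auto simp: l2_rel_def scaleR_add_left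
        intro!: square_integrable_add square_integrable_scaleR)
  show "a *\<^sub>R b *\<^sub>R x = (a * b) *\<^sub>R x"
    by transfer (auto simp: l2_rel_def intro!: square_integrable_scaleR)
  show "1 *\<^sub>R x = x"
    by transfer (auto simp: l2_rel_def)
  show "sgn x = inverse (norm x) *\<^sub>R x" by (fact sgn_l2_def)
  show "dist x y = norm (x - y)" by (fact dist_l2_def)
  show "(uniformity :: ('a l2 \<times> 'a l2) filter) = (INF e\<in>{0<..}. principal {(x, y). dist x y < e})"
    by (fact uniformity_l2_def)
  show "open U \<longleftrightarrow> (\<forall>x\<in>U. \<forall>\<^sub>F (x', y) in uniformity. x' = x \<longrightarrow> y \<in> U)" for U :: "'a l2 set"
    by (fact open_l2_def)
  show "inner x y = inner y x"
    by transfer (simp add: inner_commute)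
  show "inner (x + y) z = inner x z + inner y z"
    by transfer (auto simp: l2_rel_def inner_add_left integrable_inner)
  show "inner (a *\<^sub>R x) y = a * inner x y"
    by transfer simp
  show "0 \<le> inner x x"
    by transfer simp
  show "inner x x = 0 \<longleftrightarrow> x = 0"
  proof transfer
    fix f :: "real \<Rightarrow> 'a" assume "l2_rel f f"
    then have f: "square_integrable f" by (simp add: l2_rel_def)
    have "(LINT t|lebesgue_on {0..1}. inner (f t) (f t)) = 0 \<longleftrightarrow>
        (AE t in lebesgue_on {0..1}. inner (f t) (f t) = 0)"
      by (rule integral_nonneg_eq_0_iff_AE) (use f integrable_inner in auto)
    then show "((LINT t|lebesgue_on {0..1}. inner (f t) (f t)) = 0) = l2_rel f (\<lambda>t. 0)"
      using f by (simp add: l2_rel_def square_integrable_zero)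
  qed
  show "norm x = sqrt (inner x x)" by (fact norm_l2_def)
qed

end

instantiation l2 :: ("{complex_inner, euclidean_space}") complex_inner
begin

lift_definition scaleC_l2 :: "complex \<Rightarrow> 'a l2 \<Rightarrow> 'a l2" is "\<lambda>c f t. c *\<^sub>C f t"
  by (rule l2_rel_lift1) (auto intro: square_integrable_scaleC)

lift_definition cinner_l2 :: "'a l2 \<Rightarrow> 'a l2 \<Rightarrow> complex"
  is "\<lambda>f g. LINT t|lebesgue_on {0..1}. cinner (f t) (g t)"
  by (rule Bochner_Integration.integral_cong_AE)
    (auto simp: l2_rel_def intro: borel_measurable_integrable integrable_cinner
      l2_rel_AE2[where F = cinner, unfolded l2_rel_def])

instance
proof
  fix x y z :: "'a l2" and c d :: complex and r :: real
  show "c *\<^sub>C (x + y) = c *\<^sub>C x + c *\<^sub>C y"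
    by transfer (auto simp: l2_rel_def scaleC_add_right
        intro!: square_integrable_add square_integrable_scaleC)
  show "(c + d) *\<^sub>C x = c *\<^sub>C x + d *\<^sub>C x"
    by transfer (auto simp: l2_rel_def scaleC_add_left
        intro!: square_integrable_add square_integrable_scaleC)
  show "c *\<^sub>C (d *\<^sub>C x) = (c * d) *\<^sub>C x"
    by transfer (auto simp: l2_rel_def scaleC_scaleC intro!: square_integrable_scaleC)
  show "of_real r *\<^sub>C x = r *\<^sub>R x"
    by transfer (auto simp: l2_rel_def scaleC_of_real intro!: square_integrable_scaleR)
  show "cinner x y = cnj (cinner y x)"
  proof transfer
    fix f g :: "real \<Rightarrow> 'a"
    assume "l2_rel f f" "l2_rel g g"
    then have "integrable (lebesgue_on {0..1}) (\<lambda>t. cinner (g t) (f t))"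
      by (simp add: l2_rel_def integrable_cinner)
    moreover have "(\<lambda>t. cinner (f t) (g t)) = (\<lambda>t. cnj (cinner (g t) (f t)))"
      using cinner_commute by blast
    ultimately show "(LINT t|lebesgue_on {0..1}. cinner (f t) (g t)) =
        cnj (LINT t|lebesgue_on {0..1}. cinner (g t) (f t))"
      by (simp only: integral_bounded_linear[OF bounded_linear_cnj])
  qed
  show "cinner (x + y) z = cinner x z + cinner y z"
    by transfer (auto simp: l2_rel_def cinner_add_left integrable_cinner)
  show "cinner (c *\<^sub>C x) y = c * cinner x y"
    by transfer (simp add: cinner_scaleC_left)
  show "Re (cinner x y) = inner x y"
    by transfer (auto simp: l2_rel_def integral_Re[symmetric] Re_cinner integrable_cinner)
qed

end

text \<open>Multiplication by an operator-valued function. The result does not depend on the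
  representative, and is a genuine \<open>L\<^sup>2\<close> class whenever \<open>Linf_op M\<close> holds.\<close>

definition mult_op :: "(real \<Rightarrow> 'a \<Rightarrow> 'a) \<Rightarrow> 'a::euclidean_space l2 \<Rightarrow> 'a l2" where
  "mult_op M x = abs_l2 (\<lambda>t. M t (rep_l2 x t))"

text \<open>Membership in \<open>L\<^sup>\<infinity>([0,1]; \<L>(H))\<close>. For finite-dimensional \<open>H\<close> Borel measurability with respect
  to the operator norm agrees with strong measurability.\<close>

definition Linf_op :: "(real \<Rightarrow> 'a \<Rightarrow> 'a::{complex_inner, euclidean_space}) \<Rightarrow> bool" where
  "Linf_op M \<longleftrightarrow> (AE t in lebesgue_on {0..1}. bounded_clinear (M t)) \<and>
     (\<lambda>t. Blinfun (M t)) \<in> borel_measurable (lebesgue_on {0..1}) \<and>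
     (\<exists>C. AE t in lebesgue_on {0..1}. onorm (M t) \<le> C)"


section \<open>Sobolev spaces\<close>

definition test_function :: "(real \<Rightarrow> real) \<Rightarrow> bool" where
  "test_function \<phi> \<longleftrightarrow> (\<forall>t. \<phi> differentiable (at t)) \<and> continuous_on UNIV (deriv \<phi>) \<and>
     (\<exists>a b. 0 < a \<and> b < 1 \<and> (\<forall>t. t \<notin> {a..b} \<longrightarrow> \<phi> t = 0))"

text \<open>In dimension one the Sobolev spaces are commonly introduced with \<open>C\<^sub>c\<^sup>1(0,1)\<close> test functions
  (e.g. Brezis, Functional Analysis, Sobolev Spaces and PDEs, Section 8.2); by mollification
  \<open>C\<^sub>c\<^sup>\<infinity>(0,1)\<close> gives the same notion.\<close>

definition weak_deriv :: "'a::euclidean_space l2 \<Rightarrow> 'a l2 \<Rightarrow> bool" where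
  "weak_deriv x g \<longleftrightarrow> (\<forall>\<phi>. test_function \<phi> \<longrightarrow>
     (LINT t|lebesgue_on {0..1}. deriv \<phi> t *\<^sub>R rep_l2 x t) =
     - (LINT t|lebesgue_on {0..1}. \<phi> t *\<^sub>R rep_l2 g t))"

definition wderiv :: "'a::euclidean_space l2 \<Rightarrow> 'a l2" where
  "wderiv x = (THE g. weak_deriv x g)"

primrec sobolev :: "nat \<Rightarrow> 'a::euclidean_space l2 set" where
  "sobolev 0 = UNIV"
| "sobolev (Suc n) = {x. \<exists>g\<in>sobolev n. weak_deriv x g}"

text \<open>Pointwise values of an \<open>L\<^sup>2\<close> class are those of its continuous representative; they are
  meaningful for elements of \<open>sobolev 1\<close> and points of \<open>[0,1]\<close>.\<close>

definition cont_rep :: "'a::euclidean_space l2 \<Rightarrow> real \<Rightarrow> 'a" where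
  "cont_rep x = (SOME f. continuous_on {0..1} f \<and> (AE t in lebesgue_on {0..1}. rep_l2 x t = f t))"


section \<open>Contraction semigroups\<close>

text \<open>The inner product is a parameter, since it need not be the one of the type class.\<close>

definition ip_norm :: "('x \<Rightarrow> 'x \<Rightarrow> complex) \<Rightarrow> 'x \<Rightarrow> real" where
  "ip_norm ip x = sqrt (Re (ip x x))"

definition contraction_semigroup ::
    "('x::complex_inner \<Rightarrow> 'x \<Rightarrow> complex) \<Rightarrow> (real \<Rightarrow> 'x \<Rightarrow> 'x) \<Rightarrow> bool" where
  "contraction_semigroup ip T \<longleftrightarrow>
     (\<forall>t\<ge>0. \<forall>x y c. T t (x + y) = T t x + T t y \<and> T t (c *\<^sub>C x) = c *\<^sub>C T t x) \<and>
     (\<forall>t\<ge>0. \<forall>x. ip_norm ip (T t x) \<le> ip_norm ip x) \<and>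
     (\<forall>x. T 0 x = x) \<and>
     (\<forall>s\<ge>0. \<forall>t\<ge>0. \<forall>x. T (s + t) x = T s (T t x)) \<and>
     (\<forall>x. ((\<lambda>t. ip_norm ip (T t x - x)) \<longlongrightarrow> 0) (at_right 0))"

definition generator_graph ::
    "('x::complex_inner \<Rightarrow> 'x \<Rightarrow> complex) \<Rightarrow> (real \<Rightarrow> 'x \<Rightarrow> 'x) \<Rightarrow> ('x \<times> 'x) set" where
  "generator_graph ip T =
     {(x, y). ((\<lambda>t. ip_norm ip ((T t x - x) /\<^sub>R t - y)) \<longlongrightarrow> 0) (at_right 0)}"

definition generates_contraction_semigroup ::
    "('x::complex_inner \<Rightarrow> 'x \<Rightarrow> complex) \<Rightarrow> 'x set \<Rightarrow> ('x \<Rightarrow> 'x) \<Rightarrow> bool" where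
  "generates_contraction_semigroup ip D B \<longleftrightarrow>
     (\<exists>T. contraction_semigroup ip T \<and> generator_graph ip T = {(x, B x) | x. x \<in> D})"


section \<open>The differential operator and its boundary conditions\<close>

text \<open>\<open>H\<^sup>N\<close> is \<open>'h ^ 'n\<close> with \<open>N = CARD('n)\<close>; the linear order on \<open>'n\<close> numbers the
  components \<open>1, \<dots>, N\<close>.\<close>

definition pos :: "'n::{finite, linorder} \<Rightarrow> nat" where
  "pos i = card {j. j \<le> i}"

definition diff_op ::
    "nat \<Rightarrow> (nat \<Rightarrow> 'h \<Rightarrow> 'h) \<Rightarrow> 'h::euclidean_space l2 \<Rightarrow> 'h l2" where
  "diff_op N P x = (\<Sum>k\<le>N. mult_op (\<lambda>_. P k) ((wderiv ^^ k) x))"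

definition boundary_vec :: "'h::euclidean_space l2 \<Rightarrow> real \<Rightarrow> ('h, 'n::{finite, linorder}) vec" where
  "boundary_vec x t = (\<chi> j. cont_rep ((wderiv ^^ (pos j - 1)) x) t)"

definition boundary_map ::
    "'h::euclidean_space l2 \<Rightarrow> ('h, 'n::{finite, linorder}) vec \<times> ('h, 'n) vec" where
  "boundary_map x = (boundary_vec x 1, boundary_vec x 0)"

definition op_domain ::
    "(('h, 'n::{finite, linorder}) vec \<times> ('h, 'n) vec \<Rightarrow> ('h, 'n) vec) \<Rightarrow> 'h::euclidean_space l2 set" where
  "op_domain WB = {x \<in> sobolev CARD('n). WB (boundary_map x) = 0}"

definition Q_op ::
    "(nat \<Rightarrow> 'h \<Rightarrow> 'h) \<Rightarrow> ('h::euclidean_space, 'n) vec \<Rightarrow> ('h, 'n::{finite, linorder}) vec" where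
  "Q_op P u = (\<chi> i. \<Sum>j\<in>UNIV. if pos i + pos j \<le> CARD('n) + 1
      then (-1) ^ (pos i - 1) *\<^sub>R P (pos i + pos j - 1) (u $ j) else 0)"

definition W_op ::
    "(nat \<Rightarrow> 'h \<Rightarrow> 'h) \<Rightarrow> (('h::euclidean_space, 'n::{finite, linorder}) vec \<times> ('h, 'n) vec \<Rightarrow> ('h, 'n) vec)
      \<Rightarrow> (('h, 'n) vec \<times> ('h, 'n) vec \<Rightarrow> ('h, 'n) vec)" where
  "W_op P WB = WB \<circ> inv (\<lambda>(u, y). (Q_op P u - Q_op P y, u + y))"

end

theory Submission
  imports Defs "HOL-Computational_Algebra.Polynomial"
begin

text \<open>Write \<open>K = ker W\<close> and let \<open>\<langle>\<cdot>,\<cdot>\<rangle>\<close> be the real part of the inner product. The proof passes through two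
  equivalences: the semigroup is generated iff \<open>A\<close> is dissipative, and \<open>A\<close> is dissipative iff \<open>Re P\<^sub>0 \<le> 0\<close>
  and \<open>\<langle>f, e\<rangle> \<le> 0\<close> on \<open>K\<close>. The remaining statements are finite-dimensional reformulations of the second
  condition.

  \<^emph>\<open>Energy.\<close> Because of \<open>P\<^sub>k\<^sup>* = (-1)\<^sup>k\<^sup>+\<^sup>1 P\<^sub>k\<close>, integrating \<open>2 \<langle>P\<^sub>k x\<^sup>(\<^sup>k\<^sup>), x\<rangle>\<close> by parts \<open>k\<close> times returns the same
  integral with the opposite sign, so only boundary terms survive. They add up to \<open>u\<^sup>* Q u - y\<^sup>* Q y\<close>, where
  \<open>u\<close> and \<open>y\<close> collect the derivatives at \<open>1\<close> and \<open>0\<close> (\<open>energy_balance\<close>). In the variables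
  \<open>f = Q u - Q y\<close>, \<open>e = u + y\<close> the boundary form is \<open>\<langle>f, e\<rangle>\<close>. Every pair of boundary vectors is attained by
  functions of arbitrarily small \<open>L\<^sup>2\<close> norm (\<open>boundary_data_small_norm\<close>), so dissipativity forces the
  boundary form to be nonpositive by itself, while functions with zero boundary data isolate \<open>P\<^sub>0\<close>
  (\<open>dissipative_iff_boundary\<close>).

  \<^emph>\<open>Linear algebra.\<close> If \<open>\<langle>f, e\<rangle> \<le> 0\<close> on \<open>K\<close>, then \<open>W (u, u) = 0\<close> only for \<open>u = 0\<close>, so \<open>W\<^sub>1 + W\<^sub>2\<close> is invertible. As
  soon as it is, \<open>W\<close> has the form \<open>1/2 (W\<^sub>1 + W\<^sub>2) [I + V, I - V]\<close> with the Cayley-like operator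
  \<open>V = (W\<^sub>1 + W\<^sub>2)\<^sup>-\<^sup>1 (W\<^sub>1 - W\<^sub>2)\<close>, so that \<open>K\<close> consists of the pairs with \<open>f + e = - V (f - e)\<close>. Polarization,
  \<open>4 \<langle>f, e\<rangle> = \<parallel>f + e\<parallel>\<^sup>2 - \<parallel>f - e\<parallel>\<^sup>2\<close>, turns nonpositivity on \<open>K\<close> into \<open>\<parallel>V\<parallel> \<le> 1\<close>, and the same identity applied to
  the components of \<open>W\<^sup>* y\<close> turns \<open>W \<Sigma> W\<^sup>* \<ge> 0\<close> into \<open>\<parallel>V\<^sup>*\<parallel> \<le> 1\<close> (\<open>boundary_conditions_equivalent\<close>).

  \<^emph>\<open>Generation.\<close> A contraction semigroup has a dissipative generator, because \<open>\<langle>T(t) x - x, x\<rangle> \<le> 0\<close>. Conversely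
  a dissipative operator \<open>B\<close> on a Hilbert space for which every \<open>I - h B\<close>, \<open>h > 0\<close>, is onto generates a
  contraction semigroup (\<open>Lumer_Phillips\<close>). The semigroup is the limit of the implicit Euler scheme along
  dyadic step sizes; the only estimate needed is that two steps of lengths \<open>a\<close> and \<open>b\<close> differ from one step
  of length \<open>a + b\<close> by at most \<open>a b \<parallel>B\<^sup>2 x\<parallel>\<close>. Density of the domain follows from dissipativity and the
  range condition. For \<open>B = A \<H>\<close> the range condition is a linear boundary value problem with bounded
  measurable coefficients (\<open>boundary_value_problem\<close>): the initial value problem reduces to a Volterra
  equation for the highest derivative, and its solutions depend on as many parameters as there are boundary
  conditions, so uniqueness, which dissipativity provides, implies existence.

  \<^emph>\<open>Function spaces.\<close> All this rests on one description of the weak derivative: \<open>g\<close> is the weak derivative of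
  \<open>x\<close> iff \<open>x\<close> agrees almost everywhere with a constant plus the primitive of \<open>g\<close> (\<open>weak_deriv_iff_prim\<close>). It
  gives the continuous representatives, uniqueness of derivatives, and integration by parts, the latter from
  Fubini's theorem.\<close>
section \<open>Equivalent inner products\<close>

text \<open>An inner product on a complete space whose norm is equivalent to the given one. The semigroup has to
  be contractive for this norm, whereas completeness and convergence refer to the given one.\<close>

locale hilbert_form =
  fixes ip :: "'x::{complex_inner, complete_space} \<Rightarrow> 'x \<Rightarrow> complex"
  assumes ip_add_left: "ip (x + y) z = ip x z + ip y z"
    and ip_scaleC_left: "ip (c *\<^sub>C x) z = c * ip x z"
    and ip_commute: "ip x y = cnj (ip y x)"
    and ip_equivalent: "\<exists>K>0. \<forall>x. norm x \<le> K * ip_norm ip x \<and> ip_norm ip x \<le> K * norm x"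
    and ip_nonneg: "0 \<le> Re (ip x x)"
begin

abbreviation "nrm \<equiv> ip_norm ip"

definition re_ip :: "'x \<Rightarrow> 'x \<Rightarrow> real" where "re_ip x y = Re (ip x y)"

lemma re_ip_sym: "re_ip x y = re_ip y x"
  using ip_commute[of x y] by (simp add: re_ip_def)

lemma re_ip_add_left: "re_ip (x + y) z = re_ip x z + re_ip y z"
  by (simp add: re_ip_def ip_add_left)

lemma re_ip_add_right: "re_ip z (x + y) = re_ip z x + re_ip z y"
  by (metis re_ip_sym re_ip_add_left)

lemma re_ip_scaleR_left: "re_ip (r *\<^sub>R x) z = r * re_ip x z"
  by (simp add: re_ip_def ip_scaleC_left flip: scaleC_of_real)

lemma re_ip_scaleR_right: "re_ip z (r *\<^sub>R x) = r * re_ip z x"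
  by (metis re_ip_sym re_ip_scaleR_left)

lemma re_ip_diff_left: "re_ip (x - y) z = re_ip x z - re_ip y z"
  using re_ip_add_left[of x "(-1) *\<^sub>R y" z] re_ip_scaleR_left[of "-1" y z] by simp

lemma re_ip_diff_right: "re_ip z (x - y) = re_ip z x - re_ip z y"
  by (metis re_ip_sym re_ip_diff_left)

lemmas re_ip_simps = re_ip_add_left re_ip_add_right re_ip_scaleR_left re_ip_scaleR_right
  re_ip_diff_left re_ip_diff_right

lemma nrm_power2: "(nrm x)\<^sup>2 = re_ip x x"
  by (simp add: ip_norm_def re_ip_def ip_nonneg)

lemma nrm_nonneg [simp]: "0 \<le> nrm x"
  by (simp add: ip_norm_def ip_nonneg)

lemma nrm_scaleC: "nrm (c *\<^sub>C x) = cmod c * nrm x"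
proof -
  have "ip (c *\<^sub>C x) (c *\<^sub>C x) = c * cnj (c * ip x x)"
    by (metis ip_scaleC_left ip_commute)
  also have "\<dots> = of_real ((cmod c)\<^sup>2) * ip x x"
    by (metis ip_commute complex_cnj_mult complex_norm_square mult.assoc of_real_power)
  finally show ?thesis
    by (simp add: ip_norm_def real_sqrt_mult)
qed

lemma nrm_scaleR: "nrm (r *\<^sub>R x) = \<bar>r\<bar> * nrm x"
  by (simp add: nrm_scaleC flip: scaleC_of_real)

lemma nrm_minus_commute: "nrm (x - y) = nrm (y - x)"
  using nrm_scaleR[of "-1" "x - y"] by simp

lemma nrm_zero [simp]: "nrm 0 = 0"
  using nrm_scaleR[of 0 0] by simp

lemma Cauchy_Schwarz_re_ip: "re_ip x y \<le> nrm x * nrm y"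
proof (cases "nrm y = 0")
  case True
  obtain K where "norm y \<le> K * nrm y" using ip_equivalent by blast
  with True have "y = 0" by simp
  then show ?thesis using re_ip_scaleR_right[of x 0 0] by simp
next
  case False
  define s t where "s = nrm x" and "t = nrm y"
  have t: "t > 0" using False nrm_nonneg[of y] unfolding t_def by linarith
  have "0 \<le> re_ip (t *\<^sub>R x - s *\<^sub>R y) (t *\<^sub>R x - s *\<^sub>R y)"
    by (metis nrm_power2 zero_le_power2)
  also have "\<dots> = t\<^sup>2 * re_ip x x - 2 * (s * t) * re_ip x y + s\<^sup>2 * re_ip y y"
    by (simp add: re_ip_simps re_ip_sym[of y x] power2_eq_square algebra_simps)
  also have "\<dots> = 2 * (s * t) * (s * t - re_ip x y)"
    unfolding nrm_power2[symmetric] s_def[symmetric] t_def[symmetric]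
    by (simp add: power2_eq_square algebra_simps)
  finally have *: "0 \<le> (s * t) * (s * t - re_ip x y)" by simp
  show ?thesis
  proof (cases "s = 0")
    case True
    obtain K where "norm x \<le> K * nrm x" using ip_equivalent by blast
    with True have "x = 0" by (simp add: s_def)
    then show ?thesis using re_ip_scaleR_left[of 0 0 y] by simp
  next
    case False
    then have "s > 0" using nrm_nonneg[of x] unfolding s_def by linarith
    then have "s * t > 0" using t by simp
    with * show ?thesis by (simp add: zero_le_mult_iff s_def t_def)
  qed
qed

lemma nrm_triangle: "nrm (x + y) \<le> nrm x + nrm y"
proof (rule power2_le_imp_le)
  have "(nrm (x + y))\<^sup>2 = (nrm x)\<^sup>2 + 2 * re_ip x y + (nrm y)\<^sup>2"
    by (simp add: nrm_power2 re_ip_simps re_ip_sym[of y x])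
  also have "\<dots> \<le> (nrm x + nrm y)\<^sup>2"
    using Cauchy_Schwarz_re_ip[of x y] by (simp add: power2_sum)
  finally show "(nrm (x + y))\<^sup>2 \<le> (nrm x + nrm y)\<^sup>2" .
qed simp

lemma nrm_triangle_diff: "nrm (x - z) \<le> nrm (x - y) + nrm (y - z)"
  using nrm_triangle[of "x - y" "y - z"] by simp

lemma nrm_diff_le: "\<bar>nrm x - nrm y\<bar> \<le> nrm (x - y)"
  using nrm_triangle[of "x - y" y] nrm_triangle[of "y - x" x] by (simp add: nrm_minus_commute)

lemma nrm_eq_0_iff: "nrm x = 0 \<longleftrightarrow> x = 0"
proof
  assume *: "nrm x = 0"
  obtain K where "norm x \<le> K * nrm x" using ip_equivalent by blast
  with * show "x = 0" by simp
qed simp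

lemma tendsto_iff_nrm: "(f \<longlongrightarrow> l) F \<longleftrightarrow> ((\<lambda>n. nrm (f n - l)) \<longlongrightarrow> 0) F"
proof -
  obtain K where K: "K > 0" "\<And>x. norm x \<le> K * nrm x" "\<And>x. nrm x \<le> K * norm x"
    using ip_equivalent by blast
  show ?thesis
  proof
    assume "(f \<longlongrightarrow> l) F"
    then have "((\<lambda>n. K * norm (f n - l)) \<longlongrightarrow> 0) F"
      by (intro tendsto_mult_right_zero) (simp add: LIM_zero tendsto_norm_zero)
    then show "((\<lambda>n. nrm (f n - l)) \<longlongrightarrow> 0) F"
      by (rule Lim_null_comparison[rotated]) (use K in auto)
  next
    assume "((\<lambda>n. nrm (f n - l)) \<longlongrightarrow> 0) F"
    then have "((\<lambda>n. K * nrm (f n - l)) \<longlongrightarrow> 0) F"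
      by (rule tendsto_mult_right_zero)
    then have "((\<lambda>n. f n - l) \<longlongrightarrow> 0) F"
      by (rule Lim_null_comparison[rotated]) (use K in auto)
    then show "(f \<longlongrightarrow> l) F" by (rule LIM_zero_cancel)
  qed
qed

lemma tendsto_nrm: "(f \<longlongrightarrow> l) F \<Longrightarrow> ((\<lambda>n. nrm (f n)) \<longlongrightarrow> nrm l) F"
proof -
  assume "(f \<longlongrightarrow> l) F"
  then have "((\<lambda>n. nrm (f n - l)) \<longlongrightarrow> 0) F" by (simp add: tendsto_iff_nrm)
  then have "((\<lambda>n. nrm (f n) - nrm l) \<longlongrightarrow> 0) F"
    by (rule Lim_null_comparison[rotated]) (use nrm_diff_le in auto)
  then show ?thesis by (rule LIM_zero_cancel)
qed

text \<open>The form is a combination of two squared norms by polarization.\<close>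

lemma tendsto_re_ip:
  assumes "(f \<longlongrightarrow> l) F" "(g \<longlongrightarrow> k) F"
  shows "((\<lambda>n. re_ip (f n) (g n)) \<longlongrightarrow> re_ip l k) F"
proof -
  have eq: "re_ip x y = ((nrm (x + y))\<^sup>2 - (nrm (x - y))\<^sup>2) / 4" for x y
    by (simp add: nrm_power2 re_ip_simps re_ip_sym[of y x])
  show ?thesis
    unfolding eq by (intro tendsto_intros tendsto_nrm assms) simp
qed

lemma Cauchy_nrm_convergent:
  fixes X :: "nat \<Rightarrow> 'x"
  assumes "\<And>e. e > 0 \<Longrightarrow> \<exists>M. \<forall>m\<ge>M. \<forall>n\<ge>M. nrm (X m - X n) < e"
  shows "convergent X"
proof -
  obtain K where K: "K > 0" "\<And>x. norm x \<le> K * nrm x"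
    using ip_equivalent by blast
  have "Cauchy X"
  proof (rule CauchyI)
    fix e :: real assume "e > 0"
    then have "e / K > 0" using K by simp
    from assms[OF this] obtain M where "\<forall>m\<ge>M. \<forall>n\<ge>M. nrm (X m - X n) < e / K" by blast
    then have "norm (X m - X n) < e" if "m \<ge> M" "n \<ge> M" for m n
      using K that order_le_less_trans[OF K(2)[of "X m - X n"]] by (simp add: pos_less_divide_eq mult.commute)
    then show "\<exists>M. \<forall>m\<ge>M. \<forall>n\<ge>M. norm (X m - X n) < e" by blast
  qed
  then show ?thesis by (simp add: Cauchy_convergent_iff)
qed

end

section \<open>The implicit Euler scheme\<close>

locale m_dissipative = hilbert_form ip
  for ip :: "'x::{complex_inner, complete_space} \<Rightarrow> 'x \<Rightarrow> complex" +
  fixes D :: "'x set" and B :: "'x \<Rightarrow> 'x"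
  assumes D_add: "x \<in> D \<Longrightarrow> y \<in> D \<Longrightarrow> x + y \<in> D"
    and D_scaleC: "x \<in> D \<Longrightarrow> c *\<^sub>C x \<in> D"
    and B_add: "x \<in> D \<Longrightarrow> y \<in> D \<Longrightarrow> B (x + y) = B x + B y"
    and B_scaleC: "x \<in> D \<Longrightarrow> B (c *\<^sub>C x) = c *\<^sub>C B x"
    and dissipative: "x \<in> D \<Longrightarrow> Re (ip x (B x)) \<le> 0"
    and range_resolvent: "h > 0 \<Longrightarrow> \<exists>x\<in>D. x - h *\<^sub>R B x = f"
begin

lemma D_scaleR: "x \<in> D \<Longrightarrow> r *\<^sub>R x \<in> D"
  using D_scaleC[of x "of_real r"] by (simp add: scaleC_of_real)

lemma B_scaleR: "x \<in> D \<Longrightarrow> B (r *\<^sub>R x) = r *\<^sub>R B x"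
  using B_scaleC[of x "of_real r"] by (simp add: scaleC_of_real)

lemma D_diff: "x \<in> D \<Longrightarrow> y \<in> D \<Longrightarrow> x - y \<in> D"
  using D_add[of x "(-1) *\<^sub>R y"] D_scaleR[of y "-1"] by simp

lemma B_diff: "x \<in> D \<Longrightarrow> y \<in> D \<Longrightarrow> B (x - y) = B x - B y"
  using B_add[of x "(-1) *\<^sub>R y"] D_scaleR[of y "-1"] B_scaleR[of y "-1"] by simp

lemma dissipative_re_ip: "x \<in> D \<Longrightarrow> re_ip (B x) x \<le> 0"
  using dissipative re_ip_sym[of "B x" x] by (simp add: re_ip_def)

lemma resolvent_bound:
  assumes "x \<in> D" "h > 0" shows "nrm x \<le> nrm (x - h *\<^sub>R B x)"
proof (cases "nrm x = 0")
  case False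
  have "h * re_ip (B x) x \<le> 0"
    using dissipative_re_ip[OF assms(1)] assms(2) by (simp add: mult_nonneg_nonpos)
  then have "(nrm x)\<^sup>2 \<le> re_ip (x - h *\<^sub>R B x) x"
    by (simp add: nrm_power2 re_ip_simps)
  also have "\<dots> \<le> nrm (x - h *\<^sub>R B x) * nrm x" by (rule Cauchy_Schwarz_re_ip)
  finally show ?thesis
    using False nrm_nonneg[of x] by (simp add: power2_eq_square)
qed simp

lemma resolvent_unique:
  assumes "x \<in> D" "y \<in> D" "h > 0" "x - h *\<^sub>R B x = y - h *\<^sub>R B y"
  shows "x = y"
proof -
  have "(x - y) - h *\<^sub>R B (x - y) = 0"
    using assms by (simp add: B_diff algebra_simps)
  then have "nrm (x - y) \<le> 0"
    using resolvent_bound[of "x - y" h] assms D_diff by simp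
  then show ?thesis using nrm_nonneg[of "x - y"] nrm_eq_0_iff[of "x - y"] by simp
qed

text \<open>The resolvent \<open>(I - h B)\<^sup>-\<^sup>1\<close>, that is, one step of the implicit Euler scheme; the step of
  length zero is the identity.\<close>

definition J :: "real \<Rightarrow> 'x \<Rightarrow> 'x" where
  "J h f = (if h \<le> 0 then f else (THE x. x \<in> D \<and> x - h *\<^sub>R B x = f))"

lemma J_nonpos: "h \<le> 0 \<Longrightarrow> J h f = f"
  by (simp add: J_def)

lemma J_spec:
  assumes "h > 0" shows "J h f \<in> D \<and> J h f - h *\<^sub>R B (J h f) = f"
proof -
  have "\<exists>!x. x \<in> D \<and> x - h *\<^sub>R B x = f"
    using range_resolvent[OF assms] resolvent_unique[OF _ _ assms] by (metis)
  then have "(THE x. x \<in> D \<and> x - h *\<^sub>R B x = f) \<in> D \<and>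
      (THE x. x \<in> D \<and> x - h *\<^sub>R B x = f) - h *\<^sub>R B (THE x. x \<in> D \<and> x - h *\<^sub>R B x = f) = f"
    by (rule theI')
  then show ?thesis using assms by (simp add: J_def)
qed

lemma B_J_eq: "h > 0 \<Longrightarrow> h *\<^sub>R B (J h f) = J h f - f"
proof -
  assume "h > 0"
  then have "J h f - h *\<^sub>R B (J h f) = f" using J_spec by blast
  moreover have "h *\<^sub>R B (J h f) = J h f - (J h f - h *\<^sub>R B (J h f))" by simp
  ultimately show ?thesis by simp
qed

lemma J_eqI: "h > 0 \<Longrightarrow> x \<in> D \<Longrightarrow> x - h *\<^sub>R B x = f \<Longrightarrow> J h f = x"
  using J_spec resolvent_unique by metis

lemma J_contraction: "nrm (J h f) \<le> nrm f"
  using J_spec[of h f] resolvent_bound[of "J h f" h] by (cases "h > 0") (auto simp: J_nonpos)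

lemma J_add: "J h (x + y) = J h x + J h y"
proof (cases "h > 0")
  case True
  note * = J_spec[OF True, of x] J_spec[OF True, of y]
  have "J h x + J h y - h *\<^sub>R (B (J h x) + B (J h y)) =
      (J h x - h *\<^sub>R B (J h x)) + (J h y - h *\<^sub>R B (J h y))"
    by (simp add: algebra_simps)
  with * show ?thesis
    by (intro J_eqI True) (simp_all add: D_add B_add)
qed (simp add: J_nonpos)

lemma J_scaleC: "J h (c *\<^sub>C x) = c *\<^sub>C J h x"
proof (cases "h > 0")
  case True
  note * = J_spec[OF True, of x]
  have "c *\<^sub>C J h x - h *\<^sub>R c *\<^sub>C B (J h x) = c *\<^sub>C (J h x - h *\<^sub>R B (J h x))"
    by (simp add: linear_diff[OF linear_scaleC] scaleC_scaleR)
  with * show ?thesis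
    by (intro J_eqI True) (auto simp: D_scaleC B_scaleC)
qed (simp add: J_nonpos)

lemma J_scaleR: "J h (r *\<^sub>R x) = r *\<^sub>R J h x"
  using J_scaleC[of h "of_real r" x] by (simp add: scaleC_of_real)

lemma J_diff: "J h (x - y) = J h x - J h y"
  using J_add[of h x "(-1) *\<^sub>R y"] J_scaleR[of h "-1" y] by simp

lemma J_D: "x \<in> D \<Longrightarrow> J h x \<in> D"
  using J_spec[of h x] by (cases "h > 0") (auto simp: J_nonpos)

lemma B_J:
  assumes "x \<in> D" shows "B (J h x) = J h (B x)"
proof (cases "h > 0")
  case True
  define y where "y = J h x"
  have y: "y \<in> D" "y - h *\<^sub>R B y = x" using J_spec[OF True] by (auto simp: y_def)
  have "B y = (1/h) *\<^sub>R (h *\<^sub>R B y)" using True by simp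
  also have "h *\<^sub>R B y = y - x" unfolding y_def by (rule B_J_eq[OF True])
  finally have "B y = (1/h) *\<^sub>R (y - x)" .
  then have By: "B y \<in> D" using assms y by (simp add: D_diff D_scaleR)
  have "B y - h *\<^sub>R B (B y) = B (y - h *\<^sub>R B y)"
    using y(1) By by (simp add: B_diff B_scaleR D_scaleR)
  then have "B y - h *\<^sub>R B (B y) = B x" by (simp only: y(2))
  then have "J h (B x) = B y" by (rule J_eqI[OF True By])
  then show ?thesis unfolding y_def by (rule sym)
qed (simp add: J_nonpos)

lemma J_commute: "J a (J b x) = J b (J a x)"
proof (cases "b > 0")
  case b: True
  define u where "u = J b x"
  have u: "u \<in> D" "u - b *\<^sub>R B u = x" using J_spec[OF b] by (auto simp: u_def)
  have "J a u - b *\<^sub>R B (J a u) = J a (u - b *\<^sub>R B u)"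
    using u(1) by (simp add: B_J J_diff J_scaleR)
  then have "J a u - b *\<^sub>R B (J a u) = J a x" by (simp add: u(2))
  then have "J b (J a x) = J a u"
    using u J_D b by (intro J_eqI) auto
  then show ?thesis by (simp add: u_def)
qed (simp add: J_nonpos)

lemma J_minus_id:
  assumes "x \<in> D" "h \<ge> 0" shows "J h x - x = h *\<^sub>R J h (B x)"
proof (cases "h > 0")
  case True
  show ?thesis using B_J_eq[OF True, of x] B_J[OF assms(1), of h] by simp
qed (use assms in \<open>simp add: J_nonpos\<close>)

lemma J_minus_id_bound: "x \<in> D \<Longrightarrow> h \<ge> 0 \<Longrightarrow> nrm (J h x - x) \<le> h * nrm (B x)"
  using J_minus_id[of x h] by (simp add: nrm_scaleR J_contraction mult_left_mono)

text \<open>Two steps of lengths \<open>a\<close> and \<open>b\<close> differ from one of length \<open>a + b\<close> in second order only,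
  because \<open>(I - a B) (I - b B) = I - (a + b) B + a b B\<^sup>2\<close>.\<close>

lemma J_local_error:
  assumes x: "x \<in> D" "B x \<in> D" and "a \<ge> 0" "b \<ge> 0"
  shows "nrm (J a (J b x) - J (a + b) x) \<le> a * b * nrm (B (B x))"
proof (cases "a > 0 \<and> b > 0")
  case True
  then have a: "a > 0" and b: "b > 0" and c: "a + b > 0" by auto
  define u z where "u = J b x" and "z = J a u"
  have u: "u \<in> D" "u - b *\<^sub>R B u = x" using J_spec[OF b] by (auto simp: u_def)
  have z: "z \<in> D" "z - a *\<^sub>R B z = u" using J_spec[OF a] by (auto simp: z_def)
  have Bz: "B z = J a (J b (B x))" using x u by (simp add: z_def u_def B_J)
  have BzD: "B z \<in> D" unfolding Bz by (intro J_D x)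
  have BBz: "B (B z) = J a (J b (B (B x)))" unfolding Bz using x by (simp add: B_J J_D)
  have "B u = B z - a *\<^sub>R B (B z)"
    using z BzD by (metis B_diff B_scaleR D_scaleR)
  then have "u - b *\<^sub>R (B z - a *\<^sub>R B (B z)) = x" using u by simp
  then have "z - (a + b) *\<^sub>R B z = x - (a * b) *\<^sub>R B (B z)"
    unfolding z(2)[symmetric] by (simp add: algebra_simps)
  then have "J (a + b) (x - (a * b) *\<^sub>R B (B z)) = z"
    using z by (intro J_eqI c) auto
  then have "J a (J b x) - J (a + b) x = - ((a * b) *\<^sub>R J (a + b) (B (B z)))"
    by (simp add: J_diff J_scaleR z_def u_def algebra_simps)
  then have "nrm (J a (J b x) - J (a + b) x) = (a * b) * nrm (J (a + b) (B (B z)))"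
    using a b nrm_scaleR[of "-(a * b)" "J (a + b) (B (B z))"] by simp
  also have "\<dots> \<le> (a * b) * nrm (B (B x))"
    unfolding BBz using a b
    by (intro mult_left_mono) (auto intro: order_trans[OF J_contraction])
  finally show ?thesis .
next
  case False
  with assms have "a = 0 \<or> b = 0" by auto
  then show ?thesis by (auto simp: J_nonpos)
qed

lemma J_pow_contraction: "nrm ((J h ^^ n) x) \<le> nrm x"
  by (induction n) (auto intro: order_trans[OF J_contraction])

lemma J_pow_add: "(J h ^^ n) (x + y) = (J h ^^ n) x + (J h ^^ n) y"
  by (induction n) (auto simp: J_add)

lemma J_pow_scaleC: "(J h ^^ n) (c *\<^sub>C x) = c *\<^sub>C (J h ^^ n) x"
  by (induction n) (auto simp: J_scaleC)

lemma J_pow_diff: "(J h ^^ n) (x - y) = (J h ^^ n) x - (J h ^^ n) y"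
  by (induction n) (auto simp: J_diff)

lemma J_pow_D: "x \<in> D \<Longrightarrow> (J h ^^ n) x \<in> D"
  by (induction n) (auto simp: J_D)

lemma B_J_pow: "x \<in> D \<Longrightarrow> B ((J h ^^ n) x) = (J h ^^ n) (B x)"
  by (induction n) (auto simp: J_pow_D B_J)

lemma J_pow_commute: "(J a ^^ n) (J b x) = J b ((J a ^^ n) x)"
  by (induction n) (auto simp: J_commute)

lemma J_pow_zero: "(J 0 ^^ n) x = x"
  by (induction n) (auto simp: J_nonpos)

text \<open>The local errors accumulate at most linearly, since the steps are contractions commuting with \<open>B\<close>.\<close>

lemma J_pow_error:
  assumes x: "x \<in> D" "B x \<in> D" and "a \<ge> 0" "b \<ge> 0"
  shows "nrm ((J a ^^ n) ((J b ^^ n) x) - (J (a + b) ^^ n) x) \<le> real n * (a * b * nrm (B (B x)))"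
proof (induction n)
  case (Suc n)
  define y where "y = (J (a + b) ^^ n) x"
  have y: "y \<in> D" "B y \<in> D" using x by (auto simp: y_def B_J_pow J_pow_D)
  have BBy: "nrm (B (B y)) \<le> nrm (B (B x))"
    using x by (simp add: y_def B_J_pow J_pow_D J_pow_contraction)
  have eq: "(J a ^^ Suc n) ((J b ^^ Suc n) x) - (J (a + b) ^^ Suc n) x =
      J a (J b ((J a ^^ n) ((J b ^^ n) x) - y)) + (J a (J b y) - J (a + b) y)"
    by (simp add: J_pow_commute J_diff y_def)
  have "nrm ((J a ^^ Suc n) ((J b ^^ Suc n) x) - (J (a + b) ^^ Suc n) x) \<le>
      nrm ((J a ^^ n) ((J b ^^ n) x) - y) + nrm (J a (J b y) - J (a + b) y)"
    unfolding eq
    by (rule order_trans[OF nrm_triangle add_right_mono[OF order_trans[OF J_contraction J_contraction]]])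
  also have "\<dots> \<le> real n * (a * b * nrm (B (B x))) + a * b * nrm (B (B y))"
    using add_mono[OF Suc.IH J_local_error[OF y assms(3,4)]] by (simp only: y_def)
  also have "\<dots> \<le> real n * (a * b * nrm (B (B x))) + a * b * nrm (B (B x))"
    using mult_left_mono[OF BBy, of "a * b"] assms by simp
  finally show ?case by (simp add: algebra_simps)
qed simp

lemma J_pow_minus_id:
  assumes "x \<in> D" "h \<ge> 0" shows "nrm ((J h ^^ n) x - x) \<le> real n * (h * nrm (B x))"
proof (induction n)
  case (Suc n)
  have "nrm ((J h ^^ Suc n) x - x) \<le> nrm (J h ((J h ^^ n) x) - J h x) + nrm (J h x - x)"
    using nrm_triangle_diff[of "(J h ^^ Suc n) x" x "J h x"] by simp
  also have "\<dots> \<le> nrm ((J h ^^ n) x - x) + h * nrm (B x)"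
    using assms by (intro add_mono J_minus_id_bound) (auto simp: J_contraction simp flip: J_diff)
  also have "\<dots> \<le> real (Suc n) * (h * nrm (B x))"
    using Suc.IH by (simp add: algebra_simps)
  finally show ?case .
qed simp

text \<open>First-order Taylor expansion of the scheme with a remainder that depends on \<open>n h\<close> only, and therefore
  survives in the limit. It identifies the generator.\<close>

lemma J_pow_taylor:
  assumes x: "x \<in> D" "B x \<in> D" and h: "h \<ge> 0"
  shows "nrm ((J h ^^ n) x - x - (real n * h) *\<^sub>R B x) \<le> (real n)\<^sup>2 * h\<^sup>2 * nrm (B (B x))"
proof (induction n)
  case (Suc n)
  have "(J h ^^ Suc n) x - (J h ^^ n) x = (J h ^^ n) (J h x - x)"
    by (simp add: J_pow_diff J_pow_commute)
  also have "\<dots> = h *\<^sub>R (J h ^^ Suc n) (B x)"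
    using x h J_pow_scaleC[of n h "of_real h"]
    by (simp add: J_minus_id scaleC_of_real J_pow_commute)
  finally have 1: "(J h ^^ Suc n) x = (J h ^^ n) x + h *\<^sub>R (J h ^^ Suc n) (B x)"
    by (simp add: algebra_simps)
  have eq: "(J h ^^ Suc n) x - x - (real (Suc n) * h) *\<^sub>R B x =
     ((J h ^^ n) x - x - (real n * h) *\<^sub>R B x) + h *\<^sub>R ((J h ^^ Suc n) (B x) - B x)"
    unfolding 1 by (simp add: algebra_simps)
  have "nrm ((J h ^^ Suc n) x - x - (real (Suc n) * h) *\<^sub>R B x) \<le>
      (real n)\<^sup>2 * h\<^sup>2 * nrm (B (B x)) + h * (real (Suc n) * (h * nrm (B (B x))))"
    unfolding eq using h x Suc.IH J_pow_minus_id[OF x(2) h, of "Suc n"]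
    by (intro order_trans[OF nrm_triangle] add_mono) (auto simp: nrm_scaleR mult_left_mono simp del: funpow.simps)
  also have "\<dots> = ((real n)\<^sup>2 + real n + 1) * (h\<^sup>2 * nrm (B (B x)))"
    by (simp add: algebra_simps power2_eq_square)
  also have "\<dots> \<le> (real (Suc n))\<^sup>2 * (h\<^sup>2 * nrm (B (B x)))"
    by (intro mult_right_mono mult_nonneg_nonneg) (auto simp: power2_eq_square algebra_simps)
  finally show ?case by (simp add: mult.assoc)
qed simp

end

context m_dissipative begin

text \<open>With \<open>p = J\<^sub>k x - x = k B (J\<^sub>k x)\<close> and \<open>q = J\<^sub>h x - x = h B (J\<^sub>h x)\<close>, dissipativity at \<open>J\<^sub>k x - J\<^sub>h x = p - q\<close> reads
  \<open>\<langle>p / k - q / h, p - q\<rangle> \<le> 0\<close>. Hence the norms of the increments decrease with the step size, and the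
  differences of increments are controlled by differences of these norms.\<close>

lemma resolvent_monotone:
  assumes h: "0 < h" "h < k"
  shows "(nrm (J k x - J h x))\<^sup>2 \<le> (nrm (J k x - x))\<^sup>2 - (nrm (J h x - x))\<^sup>2"
proof -
  define p q where "p = J k x - x" and "q = J h x - x"
  have k: "k > 0" using h by simp
  have D: "J k x \<in> D" "J h x \<in> D" using J_spec h k by auto
  have Bp: "p = k *\<^sub>R B (J k x)" and Bq: "q = h *\<^sub>R B (J h x)"
    unfolding p_def q_def using B_J_eq[OF k] B_J_eq[OF h(1)] by simp_all
  have pq: "J k x - J h x = p - q" by (simp add: p_def q_def)
  have "re_ip (B (J k x) - B (J h x)) (p - q) \<le> 0"
    using dissipative_re_ip[OF D_diff[OF D]] unfolding pq[symmetric] B_diff[OF D] .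
  moreover have "re_ip (h *\<^sub>R p - k *\<^sub>R q) (p - q) = (h * k) * re_ip (B (J k x) - B (J h x)) (p - q)"
    unfolding Bp Bq by (simp add: re_ip_simps algebra_simps)
  ultimately have "re_ip (h *\<^sub>R p - k *\<^sub>R q) (p - q) \<le> 0"
    using h k by (simp add: mult_nonneg_nonpos)
  then have *: "h * re_ip p p + k * re_ip q q \<le> (h + k) * re_ip p q"
    by (simp add: re_ip_simps re_ip_sym[of q p] algebra_simps)
  have "re_ip q q \<le> re_ip p p"
  proof -
    have "0 \<le> re_ip (p - q) (p - q)" by (metis nrm_power2 zero_le_power2)
    then have "2 * re_ip p q \<le> re_ip p p + re_ip q q"
      by (simp add: re_ip_simps re_ip_sym[of q p])
    then have "(h + k) * (2 * re_ip p q) \<le> (h + k) * (re_ip p p + re_ip q q)"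
      using h by (intro mult_left_mono) auto
    with * have "(k - h) * re_ip q q \<le> (k - h) * re_ip p p" by (simp add: algebra_simps)
    then show ?thesis using h by simp
  qed
  then have "h * (2 * re_ip q q) \<le> h * (2 * re_ip p p)" using h by simp
  then have "(h + k) * (2 * re_ip q q) \<le> 2 * (h * re_ip p p + k * re_ip q q)"
    by (simp add: algebra_simps)
  also have "\<dots> \<le> (h + k) * (2 * re_ip p q)" using * by simp
  finally have "re_ip q q \<le> re_ip p q" using h by simp
  then have "re_ip (p - q) (p - q) \<le> re_ip p p - re_ip q q"
    by (simp add: re_ip_simps re_ip_sym[of q p])
  then show ?thesis
    unfolding nrm_power2 pq p_def[symmetric] q_def[symmetric] .
qed

text \<open>By the preceding inequality the increments \<open>p\<^sub>n = J\<^sub>h x - x\<close> form a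
  Cauchy sequence as \<open>h\<close> tends to \<open>0\<close>. Their limit \<open>p\<^sub>0\<close> satisfies \<open>\<langle>p\<^sub>0, p\<^sub>0 + x - d\<rangle> \<le> 0\<close> for all \<open>d\<close> in the
  domain, which is a subspace, so \<open>p\<^sub>0\<close> is orthogonal to the domain. Solving \<open>d - B d = p\<^sub>0\<close> shows that only
  \<open>p\<^sub>0 = 0\<close> is possible, that is, the vectors \<open>J\<^sub>h x\<close> of the domain converge to \<open>x\<close>.\<close>

lemma D_dense:
  assumes "e > 0" shows "\<exists>y\<in>D. nrm (y - x) < e"
proof -
  define h :: "nat \<Rightarrow> real" where "h n = 1 / real (Suc n)" for n
  have h: "h n > 0" for n by (simp add: h_def)
  have h_less: "h n < h m" if "m < n" for m n
    using that by (simp add: h_def divide_strict_left_mono)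
  have h0: "h \<longlonglongrightarrow> 0" unfolding h_def using LIMSEQ_inverse_real_of_nat by (simp add: inverse_eq_divide)
  define p where "p n = J (h n) x - x" for n
  have mono: "(nrm (p m - p n))\<^sup>2 \<le> (nrm (p m))\<^sup>2 - (nrm (p n))\<^sup>2" if "m \<le> n" for m n
  proof (cases "m = n")
    case False
    then show ?thesis
      using resolvent_monotone[OF h h_less, of m n x] that by (simp add: p_def)
  qed simp
  define s where "s n = (nrm (p n))\<^sup>2" for n
  have "decseq s"
    unfolding decseq_def s_def using mono by (smt (verit) zero_le_power2)
  moreover have "0 \<le> s n" for n by (simp add: s_def)
  ultimately obtain l where "s \<longlonglongrightarrow> l"
    using decseq_convergent[of s 0] by blast
  then have Cs: "Cauchy s" by (simp add: LIMSEQ_imp_Cauchy)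
  have "convergent p"
  proof (rule Cauchy_nrm_convergent)
    fix e :: real assume "e > 0"
    then obtain M where M: "\<And>m n. m \<ge> M \<Longrightarrow> n \<ge> M \<Longrightarrow> norm (s m - s n) < e\<^sup>2"
      using CauchyD[OF Cs, of "e\<^sup>2"] by auto
    have "nrm (p m - p n) < e" if "m \<ge> M" "n \<ge> M" "m \<le> n" for m n
    proof (rule power2_less_imp_less)
      show "(nrm (p m - p n))\<^sup>2 < e\<^sup>2"
        using mono[OF that(3)] M[OF that(1,2)] unfolding s_def real_norm_def by linarith
    qed (use \<open>e > 0\<close> in simp)
    note * = this
    have "nrm (p m - p n) < e" if "m \<ge> M" "n \<ge> M" for m n
      using that *[of m n] *[of n m] nrm_minus_commute[of "p m" "p n"] by (cases "m \<le> n") auto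
    then show "\<exists>M. \<forall>m\<ge>M. \<forall>n\<ge>M. nrm (p m - p n) < e" by blast
  qed
  then obtain p0 where p0: "p \<longlonglongrightarrow> p0" by (auto simp: convergent_def)
  have le: "re_ip p0 (p0 + x - d) \<le> 0" if d: "d \<in> D" for d
  proof -
    have "re_ip (p n - h n *\<^sub>R B d) (p n + x - d) \<le> 0" for n
    proof -
      have D: "J (h n) x \<in> D" using J_spec[OF h] by blast
      have "re_ip (h n *\<^sub>R B (J (h n) x - d)) (J (h n) x - d) \<le> 0"
        using dissipative_re_ip[OF D_diff[OF D d]] h[of n]
        by (simp add: re_ip_simps mult_nonneg_nonpos)
      then show ?thesis
        using B_J_eq[OF h, of n x] by (simp add: B_diff[OF D d] p_def scaleR_diff_right)
    qed
    moreover have "(\<lambda>n. re_ip (p n - h n *\<^sub>R B d) (p n + x - d)) \<longlonglongrightarrow> re_ip (p0 - 0 *\<^sub>R B d) (p0 + x - d)"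
      by (intro tendsto_re_ip tendsto_intros p0 h0)
    ultimately show ?thesis
      using LIMSEQ_le_const2 by fastforce
  qed
  have orth: "re_ip p0 d = 0" if d: "d \<in> D" for d
  proof (rule ccontr)
    assume nz: "re_ip p0 d \<noteq> 0"
    \<comment> \<open>chosen so that the inequality at \<open>r d\<close> would read \<open>1 \<le> 0\<close>\<close>
    define r where "r = (re_ip p0 (p0 + x) - 1) / re_ip p0 d"
    have "re_ip p0 (p0 + x - r *\<^sub>R d) \<le> 0" using le[OF D_scaleR[OF d]] .
    then show False using nz by (simp add: re_ip_diff_right re_ip_scaleR_right r_def)
  qed
  define d where "d = J 1 p0"
  have d: "d \<in> D" "d - B d = p0" using J_spec[of 1 p0] by (auto simp: d_def)
  have "re_ip d d = re_ip (B d) d"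
    using orth[OF d(1)] d(2) by (metis re_ip_diff_left right_minus_eq)
  then have "nrm d = 0" using dissipative_re_ip[OF d(1)] nrm_power2[of d]
    by (metis le_less not_le power_eq_0_iff zero_le_power2)
  then have "d = 0" by (simp add: nrm_eq_0_iff)
  then have "p0 = 0" using d(2) orth[OF d(1)] B_scaleR[OF d(1), of 0] by simp
  then have "(\<lambda>n. J (h n) x) \<longlonglongrightarrow> x"
    using p0 unfolding p_def by (simp add: LIM_zero_cancel)
  then have "(\<lambda>n. nrm (J (h n) x - x)) \<longlonglongrightarrow> 0" by (simp add: tendsto_iff_nrm)
  then have "\<forall>\<^sub>F n in sequentially. nrm (J (h n) x - x) < e"
    using assms by (rule order_tendstoD)
  then obtain n where "nrm (J (h n) x - x) < e" by (auto simp: eventually_sequentially)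
  then show ?thesis using J_spec[OF h] by blast
qed

text \<open>The approximation is \<open>y = J\<^sub>h x\<close>, for which \<open>B y = J\<^sub>h (B x)\<close>. The second estimate needs \<open>J\<^sub>h\<close> close to the
  identity at \<open>B x\<close>, which is only known to be a limit of vectors \<open>z\<close> of the domain.\<close>

lemma D2_graph_dense:
  assumes "x \<in> D" "e > 0"
  shows "\<exists>y\<in>D. B y \<in> D \<and> nrm (y - x) < e \<and> nrm (B y - B x) < e"
proof -
  obtain z where z: "z \<in> D" "nrm (z - B x) < e / 3" using D_dense[of "e/3" "B x"] assms by auto
  \<comment> \<open>small enough to move both \<open>x\<close> and \<open>z\<close> by less than the tolerance\<close>
  define h where "h = min (e / (2 * (nrm (B x) + 1))) (e / (3 * (nrm (B z) + 1)))"
  have pos: "nrm (B x) + 1 > 0" "nrm (B z) + 1 > 0" using nrm_nonneg[of "B x"] nrm_nonneg[of "B z"] by linarith+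
  then have h: "h > 0" using assms by (simp add: h_def)
  have "h * nrm (B x) < e"
  proof -
    have "h * (nrm (B x) + 1) \<le> e / (2 * (nrm (B x) + 1)) * (nrm (B x) + 1)"
      using pos by (intro mult_right_mono) (auto simp: h_def)
    also have "\<dots> = e / 2" using pos by (simp add: field_simps)
    finally show ?thesis using assms h by (simp add: algebra_simps)
  qed
  then have 1: "nrm (J h x - x) < e" using J_minus_id_bound[OF assms(1), of h] h by simp
  have "h * nrm (B z) < e / 3"
  proof -
    have "h * (nrm (B z) + 1) \<le> e / (3 * (nrm (B z) + 1)) * (nrm (B z) + 1)"
      using pos by (intro mult_right_mono) (auto simp: h_def)
    also have "\<dots> = e / 3" using pos by (simp add: field_simps)
    finally show ?thesis using assms h by (simp add: algebra_simps)
  qed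
  then have "nrm (J h z - z) < e / 3" using J_minus_id_bound[OF z(1), of h] h by simp
  moreover have "nrm (J h (B x) - J h z) < e / 3"
    using J_contraction[of h "B x - z"] z(2) nrm_minus_commute[of z "B x"] by (simp add: J_diff)
  ultimately have "nrm (J h (B x) - B x) < e"
    using nrm_triangle_diff[of "J h (B x)" "B x" "J h z"] nrm_triangle_diff[of "J h z" "B x" z] z(2)
    by linarith
  then have 2: "nrm (B (J h x) - B x) < e" using assms by (simp add: B_J)
  have "J h x \<in> D" "B (J h x) \<in> D" using J_spec[OF h] assms by (auto simp: B_J)
  with 1 2 show ?thesis by blast
qed

lemma D2_dense:
  assumes "e > 0" shows "\<exists>y\<in>D. B y \<in> D \<and> nrm (y - x) < e"
proof -
  obtain z where z: "z \<in> D" "nrm (z - x) < e / 2" using D_dense[of "e/2" x] assms by auto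
  obtain y where y: "y \<in> D" "B y \<in> D" "nrm (y - z) < e / 2"
    using D2_graph_dense[OF z(1), of "e/2"] assms by auto
  have "nrm (y - x) < e" using nrm_triangle_diff[of y x z] y z by linarith
  with y show ?thesis by blast
qed

text \<open>The approximate solution after \<open>2\<^sup>m\<close> implicit Euler steps. Halving the step doubles the number of steps,
  so consecutive approximations can be compared step by step.\<close>

definition euler :: "nat \<Rightarrow> real \<Rightarrow> 'x \<Rightarrow> 'x" where
  "euler m t = J (t / 2 ^ m) ^^ (2 ^ m)"

lemma euler_contraction: "nrm (euler m t x) \<le> nrm x"
  by (simp add: euler_def J_pow_contraction)

lemma euler_diff: "euler m t (x - y) = euler m t x - euler m t y"
  by (simp add: euler_def J_pow_diff)

text \<open>The case \<open>s = t\<close> makes the scheme converge, the general case gives the semigroup law of the limit.\<close>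

lemma euler_product_error:
  assumes "x \<in> D" "B x \<in> D" "s \<ge> 0" "t \<ge> 0"
  shows "nrm (euler m s (euler m t x) - euler m (s + t) x) \<le> (s * t * nrm (B (B x))) / 2 ^ m"
proof -
  have "nrm (euler m s (euler m t x) - euler m (s + t) x) \<le>
      real (2 ^ m) * (s / 2 ^ m * (t / 2 ^ m) * nrm (B (B x)))"
    using J_pow_error[OF assms(1,2), of "s / 2^m" "t / 2^m" "2^m"] assms
    by (simp add: euler_def add_divide_distrib)
  then show ?thesis by (simp add: field_simps)
qed

lemma euler_Suc: "euler (Suc m) t x = euler m (t / 2) (euler m (t / 2) x)"
proof -
  have "(J h ^^ (2 * n)) x = (J h ^^ n) ((J h ^^ n) x)" for h n
    by (simp add: mult_2 funpow_add)
  then show ?thesis by (simp add: euler_def)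
qed

text \<open>On vectors with \<open>B\<^sup>2 y\<close> defined the increments are of order \<open>2\<^sup>-\<^sup>m\<close>; these vectors are dense and all
  approximations are contractions.\<close>

lemma euler_convergent:
  assumes t: "t \<ge> 0" shows "convergent (\<lambda>m. euler m t x)"
proof (rule Cauchy_nrm_convergent)
  fix e :: real assume e: "e > 0"
  obtain y where y: "y \<in> D" "B y \<in> D" "nrm (y - x) < e / 4"
    using D2_dense[of "e/4" x] e by auto
  define C where "C = t\<^sup>2 * nrm (B (B y))"
  have step: "nrm (euler (Suc m) t y - euler m t y) \<le> C / 2 ^ Suc m" for m
  proof -
    have "nrm (euler (Suc m) t y - euler m t y) \<le> (t / 2 * (t / 2) * nrm (B (B y))) / 2 ^ m"
      using euler_product_error[OF y(1,2), of "t/2" "t/2" m] t by (simp add: euler_Suc)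
    also have "\<dots> = (C / 2) / 2 ^ Suc m" by (simp add: C_def power2_eq_square)
    also have "\<dots> \<le> C / 2 ^ Suc m" by (intro divide_right_mono) (auto simp: C_def)
    finally show ?thesis .
  qed
  have dist: "nrm (euler (m + n) t y - euler m t y) \<le> C / 2 ^ m - C / 2 ^ (m + n)" for m n
  proof (induction n)
    case (Suc n)
    have "nrm (euler (m + Suc n) t y - euler m t y) \<le> C / 2 ^ Suc (m + n) + (C / 2 ^ m - C / 2 ^ (m + n))"
      using nrm_triangle_diff[of "euler (m + Suc n) t y" "euler m t y" "euler (m + n) t y"]
        Suc.IH step[of "m + n"] by simp
    then show ?case by (simp add: field_simps)
  qed simp
  have C0: "C \<ge> 0" by (simp add: C_def)
  have "(\<lambda>m. C * (1/2) ^ m) \<longlonglongrightarrow> C * 0" by (intro tendsto_intros LIMSEQ_power_zero) simp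
  then have "\<forall>\<^sub>F m in sequentially. C * (1/2) ^ m < e / 4"
    using e by (intro order_tendstoD) auto
  then obtain M where M: "C / 2 ^ m < e / 4" if "m \<ge> M" for m
    by (auto simp: eventually_sequentially power_one_over divide_simps)
  have close: "nrm (euler n t y - euler m t y) < e / 4" if mn: "M \<le> m" "m \<le> n" for m n
  proof -
    obtain k where "n = m + k" using mn(2) le_Suc_ex by blast
    then have "nrm (euler n t y - euler m t y) \<le> C / 2 ^ m - C / 2 ^ n" using dist by simp
    also have "\<dots> \<le> C / 2 ^ m" using C0 by simp
    finally show ?thesis using M[OF mn(1)] by linarith
  qed
  have "nrm (euler n t x - euler m t x) < e" if "M \<le> m" "M \<le> n" for m n
  proof -
    have "nrm (euler n t y - euler m t y) < e / 4"
      using close[of m n] close[of n m] that nrm_minus_commute by (cases "m \<le> n") auto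
    moreover have close_y: "nrm (euler k t x - euler k t y) < e / 4" for k
      using euler_contraction[of k t "x - y"] y(3) nrm_minus_commute[of x y] by (simp add: euler_diff)
    ultimately show ?thesis
      using nrm_triangle_diff[of "euler n t x" "euler m t x" "euler n t y"]
        nrm_triangle_diff[of "euler n t y" "euler m t x" "euler m t y"]
        nrm_minus_commute[of "euler m t x" "euler m t y"] e close_y[of n] close_y[of m]
      by linarith
  qed
  then show "\<exists>M. \<forall>m\<ge>M. \<forall>n\<ge>M. nrm (euler m t x - euler n t x) < e" by blast
qed

definition flow :: "real \<Rightarrow> 'x \<Rightarrow> 'x" where
  "flow t x = lim (\<lambda>m. euler m t x)"

lemma euler_tendsto: "t \<ge> 0 \<Longrightarrow> (\<lambda>m. euler m t x) \<longlonglongrightarrow> flow t x"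
  unfolding flow_def using euler_convergent by (simp add: convergent_LIMSEQ_iff)

lemma flow_add: "t \<ge> 0 \<Longrightarrow> flow t (x + y) = flow t x + flow t y"
proof -
  assume t: "t \<ge> 0"
  have "(\<lambda>m. euler m t x + euler m t y) \<longlonglongrightarrow> flow t x + flow t y"
    by (intro tendsto_intros euler_tendsto t)
  then have "(\<lambda>m. euler m t (x + y)) \<longlonglongrightarrow> flow t x + flow t y"
    by (simp add: euler_def J_pow_add)
  then show ?thesis using euler_tendsto[OF t] LIMSEQ_unique by blast
qed

lemma flow_scaleC: "t \<ge> 0 \<Longrightarrow> flow t (c *\<^sub>C x) = c *\<^sub>C flow t x"
proof -
  assume t: "t \<ge> 0"
  have "(\<lambda>m. nrm (c *\<^sub>C euler m t x - c *\<^sub>C flow t x)) \<longlonglongrightarrow> 0"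
  proof -
    have "(\<lambda>m. cmod c * nrm (euler m t x - flow t x)) \<longlonglongrightarrow> 0"
      using euler_tendsto[OF t, of x] by (intro tendsto_mult_right_zero) (simp add: tendsto_iff_nrm)
    then show ?thesis by (simp add: linear_diff[OF linear_scaleC, symmetric] nrm_scaleC)
  qed
  then have "(\<lambda>m. euler m t (c *\<^sub>C x)) \<longlonglongrightarrow> c *\<^sub>C flow t x"
    by (simp add: tendsto_iff_nrm euler_def J_pow_scaleC)
  then show ?thesis using euler_tendsto[OF t] LIMSEQ_unique by blast
qed

lemma flow_scaleR: "t \<ge> 0 \<Longrightarrow> flow t (r *\<^sub>R x) = r *\<^sub>R flow t x"
  using flow_scaleC[of t "of_real r" x] by (simp add: scaleC_of_real)

lemma flow_diff: "t \<ge> 0 \<Longrightarrow> flow t (x - y) = flow t x - flow t y"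
  using flow_add[of t x "(-1) *\<^sub>R y"] flow_scaleR[of t "-1" y] by simp

lemma flow_contraction: "t \<ge> 0 \<Longrightarrow> nrm (flow t x) \<le> nrm x"
  by (rule LIMSEQ_le_const2[OF tendsto_nrm[OF euler_tendsto]]) (auto simp: euler_contraction)

lemma flow_zero: "flow 0 x = x"
  by (simp add: flow_def euler_def J_pow_zero)

lemma flow_compose:
  assumes s: "s \<ge> 0" and t: "t \<ge> 0"
  shows "flow (s + t) x = flow s (flow t x)"
proof -
  have D2: "flow s (flow t y) = flow (s + t) y" if y: "y \<in> D" "B y \<in> D" for y
  proof -
    have "(\<lambda>m. nrm (euler m s (euler m t y) - euler m s (flow t y))) \<longlonglongrightarrow> 0"
    proof (rule Lim_null_comparison)
      show "(\<lambda>m. nrm (euler m t y - flow t y)) \<longlonglongrightarrow> 0"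
        using euler_tendsto[OF t] by (simp add: tendsto_iff_nrm)
      show "\<forall>\<^sub>F m in sequentially. norm (nrm (euler m s (euler m t y) - euler m s (flow t y)))
          \<le> nrm (euler m t y - flow t y)"
        using euler_contraction by (simp add: euler_diff[symmetric])
    qed
    then have "(\<lambda>m. euler m s (euler m t y) - euler m s (flow t y)) \<longlonglongrightarrow> 0"
      by (simp add: tendsto_iff_nrm[of _ 0])
    from tendsto_add[OF this euler_tendsto[OF s, of "flow t y"]]
    have 1: "(\<lambda>m. euler m s (euler m t y)) \<longlonglongrightarrow> flow s (flow t y)" by simp
    have "(\<lambda>m. (s * t * nrm (B (B y))) * (1/2) ^ m) \<longlonglongrightarrow> (s * t * nrm (B (B y))) * 0"
      by (intro tendsto_intros LIMSEQ_power_zero) simp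
    then have "(\<lambda>m. (s * t * nrm (B (B y))) / 2 ^ m) \<longlonglongrightarrow> 0"
      by (simp add: power_one_over)
    then have "(\<lambda>m. nrm (euler m s (euler m t y) - euler m (s + t) y)) \<longlonglongrightarrow> 0"
      by (rule Lim_null_comparison[rotated]) (use euler_product_error[OF y s t] in auto)
    then have "(\<lambda>m. euler m s (euler m t y) - euler m (s + t) y) \<longlonglongrightarrow> 0"
      by (simp add: tendsto_iff_nrm[of _ 0])
    from tendsto_add[OF this euler_tendsto[of "s + t" y]] s t
    have 2: "(\<lambda>m. euler m s (euler m t y)) \<longlonglongrightarrow> flow (s + t) y" by simp
    show ?thesis by (rule LIMSEQ_unique[OF 1 2])
  qed
  have "nrm (flow (s + t) x - flow s (flow t x)) \<le> e" if "e > 0" for e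
  proof -
    obtain y where y: "y \<in> D" "B y \<in> D" "nrm (y - x) < e / 2"
      using D2_dense[of "e/2" x] \<open>e > 0\<close> by auto
    have "flow (s + t) x - flow s (flow t x) =
        flow s (flow t (y - x)) - flow (s + t) (y - x)"
      using D2[OF y(1,2)] s t by (simp add: flow_diff)
    moreover have "nrm (flow s (flow t (y - x))) \<le> nrm (y - x)"
      using flow_contraction s t order_trans by blast
    moreover have "nrm (flow (s + t) (y - x)) \<le> nrm (y - x)"
      using flow_contraction s t by simp
    moreover have "nrm (flow s (flow t (y - x)) - flow (s + t) (y - x)) \<le>
        nrm (flow s (flow t (y - x))) + nrm (flow (s + t) (y - x))"
      using nrm_triangle_diff[of "flow s (flow t (y - x))" "flow (s + t) (y - x)" 0]
        nrm_minus_commute[of 0 "flow (s + t) (y - x)"] by simp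
    ultimately show ?thesis using y(3) by simp
  qed
  then have "nrm (flow (s + t) x - flow s (flow t x)) \<le> 0" by (rule field_le_epsilon) simp
  then have "nrm (flow (s + t) x - flow s (flow t x)) = 0"
    by (simp add: antisym)
  then show ?thesis by (simp add: nrm_eq_0_iff)
qed

lemma flow_minus_id:
  assumes "x \<in> D" "t \<ge> 0" shows "nrm (flow t x - x) \<le> t * nrm (B x)"
proof (rule LIMSEQ_le_const2[OF tendsto_nrm])
  show "(\<lambda>m. euler m t x - x) \<longlonglongrightarrow> flow t x - x"
    by (intro tendsto_intros euler_tendsto assms)
  show "\<exists>M. \<forall>m\<ge>M. nrm (euler m t x - x) \<le> t * nrm (B x)"
    using J_pow_minus_id[OF assms(1), of "t / 2 ^ m" "2 ^ m" for m] assms(2) by (auto simp: euler_def)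
qed

lemma flow_taylor:
  assumes "x \<in> D" "B x \<in> D" "t \<ge> 0"
  shows "nrm (flow t x - x - t *\<^sub>R B x) \<le> t\<^sup>2 * nrm (B (B x))"
proof (rule LIMSEQ_le_const2[OF tendsto_nrm])
  show "(\<lambda>m. euler m t x - x - t *\<^sub>R B x) \<longlonglongrightarrow> flow t x - x - t *\<^sub>R B x"
    by (intro tendsto_intros euler_tendsto assms)
  have "nrm (euler m t x - x - t *\<^sub>R B x) \<le> t\<^sup>2 * nrm (B (B x))" for m
    using J_pow_taylor[OF assms(1,2), of "t / 2 ^ m" "2 ^ m"] assms(3)
    by (simp add: euler_def power_divide)
  then show "\<exists>M. \<forall>m\<ge>M. nrm (euler m t x - x - t *\<^sub>R B x) \<le> t\<^sup>2 * nrm (B (B x))"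
    by blast
qed

lemma flow_strongly_continuous: "((\<lambda>t. nrm (flow t x - x)) \<longlongrightarrow> 0) (at_right 0)"
proof (rule tendstoI)
  fix e :: real assume e: "e > 0"
  obtain y where y: "y \<in> D" "nrm (y - x) < e / 3" using D_dense[of "e/3" x] e by auto
  define d where "d = e / (3 * (nrm (B y) + 1))"
  have pos: "nrm (B y) + 1 > 0" using nrm_nonneg[of "B y"] by linarith
  then have d: "d > 0" using e by (simp add: d_def)
  have "nrm (flow t x - x) < e" if t: "0 < t" "t < d" for t
  proof -
    have "nrm (flow t y - y) \<le> t * nrm (B y)" using flow_minus_id y t by simp
    also have "\<dots> \<le> d * (nrm (B y) + 1)" using t pos by (intro mult_mono) auto
    also have "\<dots> = e / 3" using pos by (simp add: d_def field_simps)
    finally have "nrm (flow t y - y) \<le> e / 3" .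
    moreover have "nrm (flow t x - flow t y) \<le> nrm (y - x)"
      using flow_contraction[of t "x - y"] t nrm_minus_commute[of x y] by (simp add: flow_diff)
    ultimately show ?thesis
      using nrm_triangle_diff[of "flow t x" x "flow t y"]
        nrm_triangle_diff[of "flow t y" x y] y(2) by linarith
  qed
  then show "\<forall>\<^sub>F t in at_right 0. dist (nrm (flow t x - x)) 0 < e"
    using d unfolding eventually_at_right_field by (intro exI[of _ d]) auto
qed

text \<open>For \<open>x\<close> with \<open>B\<^sup>2 x\<close> defined this is the Taylor estimate. A general \<open>x\<close> of the domain is approximated in the
  graph norm by such vectors; the difference quotients at the error are bounded by the graph norm.\<close>

lemma flow_derivative:
  assumes x: "x \<in> D"
  shows "((\<lambda>t. nrm ((flow t x - x) /\<^sub>R t - B x)) \<longlongrightarrow> 0) (at_right 0)"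
proof (rule tendstoI)
  fix e :: real assume e: "e > 0"
  obtain y where y: "y \<in> D" "B y \<in> D" "nrm (B y - B x) < e / 3"
    using D2_graph_dense[OF x, of "e/3"] e by auto
  define d where "d = e / (3 * (nrm (B (B y)) + 1))"
  have pos: "nrm (B (B y)) + 1 > 0" using nrm_nonneg[of "B (B y)"] by linarith
  then have d: "d > 0" using e by (simp add: d_def)
  have "nrm ((flow t x - x) /\<^sub>R t - B x) < e" if t: "0 < t" "t < d" for t
  proof -
    have xy: "x - y \<in> D" using D_diff x y by blast
    have eq: "flow t x - x - t *\<^sub>R B x = (flow t (x - y) - (x - y)) +
        ((flow t y - y - t *\<^sub>R B y) + t *\<^sub>R (B y - B x))"
      using t by (simp add: flow_diff algebra_simps)
    have "nrm (flow t (x - y) - (x - y)) \<le> t * nrm (B y - B x)"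
      using flow_minus_id[OF xy, of t] t B_diff[OF x y(1)] nrm_minus_commute[of "B x" "B y"] by simp
    moreover have "nrm (flow t y - y - t *\<^sub>R B y) \<le> t\<^sup>2 * nrm (B (B y))"
      using flow_taylor y t by simp
    moreover have "nrm (t *\<^sub>R (B y - B x)) = t * nrm (B y - B x)" using t by (simp add: nrm_scaleR)
    ultimately have "nrm (flow t x - x - t *\<^sub>R B x) \<le>
        t * (2 * nrm (B y - B x) + t * nrm (B (B y)))"
      unfolding eq
      using nrm_triangle[of "flow t (x - y) - (x - y)" "(flow t y - y - t *\<^sub>R B y) + t *\<^sub>R (B y - B x)"]
        nrm_triangle[of "flow t y - y - t *\<^sub>R B y" "t *\<^sub>R (B y - B x)"]
      by (simp add: algebra_simps power2_eq_square)
    moreover have "2 * nrm (B y - B x) + t * nrm (B (B y)) < e"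
    proof -
      have "t * nrm (B (B y)) \<le> d * (nrm (B (B y)) + 1)" using t pos by (intro mult_mono) auto
      also have "\<dots> = e / 3" using pos by (simp add: d_def field_simps)
      finally show ?thesis using y(3) by linarith
    qed
    ultimately have "nrm (flow t x - x - t *\<^sub>R B x) < t * e"
      using t by (meson le_less_trans mult_strict_left_mono)
    then have "inverse t * nrm (flow t x - x - t *\<^sub>R B x) < inverse t * (t * e)"
      using t by (intro mult_strict_left_mono) auto
    moreover have "(flow t x - x) /\<^sub>R t - B x = inverse t *\<^sub>R (flow t x - x - t *\<^sub>R B x)"
      using t by (simp add: algebra_simps)
    moreover have "inverse t * (t * e) = e" using t by simp
    ultimately show ?thesis using t by (simp only: nrm_scaleR abs_of_pos positive_imp_inverse_positive)
  qed
  then show "\<forall>\<^sub>F t in at_right 0. dist (nrm ((flow t x - x) /\<^sub>R t - B x)) 0 < e"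
    using d unfolding eventually_at_right_field by (intro exI[of _ d]) auto
qed

end

context hilbert_form begin

text \<open>The difference quotients satisfy \<open>\<langle>T(t) x - x, x\<rangle> \<le> \<parallel>T(t) x\<parallel> \<parallel>x\<parallel> - \<parallel>x\<parallel>\<^sup>2 \<le> 0\<close>.\<close>

lemma generator_dissipative:
  assumes T: "contraction_semigroup ip T" and xy: "(x, y) \<in> generator_graph ip T"
  shows "re_ip y x \<le> 0"
proof -
  have "((\<lambda>t. (T t x - x) /\<^sub>R t) \<longlongrightarrow> y) (at_right 0)"
    using xy by (simp add: generator_graph_def tendsto_iff_nrm)
  then have "((\<lambda>t. re_ip ((T t x - x) /\<^sub>R t) x) \<longlongrightarrow> re_ip y x) (at_right 0)"
    by (intro tendsto_re_ip tendsto_const)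
  moreover have "re_ip ((T t x - x) /\<^sub>R t) x \<le> 0" if t: "t > 0" for t
  proof -
    have "re_ip (T t x) x \<le> nrm (T t x) * nrm x" by (rule Cauchy_Schwarz_re_ip)
    also have "\<dots> \<le> nrm x * nrm x"
      using T t by (intro mult_right_mono) (auto simp: contraction_semigroup_def)
    finally have "re_ip (T t x - x) x \<le> 0"
      by (simp add: re_ip_simps nrm_power2[of x, symmetric] power2_eq_square)
    then show ?thesis using t by (simp add: re_ip_simps mult_nonneg_nonpos)
  qed
  ultimately show ?thesis
    by (intro tendsto_upperbound[where F = "at_right (0::real)"])
       (auto simp: eventually_at_right_field intro: exI[of _ 1])
qed

lemma generator_diff:
  assumes T: "contraction_semigroup ip T"
    and "(x, y) \<in> generator_graph ip T" "(x', y') \<in> generator_graph ip T"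
  shows "(x - x', y - y') \<in> generator_graph ip T"
proof -
  have "((\<lambda>t. (T t x - x) /\<^sub>R t - (T t x' - x') /\<^sub>R t) \<longlongrightarrow> y - y') (at_right 0)"
    using assms by (intro tendsto_diff) (simp_all add: generator_graph_def tendsto_iff_nrm)
  moreover
  have "(T t x - x) /\<^sub>R t - (T t x' - x') /\<^sub>R t = (T t (x - x') - (x - x')) /\<^sub>R t" if "t > 0" for t
  proof -
    have add: "T t (u + v) = T t u + T t v" and sc: "T t (c *\<^sub>C u) = c *\<^sub>C T t u" for u v c
      using T that by (auto simp: contraction_semigroup_def)
    have "T t ((-1) *\<^sub>R x') = (-1) *\<^sub>R T t x'"
      using sc[of "of_real (-1)" x'] by (simp only: scaleC_of_real)
    then have "T t (x - x') = T t x - T t x'" using add[of x "(-1) *\<^sub>R x'"] by simp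
    then show ?thesis by (simp flip: scaleR_diff_right)
  qed
  then have "\<forall>\<^sub>F t in at_right 0. (T t x - x) /\<^sub>R t - (T t x' - x') /\<^sub>R t =
      (T t (x - x') - (x - x')) /\<^sub>R t"
    unfolding eventually_at_right_field by (intro exI[of _ 1]) auto
  ultimately have "((\<lambda>t. (T t (x - x') - (x - x')) /\<^sub>R t) \<longlongrightarrow> y - y') (at_right 0)"
    by (rule Lim_transform_eventually)
  then show ?thesis by (simp add: generator_graph_def tendsto_iff_nrm)
qed

end

text \<open>The generator extends \<open>B\<close> and is dissipative. Since \<open>I - B\<close> is onto and the identity minus the generator
  is injective, the extension cannot be proper.\<close>

theorem (in m_dissipative) Lumer_Phillips: "generates_contraction_semigroup ip D B"
  unfolding generates_contraction_semigroup_def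
proof (intro exI[of _ flow] conjI)
  show T: "contraction_semigroup ip flow"
    unfolding contraction_semigroup_def
    using flow_add flow_scaleC flow_contraction flow_zero flow_compose
      flow_strongly_continuous by blast
  have DB: "(x, B x) \<in> generator_graph ip flow" if "x \<in> D" for x
    using flow_derivative[OF that] by (simp add: generator_graph_def)
  show "generator_graph ip flow = {(x, B x) | x. x \<in> D}"
  proof (intro equalityI subsetI)
    fix z assume "z \<in> generator_graph ip flow"
    then obtain x y where z: "z = (x, y)" "(x, y) \<in> generator_graph ip flow" by (cases z) auto
    obtain d where d: "d \<in> D" "d - 1 *\<^sub>R B d = x - y" using range_resolvent[of 1] by auto
    have "re_ip (y - B d) (x - d) \<le> 0"
      by (rule generator_dissipative[OF T generator_diff[OF T z(2) DB[OF d(1)]]])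
    moreover have eq: "y - B d = x - d" using d(2) by (simp add: algebra_simps)
    ultimately have "(nrm (x - d))\<^sup>2 \<le> 0" by (simp add: nrm_power2)
    then have "x = d" by (simp add: nrm_eq_0_iff)
    then show "z \<in> {(x, B x) | x. x \<in> D}" using eq d z by auto
  qed (use DB in auto)
qed

section \<open>The space \<open>L\<^sup>2\<close> on the unit interval\<close>

abbreviation I01 :: "real measure" where "I01 \<equiv> lebesgue_on {0..1}"

interpretation I01: finite_measure I01
  by (rule finite_measure_lebesgue_on) simp

lemma emeasure_I01 [simp]: "emeasure I01 {0..1} = 1"
  by (simp add: emeasure_restrict_space)

lemma measure_I01 [simp]: "measure I01 {0..1} = 1"
  by (simp add: measure_def)

text \<open>Lebesgue measure is complete, so measurability passes to functions that agree almost
  everywhere.\<close>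

lemma borel_measurable_I01_AE:
  fixes f g :: "real \<Rightarrow> 'a::euclidean_space"
  assumes f: "f \<in> borel_measurable I01" and ae: "AE t in I01. f t = g t"
  shows "g \<in> borel_measurable I01"
proof -
  have "(\<lambda>t. if t \<in> {0..1} then f t else 0) \<in> borel_measurable lebesgue"
    using f by (intro borel_measurable_if_I) auto
  moreover have "AE t in lebesgue. (if t \<in> {0..1} then f t else 0) = (if t \<in> {0..1} then g t else 0)"
    using ae by (auto simp: AE_restrict_space_iff elim!: eventually_mono)
  ultimately have "(\<lambda>t. if t \<in> {0..1} then g t else 0) \<in> borel_measurable lebesgue"
    by (rule borel_measurable_AE)
  then show ?thesis by (rule borel_measurable_if_D)
qed

lemma square_integrable_AE:
  assumes f: "square_integrable f" and ae: "AE t in I01. f t = g t"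
  shows "square_integrable g"
proof -
  have g: "g \<in> borel_measurable I01"
    using borel_measurable_I01_AE f ae by (auto simp: square_integrable_def)
  have "AE t in I01. (norm (f t))\<^sup>2 = (norm (g t))\<^sup>2"
    using ae by eventually_elim simp
  then show ?thesis
    using f g by (auto simp: square_integrable_def intro!: integrable_cong_AE_imp[where g = "\<lambda>t. (norm (f t))\<^sup>2"])
qed

lemma square_integrable_bound:
  fixes f :: "real \<Rightarrow> 'a::euclidean_space" and g :: "real \<Rightarrow> 'b::euclidean_space"
  assumes g: "square_integrable g" and f: "f \<in> borel_measurable I01"
    and bound: "AE t in I01. norm (f t) \<le> C * norm (g t)"
  shows "square_integrable f"
proof -
  have "integrable I01 (\<lambda>t. C\<^sup>2 * (norm (g t))\<^sup>2)"
    using g by (simp add: square_integrable_def)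
  moreover have "AE t in I01. norm ((norm (f t))\<^sup>2) \<le> norm (C\<^sup>2 * (norm (g t))\<^sup>2)"
    using bound
  proof eventually_elim
    case (elim t)
    have "(norm (f t))\<^sup>2 \<le> (C * norm (g t))\<^sup>2" using elim by (intro power_mono) auto
    then show ?case by (simp add: power_mult_distrib)
  qed
  ultimately have "integrable I01 (\<lambda>t. (norm (f t))\<^sup>2)"
    using f by (intro Bochner_Integration.integrable_bound[where g = "\<lambda>t. (norm (f t))\<^sup>2"
          and f = "\<lambda>t. C\<^sup>2 * (norm (g t))\<^sup>2"]) auto
  then show ?thesis using f by (simp add: square_integrable_def)
qed

lemma square_integrable_const: "square_integrable (\<lambda>t. c)"
  by (simp add: square_integrable_def)

lemma square_integrable_bounded:
  fixes f :: "real \<Rightarrow> 'a::euclidean_space"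
  assumes "f \<in> borel_measurable I01" "AE t in I01. norm (f t) \<le> C"
  shows "square_integrable f"
  using square_integrable_bound[OF square_integrable_const[of "1::real"] assms(1), of C] assms(2) by simp

lemma square_integrable_continuous:
  fixes f :: "real \<Rightarrow> 'a::euclidean_space"
  assumes "continuous_on {0..1} f" shows "square_integrable f"
proof -
  obtain C where "\<And>t. t \<in> {0..1} \<Longrightarrow> norm (f t) \<le> C"
    using compact_imp_bounded[OF compact_continuous_image[OF assms]] unfolding bounded_iff by blast
  then show ?thesis
    using assms by (intro square_integrable_bounded[of f C] continuous_imp_measurable_on_sets_lebesgue) auto
qed

lemma integrable_square_integrable:
  assumes "square_integrable f" shows "integrable I01 f"
proof -
  have [measurable]: "f \<in> borel_measurable I01" using assms by (simp add: square_integrable_def)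
  have "integrable I01 (\<lambda>t. 1 + (norm (f t))\<^sup>2)"
    using assms by (simp add: square_integrable_def)
  moreover have "AE t in I01. norm (f t) \<le> norm (1 + (norm (f t))\<^sup>2)"
  proof (rule AE_I2)
    fix t show "norm (f t) \<le> norm (1 + (norm (f t))\<^sup>2)"
      using sum_squares_bound[of "norm (f t)" 1] norm_ge_zero[of "f t"]
      unfolding power_one real_norm_def by linarith
  qed
  ultimately show ?thesis
    by (intro Bochner_Integration.integrable_bound[of I01 "\<lambda>t. 1 + (norm (f t))\<^sup>2" f]) auto
qed

lemma square_integrable_rep [simp]: "square_integrable (rep_l2 x)"
  using Quotient_rep_reflp[OF Quotient_l2, of x] by (simp add: l2_rel_def)

lemma rep_abs_l2: "square_integrable f \<Longrightarrow> AE t in I01. rep_l2 (abs_l2 f) t = f t"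
  using Quotient_rep_abs[OF Quotient_l2, of f] by (simp add: l2_rel_def)

lemma measurable_rep_l2 [measurable]: "rep_l2 x \<in> borel_measurable I01"
  using square_integrable_rep[of x] by (simp add: square_integrable_def del: square_integrable_rep)

lemma integrable_rep_l2 [simp]: "integrable I01 (rep_l2 x)"
  by (simp add: integrable_square_integrable)

lemma l2_eqI: "AE t in I01. rep_l2 x t = rep_l2 y t \<Longrightarrow> x = y"
  using Quotient_rel_rep[OF Quotient_l2, of x y] by (simp add: l2_rel_def)

lemma abs_l2_eqI: "AE t in I01. f t = rep_l2 y t \<Longrightarrow> abs_l2 f = y"
proof -
  assume *: "AE t in I01. f t = rep_l2 y t"
  then have "AE t in I01. rep_l2 y t = f t" by eventually_elim simp
  then have f: "square_integrable f" by (rule square_integrable_AE[rotated]) simp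
  show ?thesis using rep_abs_l2[OF f] * by (intro l2_eqI) auto
qed

lemma rep_zero_l2: "AE t in I01. rep_l2 0 t = 0"
  unfolding zero_l2_def by (rule rep_abs_l2[OF square_integrable_zero])

lemma rep_plus_l2: "AE t in I01. rep_l2 (x + y) t = rep_l2 x t + rep_l2 y t"
  unfolding plus_l2_def by (auto intro!: rep_abs_l2 square_integrable_add)

lemma rep_scaleR_l2: "AE t in I01. rep_l2 (r *\<^sub>R x) t = r *\<^sub>R rep_l2 x t"
  unfolding scaleR_l2_def by (auto intro!: rep_abs_l2 square_integrable_scaleR)

lemma rep_scaleC_l2:
  fixes x :: "'a::{complex_inner, euclidean_space} l2"
  shows "AE t in I01. rep_l2 (c *\<^sub>C x) t = c *\<^sub>C rep_l2 x t"
  unfolding scaleC_l2_def by (auto intro!: rep_abs_l2 square_integrable_scaleC)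

lemma rep_minus_l2: "AE t in I01. rep_l2 (x - y) t = rep_l2 x t - rep_l2 y t"
  using rep_plus_l2[of x "(-1) *\<^sub>R y"] rep_scaleR_l2[of "-1" y] by eventually_elim simp

lemma inner_l2_eq: "inner x y = (LINT t|I01. inner (rep_l2 x t) (rep_l2 y t))"
  by (simp add: inner_l2.rep_eq)

lemma norm_l2_power2: "(norm x)\<^sup>2 = (LINT t|I01. (norm (rep_l2 x t))\<^sup>2)"
  unfolding power2_norm_eq_inner inner_l2_eq ..

lemma integrable_norm2_rep [simp]: "integrable I01 (\<lambda>t. (norm (rep_l2 x t))\<^sup>2)"
  using square_integrable_rep[of x] by (simp add: square_integrable_def del: square_integrable_rep)

lemma norm_l2_le:
  assumes "AE t in I01. norm (rep_l2 x t) \<le> C * norm (rep_l2 y t)" "C \<ge> 0"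
  shows "norm x \<le> C * norm y"
proof (rule power2_le_imp_le)
  have "AE t in I01. (norm (rep_l2 x t))\<^sup>2 \<le> C\<^sup>2 * (norm (rep_l2 y t))\<^sup>2"
    using assms(1) by eventually_elim (metis norm_ge_zero power_mono power_mult_distrib)
  then have "(norm x)\<^sup>2 \<le> (LINT t|I01. C\<^sup>2 * (norm (rep_l2 y t))\<^sup>2)"
    unfolding norm_l2_power2 by (intro integral_mono_AE) auto
  then show "(norm x)\<^sup>2 \<le> (C * norm y)\<^sup>2" by (simp add: norm_l2_power2 power_mult_distrib)
qed (use assms in simp)

lemma norm_l2_le_const:
  assumes "AE t in I01. norm (rep_l2 x t) \<le> C" "C \<ge> 0"
  shows "norm x \<le> C"
proof (rule power2_le_imp_le)
  have "AE t in I01. (norm (rep_l2 x t))\<^sup>2 \<le> C\<^sup>2"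
    using assms(1) by eventually_elim (simp add: power_mono)
  then have "(norm x)\<^sup>2 \<le> (LINT t|I01. C\<^sup>2)"
    unfolding norm_l2_power2 by (intro integral_mono_AE) auto
  then show "(norm x)\<^sup>2 \<le> C\<^sup>2" by simp
qed (use assms in simp)

lemma nn_integral_norm2_l2: "(\<integral>\<^sup>+ t. ennreal ((norm (rep_l2 x t))\<^sup>2) \<partial>I01) = ennreal ((norm x)\<^sup>2)"
  unfolding norm_l2_power2 by (intro nn_integral_eq_integral) auto

lemma nn_integral_norm_l2_le:
  assumes "norm x \<le> e" "e > 0"
  shows "(\<integral>\<^sup>+ t. ennreal (norm (rep_l2 x t)) \<partial>I01) \<le> ennreal e"
proof -
  have "norm (rep_l2 x t) \<le> (inverse e * (norm (rep_l2 x t))\<^sup>2 + e) / 2" for t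
  proof -
    \<comment> \<open>the inequality \<open>2 |a| \<le> a\<^sup>2 / e + e\<close>, balanced at \<open>|a| = e\<close>\<close>
    have "0 \<le> inverse e * (norm (rep_l2 x t) - e)\<^sup>2" using assms by simp
    also have "\<dots> = inverse e * (norm (rep_l2 x t))\<^sup>2 - 2 * norm (rep_l2 x t) + e"
      using assms by (simp add: power2_eq_square field_simps)
    finally show ?thesis by simp
  qed
  then have "(LINT t|I01. norm (rep_l2 x t)) \<le> (LINT t|I01. (inverse e * (norm (rep_l2 x t))\<^sup>2 + e) / 2)"
    by (intro integral_mono) auto
  also have "\<dots> = (inverse e * (norm x)\<^sup>2 + e) / 2"
    by (simp add: norm_l2_power2)
  also have "\<dots> \<le> (inverse e * e\<^sup>2 + e) / 2"
    using assms by (intro divide_right_mono add_mono mult_left_mono power_mono) auto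
  also have "\<dots> = e" using assms by (simp add: power2_eq_square)
  finally show ?thesis by (subst nn_integral_eq_integral) (auto intro: ennreal_leI)
qed

text \<open>Fatou's lemma bounds the integral of the squared norm in the extended nonnegative reals; this turns such
  a bound into membership and a norm estimate.\<close>

lemma nn_integral_norm2_imp_l2:
  fixes f :: "real \<Rightarrow> 'a::euclidean_space"
  assumes f: "f \<in> borel_measurable I01" and le: "(\<integral>\<^sup>+ t. ennreal ((norm (f t))\<^sup>2) \<partial>I01) \<le> ennreal (e\<^sup>2)" and e: "e \<ge> 0"
  shows "square_integrable f" "norm (abs_l2 f) \<le> e"
proof -
  have "integrable I01 (\<lambda>t. (norm (f t))\<^sup>2)"
    using f le by (intro integrableI_bounded) (auto simp: le_less_trans)
  then show sq: "square_integrable f" using f by (simp add: square_integrable_def)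
  have "ennreal ((norm (abs_l2 f))\<^sup>2) = (\<integral>\<^sup>+ t. ennreal ((norm (f t))\<^sup>2) \<partial>I01)"
    unfolding nn_integral_norm2_l2[symmetric]
    by (rule nn_integral_cong_AE) (use rep_abs_l2[OF sq] in auto)
  then have "ennreal ((norm (abs_l2 f))\<^sup>2) \<le> ennreal (e\<^sup>2)" using le by simp
  then have "(norm (abs_l2 f))\<^sup>2 \<le> e\<^sup>2" by (simp add: ennreal_le_iff)
  then show "norm (abs_l2 f) \<le> e" using e by (rule power2_le_imp_le)
qed

text \<open>Riesz--Fischer: a subsequence with summable increments converges almost everywhere, and by
  Fatou's lemma its pointwise limit is the limit in \<open>L\<^sup>2\<close>.\<close>

instance l2 :: (euclidean_space) complete_space
proof
  fix X :: "nat \<Rightarrow> 'a l2" assume X: "Cauchy X"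
  have "\<exists>M. \<forall>m\<ge>M. \<forall>n\<ge>M. norm (X m - X n) < (1/2) ^ k" for k :: nat
    using CauchyD[OF X, of "(1/2) ^ k"] by simp
  then obtain M where M: "\<And>k m n. m \<ge> M k \<Longrightarrow> n \<ge> M k \<Longrightarrow> norm (X m - X n) < (1/2) ^ k"
    by metis
  \<comment> \<open>a strictly increasing choice of indices beyond the thresholds \<open>M\<close>\<close>
  define r where "r = rec_nat (M 0) (\<lambda>k rk. max (Suc rk) (M (Suc k)))"
  have r_mono: "strict_mono r" by (rule strict_monoI_Suc) (simp add: r_def)
  have rM: "r k \<ge> M k" for k by (cases k) (simp_all add: r_def)
  have close: "norm (X (r i) - X (r k)) < (1/2) ^ k" if "k \<le> i" for i k
    using M rM[of k] strict_mono_leD[OF r_mono that] by (meson order_trans)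
  define f where "f k = rep_l2 (X (r k))" for k
  have f_meas [measurable]: "f k \<in> borel_measurable I01" for k by (simp add: f_def)
  have diff: "(\<integral>\<^sup>+ t. F (f i t - f k t) \<partial>I01) = (\<integral>\<^sup>+ t. F (rep_l2 (X (r i) - X (r k)) t) \<partial>I01)"
    for i k and F :: "'a \<Rightarrow> ennreal"
    unfolding f_def by (rule nn_integral_cong_AE) (use rep_minus_l2[of "X (r i)" "X (r k)"] in auto)
  have "(\<integral>\<^sup>+ t. (\<Sum>k. ennreal (norm (f (Suc k) t - f k t))) \<partial>I01) =
      (\<Sum>k. \<integral>\<^sup>+ t. ennreal (norm (f (Suc k) t - f k t)) \<partial>I01)"
    by (rule nn_integral_suminf) measurable
  also have "\<dots> \<le> (\<Sum>k. ennreal ((1/2) ^ k))"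
    unfolding diff[where F = "\<lambda>u. ennreal (norm u)"]
    by (intro suminf_le nn_integral_norm_l2_le less_imp_le[OF close]) auto
  also have "\<dots> < \<infinity>"
    by (subst suminf_ennreal2) (auto intro: summable_geometric)
  finally have "AE t in I01. (\<Sum>k. ennreal (norm (f (Suc k) t - f k t))) \<noteq> \<infinity>"
    by (intro nn_integral_noteq_infinite) auto
  then have conv: "AE t in I01. (\<lambda>k. f k t) \<longlonglongrightarrow> lim (\<lambda>k. f k t)"
  proof eventually_elim
    case (elim t)
    then have "summable (\<lambda>k. norm (f (Suc k) t - f k t))"
      by (intro summable_suminf_not_top) auto
    then have "summable (\<lambda>k. f (Suc k) t - f k t)" by (rule summable_norm_cancel)
    then have "convergent (\<lambda>n. \<Sum>k<n. f (Suc k) t - f k t)" by (simp add: summable_iff_convergent)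
    then obtain l where "(\<lambda>n. f n t - f 0 t) \<longlonglongrightarrow> l"
      unfolding sum_lessThan_telescope[of "\<lambda>k. f k t"] convergent_def by blast
    then have "(\<lambda>n. (f n t - f 0 t) + f 0 t) \<longlonglongrightarrow> l + f 0 t" by (intro tendsto_intros)
    then have "convergent (\<lambda>n. f n t)" by (auto simp: convergent_def)
    then show ?case by (simp add: convergent_LIMSEQ_iff)
  qed
  define h where "h t = lim (\<lambda>k. f k t)" for t
  have h_meas [measurable]: "h \<in> borel_measurable I01" unfolding h_def by measurable
  have fatou: "(\<integral>\<^sup>+ t. ennreal ((norm (h t - f k t))\<^sup>2) \<partial>I01) \<le> ennreal (((1/2) ^ k)\<^sup>2)" for k
  proof -
    have "(\<integral>\<^sup>+ t. ennreal ((norm (h t - f k t))\<^sup>2) \<partial>I01) =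
        (\<integral>\<^sup>+ t. liminf (\<lambda>i. ennreal ((norm (f i t - f k t))\<^sup>2)) \<partial>I01)"
    proof (rule nn_integral_cong_AE)
      show "AE t in I01. ennreal ((norm (h t - f k t))\<^sup>2) = liminf (\<lambda>i. ennreal ((norm (f i t - f k t))\<^sup>2))"
        using conv
      proof eventually_elim
        case (elim t)
        then have "(\<lambda>i. ennreal ((norm (f i t - f k t))\<^sup>2)) \<longlonglongrightarrow> ennreal ((norm (h t - f k t))\<^sup>2)"
          unfolding h_def by (intro tendsto_intros tendsto_ennrealI)
        then show ?case by (metis lim_imp_Liminf trivial_limit_sequentially)
      qed
    qed
    also have "\<dots> \<le> liminf (\<lambda>i. \<integral>\<^sup>+ t. ennreal ((norm (f i t - f k t))\<^sup>2) \<partial>I01)"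
      by (rule nn_integral_liminf) measurable
    also have "\<dots> \<le> ennreal (((1/2) ^ k)\<^sup>2)"
    proof (rule Liminf_le)
      show "\<forall>\<^sub>F i in sequentially. (\<integral>\<^sup>+ t. ennreal ((norm (f i t - f k t))\<^sup>2) \<partial>I01) \<le> ennreal (((1/2) ^ k)\<^sup>2)"
        using eventually_ge_at_top[of k]
      proof eventually_elim
        case (elim i)
        have "(norm (X (r i) - X (r k)))\<^sup>2 \<le> ((1/2) ^ k)\<^sup>2"
          using close[OF elim] by (intro power_mono) auto
        then show ?case unfolding diff[where F = "\<lambda>u. ennreal ((norm u)\<^sup>2)"] nn_integral_norm2_l2 by (rule ennreal_leI)
      qed
    qed simp
    finally show ?thesis .
  qed
  have sq0: "square_integrable (\<lambda>t. (h t - f 0 t) + f 0 t)"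
    using nn_integral_norm2_imp_l2(1)[OF _ fatou[of 0]]
    by (intro square_integrable_add) (auto simp: f_def)
  then have h: "square_integrable h" by simp
  have "norm (abs_l2 h - X (r k)) \<le> (1/2) ^ k" for k
  proof -
    have "abs_l2 (\<lambda>t. h t - f k t) = abs_l2 h - X (r k)"
      by (rule abs_l2_eqI) (use rep_minus_l2[of "abs_l2 h" "X (r k)"] rep_abs_l2[OF h] in \<open>auto simp: f_def\<close>)
    then show ?thesis using nn_integral_norm2_imp_l2(2)[OF _ fatou[of k]] by simp
  qed
  then have "(\<lambda>k. X (r k) - abs_l2 h) \<longlonglongrightarrow> 0"
    by (intro Lim_null_comparison[OF _ LIMSEQ_power_zero[of "1/2::real"]])
       (auto simp: norm_minus_commute)
  then have "(X \<circ> r) \<longlonglongrightarrow> abs_l2 h" by (simp add: o_def LIM_zero_cancel)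
  then show "convergent X"
    using Cauchy_converges_subseq[OF X r_mono] by (auto simp: convergent_def)
qed

instance l2 :: (euclidean_space) banach ..

section \<open>Multiplication operators\<close>

lemma Linf_op_bound:
  assumes "Linf_op M" obtains C where "C \<ge> 0" "AE t in I01. \<forall>v. norm (M t v) \<le> C * norm v"
proof -
  obtain C where "AE t in I01. onorm (M t) \<le> C" and lin: "AE t in I01. bounded_clinear (M t)"
    using assms by (auto simp: Linf_op_def)
  then have "AE t in I01. \<forall>v. norm (M t v) \<le> max 0 C * norm v"
  proof eventually_elim
    case (elim t)
    have "norm (M t v) \<le> onorm (M t) * norm v" for v
      using elim(2) by (intro onorm) (auto simp: bounded_clinear_def)
    then show ?case using elim(1)
      by (meson max.coboundedI2 mult_right_mono norm_ge_zero order_trans)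
  qed
  then show ?thesis by (rule that[of "max 0 C", rotated]) simp
qed

lemma Linf_op_measurable:
  assumes M: "Linf_op M" and x[measurable]: "x \<in> borel_measurable I01"
  shows "(\<lambda>t. M t (x t)) \<in> borel_measurable I01"
proof -
  have F: "(\<lambda>t. Blinfun (M t)) \<in> borel_measurable I01" using M by (simp add: Linf_op_def)
  have [measurable]: "(\<lambda>t. blinfun_apply (Blinfun (M t)) b) \<in> borel_measurable I01" for b
    by (rule measurable_compose[OF F]) (intro borel_measurable_continuous_onI continuous_intros)
  have "(\<lambda>t. \<Sum>b\<in>Basis. (x t \<bullet> b) *\<^sub>R blinfun_apply (Blinfun (M t)) b) \<in> borel_measurable I01"
    by measurable
  moreover have "AE t in I01. bounded_clinear (M t)" using M by (simp add: Linf_op_def)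
  then have "AE t in I01. (\<Sum>b\<in>Basis. (x t \<bullet> b) *\<^sub>R blinfun_apply (Blinfun (M t)) b) = M t (x t)"
  proof eventually_elim
    case (elim t)
    then have bl: "bounded_linear (M t)" by (simp add: bounded_clinear_def)
    have "M t (x t) = M t (\<Sum>b\<in>Basis. (x t \<bullet> b) *\<^sub>R b)" by (simp add: euclidean_representation)
    also have "\<dots> = (\<Sum>b\<in>Basis. (x t \<bullet> b) *\<^sub>R M t b)"
      using bounded_linear.linear[OF bl] by (simp add: linear_sum linear_cmul)
    finally show ?case using bl by (simp add: bounded_linear_Blinfun_apply)
  qed
  ultimately show ?thesis by (rule borel_measurable_I01_AE)
qed

lemma square_integrable_mult_op:
  assumes M: "Linf_op M" shows "square_integrable (\<lambda>t. M t (rep_l2 x t))"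
proof -
  obtain C where "AE t in I01. \<forall>v. norm (M t v) \<le> C * norm v" using Linf_op_bound[OF M] .
  then have "AE t in I01. norm (M t (rep_l2 x t)) \<le> C * norm (rep_l2 x t)"
    by eventually_elim blast
  then show ?thesis
    by (rule square_integrable_bound[OF square_integrable_rep Linf_op_measurable[OF M measurable_rep_l2]])
qed

lemma rep_mult_op: "Linf_op M \<Longrightarrow> AE t in I01. rep_l2 (mult_op M x) t = M t (rep_l2 x t)"
  unfolding mult_op_def by (intro rep_abs_l2 square_integrable_mult_op)

lemma mult_op_add:
  assumes M: "Linf_op M" shows "mult_op M (x + y) = mult_op M x + mult_op M y"
proof (rule l2_eqI)
  have "AE t in I01. bounded_clinear (M t)" using M by (simp add: Linf_op_def)
  then show "AE t in I01. rep_l2 (mult_op M (x + y)) t = rep_l2 (mult_op M x + mult_op M y) t"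
    using rep_mult_op[OF M, of "x + y"] rep_mult_op[OF M, of x] rep_mult_op[OF M, of y]
      rep_plus_l2[of x y] rep_plus_l2[of "mult_op M x" "mult_op M y"]
    by eventually_elim (simp add: bounded_clinear_def linear_add bounded_linear.linear)
qed

lemma mult_op_scaleC:
  assumes M: "Linf_op M" shows "mult_op M (c *\<^sub>C x) = c *\<^sub>C mult_op M x"
proof (rule l2_eqI)
  have "AE t in I01. bounded_clinear (M t)" using M by (simp add: Linf_op_def)
  then show "AE t in I01. rep_l2 (mult_op M (c *\<^sub>C x)) t = rep_l2 (c *\<^sub>C mult_op M x) t"
    using rep_mult_op[OF M, of "c *\<^sub>C x"] rep_mult_op[OF M, of x]
      rep_scaleC_l2[of c x] rep_scaleC_l2[of c "mult_op M x"]
    by eventually_elim (simp add: bounded_clinear_def)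
qed

lemma linear_mult_op:
  assumes M: "Linf_op M" shows "linear (mult_op M)"
  using mult_op_add[OF M] mult_op_scaleC[OF M, of "of_real r" for r]
  by (intro linearI) (simp_all add: scaleC_of_real)

lemma bounded_linear_mult_op:
  assumes M: "Linf_op M" shows "bounded_linear (mult_op M)"
proof -
  obtain C where C: "C \<ge> 0" "AE t in I01. \<forall>v. norm (M t v) \<le> C * norm v" using Linf_op_bound[OF M] .
  have "norm (mult_op M x) \<le> C * norm x" for x
  proof (rule norm_l2_le[OF _ C(1)])
    show "AE t in I01. norm (rep_l2 (mult_op M x) t) \<le> C * norm (rep_l2 x t)"
      using C(2) rep_mult_op[OF M, of x] by eventually_elim simp
  qed
  then show ?thesis
    using linear_mult_op[OF M]
    by (intro bounded_linear_intro[of _ C]) (auto simp: linear_add linear_cmul mult.commute)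
qed

lemma Linf_op_const: "bounded_clinear P \<Longrightarrow> Linf_op (\<lambda>_. P)"
  by (auto simp: Linf_op_def)

section \<open>Primitives and integration by parts\<close>

interpretation I01_pair: pair_sigma_finite I01 I01 ..

text \<open>The primitive that vanishes at \<open>0\<close>. The indicator, in place of an integral over \<open>{0..t}\<close>, keeps all integrals
  on one measure space, as Fubini's theorem and dominated convergence require.\<close>

definition prim :: "(real \<Rightarrow> 'a::euclidean_space) \<Rightarrow> real \<Rightarrow> 'a" where
  "prim g t = (LINT s|I01. indicator {..t} s *\<^sub>R g s)"

lemma measurable_id_I01 [measurable]: "(\<lambda>t. t) \<in> borel_measurable I01"
  by (intro measurable_restrict_space1 measurable_completion) simp

lemma integrable_indicator_I01:
  fixes g :: "real \<Rightarrow> 'a::euclidean_space"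
  assumes "integrable I01 g" shows "integrable I01 (\<lambda>s. indicator {..t} s *\<^sub>R g s)"
proof -
  have [measurable]: "{..t} \<inter> space I01 \<in> sets I01"
    by (auto simp: sets_restrict_space)
  have [measurable]: "g \<in> borel_measurable I01" using assms by simp
  show ?thesis
    by (rule Bochner_Integration.integrable_bound[where f = g]) (use assms in \<open>auto simp: indicator_def\<close>)
qed

lemma AE_I01_neq: "AE s in I01. s \<noteq> t"
proof -
  have "AE s in lebesgue. s \<noteq> t" by (intro AE_completion AE_lborel_singleton)
  then show ?thesis by (auto simp: AE_restrict_space_iff elim: eventually_mono)
qed

lemma AE_I01_in: "AE s in I01. s \<in> {0..1}"
  by (rule AE_I2) simp

lemma prim_1: "prim g 1 = integral\<^sup>L I01 g"
  unfolding prim_def by (rule Bochner_Integration.integral_cong) auto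

lemma prim_0: "prim g 0 = 0"
proof -
  have "AE s in I01. indicator {..0} s *\<^sub>R g s = 0"
    using AE_I01_neq[of 0] AE_I01_in by eventually_elim (auto simp: indicator_def)
  then show ?thesis unfolding prim_def by (rule integral_eq_zero_AE)
qed

lemma prim_cong_AE:
  assumes "AE s in I01. f s = g s" "f \<in> borel_measurable I01" "g \<in> borel_measurable I01"
  shows "prim f t = prim g t"
proof -
  have [measurable]: "{..t} \<inter> space I01 \<in> sets I01" by (auto simp: sets_restrict_space)
  have [measurable]: "f \<in> borel_measurable I01" "g \<in> borel_measurable I01" using assms by auto
  show ?thesis unfolding prim_def
    by (rule integral_cong_AE) (use assms(1) in \<open>measurable, auto\<close>)
qed

lemma prim_add: "integrable I01 f \<Longrightarrow> integrable I01 g \<Longrightarrow> prim (\<lambda>s. f s + g s) t = prim f t + prim g t"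
  unfolding prim_def by (simp add: scaleR_add_right integrable_indicator_I01)

lemma prim_bounded_linear:
  assumes "bounded_linear T" "integrable I01 g" shows "prim (\<lambda>s. T (g s)) t = T (prim g t)"
proof -
  have "T (prim g t) = (LINT s|I01. T (indicator {..t} s *\<^sub>R g s))"
    unfolding prim_def
    by (rule integral_bounded_linear[symmetric, OF assms(1) integrable_indicator_I01[OF assms(2)]])
  then show ?thesis using assms(1)
    by (simp add: prim_def linear_cmul bounded_linear.linear)
qed

lemma prim_mono:
  fixes g :: "real \<Rightarrow> real"
  assumes "integrable I01 g" "integrable I01 h" "AE s in I01. 0 \<le> g s \<and> g s \<le> h s" "t \<le> t'"
  shows "prim g t \<le> prim h t'"
  unfolding prim_def
proof (rule integral_mono_AE)
  show "AE s in I01. indicator {..t} s *\<^sub>R g s \<le> indicator {..t'} s *\<^sub>R h s"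
    using assms(3) by eventually_elim (use assms(4) in \<open>auto simp: indicator_def\<close>)
qed (rule integrable_indicator_I01 assms)+

lemma norm_prim_le: "integrable I01 g \<Longrightarrow> norm (prim g t) \<le> prim (\<lambda>s. norm (g s)) t"
  unfolding prim_def
  by (rule order_trans[OF integral_norm_bound]) (simp add: indicator_def if_distrib cong: if_cong)

lemma continuous_prim:
  assumes g: "integrable I01 g" shows "continuous_on S (prim g)"
proof (rule continuous_on_subset[OF _ subset_UNIV], rule continuous_on_sequentiallyI)
  fix u :: "nat \<Rightarrow> real" and a assume u: "u \<longlonglongrightarrow> a"
  have [measurable]: "g \<in> borel_measurable I01" using g by simp
  show "(\<lambda>n. prim g (u n)) \<longlonglongrightarrow> prim g a"
    unfolding prim_def
  proof (rule integral_dominated_convergence)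
    show "AE s in I01. (\<lambda>n. indicator {..u n} s *\<^sub>R g s) \<longlonglongrightarrow> indicator {..a} s *\<^sub>R g s"
      using AE_I01_neq[of a]
    proof eventually_elim
      case (elim s)
      have "\<forall>\<^sub>F n in sequentially. indicator {..u n} s *\<^sub>R g s = indicator {..a} s *\<^sub>R g s"
      proof (cases "s < a")
        case True
        show ?thesis using order_tendstoD(1)[OF u True] by eventually_elim (use True in \<open>auto simp: indicator_def\<close>)
      next
        case False
        then have as: "a < s" using elim by simp
        show ?thesis using order_tendstoD(2)[OF u as] by eventually_elim (use False elim in \<open>auto simp: indicator_def\<close>)
      qed
      then show ?case by (rule tendsto_eventually)
    qed
    show "integrable I01 (\<lambda>s. norm (g s))" using g by simp
    show "AE s in I01. norm (indicator {..u n} s *\<^sub>R g s) \<le> norm (g s)" for n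
      by (auto simp: indicator_def)
  qed (use integrable_indicator_I01[OF g] in auto)
qed

lemma borel_measurable_bounded_bilinear:
  fixes op :: "'a::euclidean_space \<Rightarrow> 'b::euclidean_space \<Rightarrow> 'c::euclidean_space"
  assumes bl: "bounded_bilinear op" and f: "f \<in> borel_measurable M" and g: "g \<in> borel_measurable M"
  shows "(\<lambda>x. op (f x) (g x)) \<in> borel_measurable M"
proof (rule borel_measurable_continuous_Pair[where H = op, OF f g])
  show "continuous_on UNIV (\<lambda>x. op (fst x) (snd x))"
    by (rule bounded_bilinear.continuous_on[OF bl]) (intro continuous_intros)+
qed

lemma integrable_I01_bounded_mult:
  fixes op :: "'a::euclidean_space \<Rightarrow> 'b::euclidean_space \<Rightarrow> 'c::euclidean_space"
  assumes g: "integrable I01 g" and f: "continuous_on {0..1} f" and bl: "bounded_bilinear op"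
  shows "integrable I01 (\<lambda>t. op (g t) (f t))"
proof -
  obtain K where K: "K > 0" "\<And>a b. norm (op a b) \<le> norm a * norm b * K"
    using bounded_bilinear.pos_bounded[OF bl] by blast
  obtain C where C: "\<And>t. t \<in> {0..1} \<Longrightarrow> norm (f t) \<le> C"
    using compact_imp_bounded[OF compact_continuous_image[OF f]] unfolding bounded_iff by blast
  have [measurable]: "g \<in> borel_measurable I01" "f \<in> borel_measurable I01"
    using g f by (auto intro: continuous_imp_measurable_on_sets_lebesgue)
  have meas: "(\<lambda>t. op (g t) (f t)) \<in> borel_measurable I01"
    by (rule borel_measurable_bounded_bilinear[OF bl]) measurable
  have "integrable I01 (\<lambda>t. norm (g t) * (C * K))" using g by simp
  then show ?thesis
  proof (rule Bochner_Integration.integrable_bound[OF _ meas])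
    show "AE t in I01. norm (op (g t) (f t)) \<le> norm (norm (g t) * (C * K))"
    proof (rule AE_I2)
      fix t assume "t \<in> space I01"
      then have "norm (f t) \<le> C" using C by simp
      then have "norm (g t) * norm (f t) * K \<le> norm (g t) * C * K"
        using K by (intro mult_right_mono mult_left_mono) auto
      then show "norm (op (g t) (f t)) \<le> norm (norm (g t) * (C * K))"
        using K(2)[of "g t" "f t"] by (simp add: mult.assoc)
    qed
  qed
qed

lemma integrable_I01_pair:
  fixes op :: "'a::euclidean_space \<Rightarrow> 'b::euclidean_space \<Rightarrow> 'c::euclidean_space"
  assumes bl: "bounded_bilinear op" and g: "integrable I01 g" and h: "integrable I01 h"
  shows "integrable (I01 \<Otimes>\<^sub>M I01) (\<lambda>(t, s). op (g t) (h s))"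
proof -
  obtain K where K: "K > 0" "\<And>a b. norm (op a b) \<le> norm a * norm b * K"
    using bounded_bilinear.pos_bounded[OF bl] by blast
  have [measurable]: "g \<in> borel_measurable I01" "h \<in> borel_measurable I01" using g h by auto
  have "integrable (I01 \<Otimes>\<^sub>M I01) (\<lambda>(t, s). norm (g t) * norm (h s) * K)"
    by (rule I01_pair.Fubini_integrable) (use g h K in auto)
  moreover have "(\<lambda>p. op (g (fst p)) (h (snd p))) \<in> borel_measurable (I01 \<Otimes>\<^sub>M I01)"
    by (rule borel_measurable_bounded_bilinear[OF bl]) measurable
  ultimately show ?thesis
    using K by (elim Bochner_Integration.integrable_bound)
      (auto simp: case_prod_beta intro!: order_trans[OF K(2)])
qed

text \<open>Integration by parts: the two triangles below and above the diagonal make up the unit square.\<close>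

lemma prim_by_parts:
  fixes op :: "'a::euclidean_space \<Rightarrow> 'b::euclidean_space \<Rightarrow> 'c::euclidean_space"
  assumes bl: "bounded_bilinear op" and g: "integrable I01 g" and h: "integrable I01 h"
  shows "(LINT t|I01. op (g t) (prim h t)) + (LINT t|I01. op (prim g t) (h t)) =
    op (integral\<^sup>L I01 g) (integral\<^sup>L I01 h)"
proof -
  note bl_left = bounded_bilinear.bounded_linear_left[OF bl]
    and bl_right = bounded_bilinear.bounded_linear_right[OF bl]
  have [measurable]: "fst \<in> borel_measurable (I01 \<Otimes>\<^sub>M I01)" "snd \<in> borel_measurable (I01 \<Otimes>\<^sub>M I01)"
    using measurable_compose[OF measurable_fst measurable_id_I01, of I01]
      measurable_compose[OF measurable_snd measurable_id_I01, of I01] by auto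
  have int: "integrable (I01 \<Otimes>\<^sub>M I01) (\<lambda>(t, s). op (g t) (h s))"
    by (rule integrable_I01_pair[OF bl g h])
  then have [measurable]: "(\<lambda>(t, s). op (g t) (h s)) \<in> borel_measurable (I01 \<Otimes>\<^sub>M I01)" by simp
  have "integrable (I01 \<Otimes>\<^sub>M I01) (\<lambda>p. if fst p \<le> snd p then (\<lambda>(t, s). op (g t) (h s)) p else 0)"
    by (rule Bochner_Integration.integrable_bound[OF int]) auto
  then have int_upper: "integrable (I01 \<Otimes>\<^sub>M I01) (\<lambda>(t, s). if t \<le> s then op (g t) (h s) else 0)"
    by (rule back_subst[of "integrable (I01 \<Otimes>\<^sub>M I01)"]) (auto simp: fun_eq_iff)
  have gh: "integrable I01 (\<lambda>s. op (g t) (h s))" for t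
    using h by (rule integrable_bounded_linear[OF bl_right])
  have [measurable]: "h \<in> borel_measurable I01" "g \<in> borel_measurable I01"using g h by simp_all
  have gh': "integrable I01 (\<lambda>s. if s \<le> t then op (g t) (h s) else 0)"
     "integrable I01 (\<lambda>s. if t \<le> s then op (g t) (h s) else 0)" for t
    using borel_measurable_integrable[OF gh]
    by (auto intro!: Bochner_Integration.integrable_bound[OF gh, of _ t])
  have "(LINT t|I01. op (prim g t) (h t)) = (LINT s|I01. LINT t|I01. (if t \<le> s then op (g t) (h s) else 0))"
  proof (rule Bochner_Integration.integral_cong[OF refl])
    fix s
    show "op (prim g s) (h s) = (LINT t|I01. (if t \<le> s then op (g t) (h s) else 0))"
      unfolding prim_def integral_bounded_linear[OF bl_left integrable_indicator_I01[OF g], symmetric]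
      by (rule Bochner_Integration.integral_cong)
         (auto simp: indicator_def bounded_bilinear.zero_left[OF bl])
  qed
  also have "\<dots> = (LINT t|I01. LINT s|I01. (if t \<le> s then op (g t) (h s) else 0))"
    by (rule I01_pair.Fubini_integral[OF int_upper])
  finally have 1: "(LINT t|I01. op (prim g t) (h t)) =
      (LINT t|I01. LINT s|I01. (if t \<le> s then op (g t) (h s) else 0))" .
  have lower: "op (g t) (prim h t) = (LINT s|I01. (if s \<le> t then op (g t) (h s) else 0))" for t
    unfolding prim_def integral_bounded_linear[OF bl_right integrable_indicator_I01[OF h], symmetric]
    by (rule Bochner_Integration.integral_cong)
       (auto simp: indicator_def bounded_bilinear.zero_right[OF bl])
  have sum: "op (g t) (prim h t) + (LINT s|I01. (if t \<le> s then op (g t) (h s) else 0)) =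
      op (g t) (integral\<^sup>L I01 h)" for t
  proof -
    have "op (g t) (prim h t) + (LINT s|I01. (if t \<le> s then op (g t) (h s) else 0)) =
      (LINT s|I01. (if s \<le> t then op (g t) (h s) else 0) + (if t \<le> s then op (g t) (h s) else 0))"
      unfolding lower by (rule Bochner_Integration.integral_add[symmetric, OF gh'])
    also have "\<dots> = (LINT s|I01. op (g t) (h s))"
    proof (rule integral_cong_AE)
      show "AE s in I01. (if s \<le> t then op (g t) (h s) else 0) + (if t \<le> s then op (g t) (h s) else 0) = op (g t) (h s)"
        using AE_I01_neq[of t] by eventually_elim auto
    qed (use gh' gh in auto)
    also have "\<dots> = op (g t) (integral\<^sup>L I01 h)" by (rule integral_bounded_linear[OF bl_right h])
    finally show ?thesis .
  qed
  have "integrable I01 (\<lambda>t. op (g t) (prim h t))"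
    by (rule integrable_I01_bounded_mult[OF g continuous_prim[OF h] bl])
  moreover have "integrable I01 (\<lambda>t. LINT s|I01. (if t \<le> s then op (g t) (h s) else 0))"
    using I01_pair.integrable_fst[OF int_upper] .
  ultimately have "(LINT t|I01. op (g t) (prim h t)) + (LINT t|I01. op (prim g t) (h t)) =
      (LINT t|I01. op (g t) (integral\<^sup>L I01 h))"
    unfolding 1 by (simp add: sum flip: Bochner_Integration.integral_add)
  also have "\<dots> = op (integral\<^sup>L I01 g) (integral\<^sup>L I01 h)"
    by (rule integral_bounded_linear[OF bl_left g])
  finally show ?thesis .
qed

lemma integration_by_parts_I01:
  fixes op :: "'a::euclidean_space \<Rightarrow> 'b::euclidean_space \<Rightarrow> 'c::euclidean_space"
  assumes bl: "bounded_bilinear op" and g: "integrable I01 g" and h: "integrable I01 h"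
    and x: "\<And>t. t \<in> {0..1} \<Longrightarrow> x t = a + prim g t" and y: "\<And>t. t \<in> {0..1} \<Longrightarrow> y t = b + prim h t"
  shows "(LINT t|I01. op (g t) (y t)) + (LINT t|I01. op (x t) (h t)) = op (x 1) (y 1) - op (x 0) (y 0)"
proof -
  note bl_left = bounded_bilinear.bounded_linear_left[OF bl]
    and bl_right = bounded_bilinear.bounded_linear_right[OF bl]
  have "(LINT t|I01. op (g t) (y t)) = (LINT t|I01. op (g t) b + op (g t) (prim h t))"
    by (rule Bochner_Integration.integral_cong) (auto simp: y bounded_bilinear.add_right[OF bl])
  also have "\<dots> = op (integral\<^sup>L I01 g) b + (LINT t|I01. op (g t) (prim h t))"
    using integrable_bounded_linear[OF bl_left g] integrable_I01_bounded_mult[OF g continuous_prim[OF h] bl]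
    by (simp add: integral_bounded_linear[OF bl_left g])
  finally have 1: "(LINT t|I01. op (g t) (y t)) = op (integral\<^sup>L I01 g) b + (LINT t|I01. op (g t) (prim h t))" .
  have "(LINT t|I01. op (x t) (h t)) = (LINT t|I01. op a (h t) + op (prim g t) (h t))"
    by (rule Bochner_Integration.integral_cong) (auto simp: x bounded_bilinear.add_left[OF bl])
  also have "\<dots> = op a (integral\<^sup>L I01 h) + (LINT t|I01. op (prim g t) (h t))"
    using integrable_bounded_linear[OF bl_right h]
      integrable_I01_bounded_mult[OF h continuous_prim[OF g] bounded_bilinear.flip[OF bl]]
    by (simp add: integral_bounded_linear[OF bl_right h])
  finally have 2: "(LINT t|I01. op (x t) (h t)) = op a (integral\<^sup>L I01 h) + (LINT t|I01. op (prim g t) (h t))" .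
  have "x 1 = a + integral\<^sup>L I01 g" "x 0 = a" "y 1 = b + integral\<^sup>L I01 h" "y 0 = b"
    using x y by (simp_all add: prim_0 prim_1)
  then show ?thesis
    using prim_by_parts[OF bl g h] unfolding 1 2
    by (simp add: bounded_bilinear.add_left[OF bl] bounded_bilinear.add_right[OF bl] algebra_simps)
qed

lemma prim_derivative:
  fixes f f' :: "real \<Rightarrow> 'a::euclidean_space"
  assumes f: "\<And>t. t \<in> {0..1} \<Longrightarrow> (f has_vector_derivative f' t) (at t within {0..1})"
    and f': "continuous_on {0..1} f'" and t: "t \<in> {0..1}"
  shows "f t = f 0 + prim f' t"
proof -
  have "(f' has_integral (f t - f 0)) {0..t}"
    using t by (intro fundamental_theorem_of_calculus)
      (auto intro!: has_vector_derivative_within_subset[OF f])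
  then have "((\<lambda>s. if s \<in> {0..t} then f' s else 0) has_integral (f t - f 0)) {0..1}"
    using t by (subst has_integral_restrict) auto
  moreover have "(LINT s|I01. indicator {..t} s *\<^sub>R f' s) = (LINT s|I01. (if s \<in> {0..t} then f' s else 0))"
    by (rule Bochner_Integration.integral_cong) (auto simp: indicator_def)
  moreover have "integrable I01 (\<lambda>s. if s \<in> {0..t} then f' s else 0)"
    using integrable_indicator_I01[OF integrable_square_integrable[OF square_integrable_continuous[OF f']], of t]
    by (rule Bochner_Integration.integrable_cong[THEN iffD1, rotated -1]) (auto simp: indicator_def)
  ultimately have "prim f' t = f t - f 0"
    unfolding prim_def by (simp add: lebesgue_integral_eq_integral integral_unique)
  then show ?thesis by simp
qed

lemma continuous_AE_eq:
  fixes f g :: "real \<Rightarrow> 'a::euclidean_space"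
  assumes f: "continuous_on {0..1} f" and g: "continuous_on {0..1} g" and ae: "AE t in I01. f t = g t"
    and t: "t \<in> {0..1}"
  shows "f t = g t"
proof -
  have c: "continuous_on {0..1} (\<lambda>t. norm (f t - g t))" by (intro continuous_intros f g)
  have "integral {0..1} (\<lambda>t. norm (f t - g t)) = (LINT t|I01. norm (f t - g t))"
    by (rule lebesgue_integral_eq_integral[symmetric])
       (use integrable_square_integrable[OF square_integrable_continuous[OF c]] in auto)
  also have "\<dots> = 0" using ae by (intro integral_eq_zero_AE) (auto elim!: eventually_mono)
  finally show ?thesis
    using integral_eq_0_iff[OF c] t by auto
qed

section \<open>Weak derivatives\<close>

text \<open>The space \<open>C\<^sub>c(0,1)\<close>. Its elements of mean zero are exactly the derivatives of the test functions,
  which is why it is convenient for reading off what a weak derivative says.\<close>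

definition bump :: "(real \<Rightarrow> real) \<Rightarrow> bool" where
  "bump \<psi> \<longleftrightarrow> continuous_on UNIV \<psi> \<and> (\<exists>a b. 0 < a \<and> b < 1 \<and> (\<forall>t. t \<notin> {a..b} \<longrightarrow> \<psi> t = 0))"

lemma bump_continuous: "bump \<psi> \<Longrightarrow> continuous_on S \<psi>"
  by (auto simp: bump_def intro: continuous_on_subset)

lemma bump_diff:
  assumes "bump \<psi>" "bump \<eta>" shows "bump (\<lambda>t. \<psi> t - c * \<eta> t)"
proof -
  obtain a b where ab: "0 < a" "b < 1" "\<And>t. t \<notin> {a..b} \<Longrightarrow> \<psi> t = 0"
    using assms(1) unfolding bump_def by blast
  obtain a' b' where ab': "0 < a'" "b' < 1" "\<And>t. t \<notin> {a'..b'} \<Longrightarrow> \<eta> t = 0"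
    using assms(2) unfolding bump_def by blast
  have "\<psi> t - c * \<eta> t = 0" if t: "t \<notin> {min a a'..max b b'}" for t
  proof -
    have "t \<notin> {a..b}" "t \<notin> {a'..b'}" using t by auto
    then show ?thesis using ab(3) ab'(3) by simp
  qed
  then show ?thesis
    unfolding bump_def using ab ab' assms
    by (intro conjI exI[of _ "min a a'"] exI[of _ "max b b'"] continuous_intros bump_continuous) auto
qed

lemma bump_mult:
  assumes "bump \<psi>" "continuous_on UNIV g" shows "bump (\<lambda>t. \<psi> t * g t)"
proof -
  obtain a b where ab: "0 < a" "b < 1" "\<And>t. t \<notin> {a..b} \<Longrightarrow> \<psi> t = 0"
    using assms(1) unfolding bump_def by blast
  have "continuous_on UNIV (\<lambda>t. \<psi> t * g t)"
    by (intro continuous_intros bump_continuous assms)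
  then show ?thesis
    unfolding bump_def using ab by (intro conjI exI[of _ a] exI[of _ b]) auto
qed

text \<open>An increasing sequence of bump functions with limit \<open>1\<close> on the open interval.\<close>

definition cutoff :: "nat \<Rightarrow> real \<Rightarrow> real" where
  "cutoff n t = min 1 (max 0 (real (Suc n) * (t * (1 - t)) - 1))"

lemma cutoff_range: "0 \<le> cutoff n t" "cutoff n t \<le> 1"
  by (auto simp: cutoff_def)

lemma bump_cutoff: "bump (cutoff n)"
proof -
  have 1: "continuous_on UNIV (cutoff n)"
    unfolding cutoff_def by (intro continuous_intros)
  have zero: "cutoff n t = 0" if "t * (1 - t) \<le> 1 / real (Suc n)" for t
  proof -
    have "real (Suc n) * (t * (1 - t)) \<le> real (Suc n) * (1 / real (Suc n))"
      using that by (intro mult_left_mono) auto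
    then show ?thesis by (simp add: cutoff_def)
  qed
  define d where "d = 1 / real (Suc n)"
  have d: "d > 0" "d \<le> 1" by (auto simp: d_def)
  have "cutoff n t = 0" if "t \<notin> {d..1 - d}" for t
  proof (rule zero, unfold d_def[symmetric])
    have tt: "t < d \<or> 1 - d < t" using that by auto
    consider "t < 0" | "0 \<le> t" "t < d" | "t > 1" | "t \<le> 1" "t > 1 - d" using tt by (meson not_le)
    then show "t * (1 - t) \<le> d"
    proof cases
      case 1
      then have "t * (1 - t) \<le> 0" by (simp add: mult_nonpos_nonneg)
      then show ?thesis using d by simp
    next
      case 2
      then have "t * (1 - t) \<le> t * 1" by (intro mult_left_mono) auto
      then show ?thesis using 2 by simp
    next
      case 3
      then have "t * (1 - t) \<le> 0" by (simp add: mult_nonneg_nonpos)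
      then show ?thesis using d by simp
    next
      case 4
      then have "t * (1 - t) \<le> 1 * (1 - t)" by (intro mult_right_mono) auto
      then show ?thesis using 4 by simp
    qed
  qed
  with 1 d show ?thesis
    unfolding bump_def by (intro conjI exI[of _ d] exI[of _ "1 - d"]) auto
qed

lemma cutoff_tendsto: "0 < t \<Longrightarrow> t < 1 \<Longrightarrow> (\<lambda>n. cutoff n t) \<longlonglongrightarrow> 1"
proof -
  assume t: "0 < t" "t < 1"
  then have p: "t * (1 - t) > 0" by simp
  obtain N :: nat where N: "2 / (t * (1 - t)) < real N" using reals_Archimedean2 by blast
  have "cutoff n t = 1" if "n \<ge> N" for n
  proof -
    have "2 / (t * (1 - t)) \<le> real (Suc n)" using N that by linarith
    then have "2 \<le> real (Suc n) * (t * (1 - t))" using p by (simp add: pos_divide_le_eq)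
    then show ?thesis by (simp add: cutoff_def)
  qed
  then show ?thesis by (intro tendsto_eventually) (auto simp: eventually_sequentially)
qed

lemma integrable_bump_scaleR:
  fixes f :: "real \<Rightarrow> 'a::euclidean_space"
  assumes "bump \<psi>" "integrable I01 f" shows "integrable I01 (\<lambda>t. \<psi> t *\<^sub>R f t)"
  using integrable_I01_bounded_mult[OF assms(2) bump_continuous[OF assms(1)]
      bounded_bilinear.flip[OF bounded_bilinear_scaleR]] .

text \<open>The antiderivative vanishes to the left of the support, and by the mean value condition also to
  the right of it.\<close>

lemma bump_antiderivative:
  assumes \<psi>: "bump \<psi>" and mean: "(LINT t|I01. \<psi> t) = 0"
  obtains \<phi> where "test_function \<phi>" "deriv \<phi> = \<psi>"
proof -
  obtain a b where ab: "0 < a" "b < 1" and zero: "\<And>t. t \<notin> {a..b} \<Longrightarrow> \<psi> t = 0"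
    using \<psi> unfolding bump_def by blast
  note cont = bump_continuous[OF \<psi>]
  \<comment> \<open>starting at \<open>-1\<close> makes the primitive differentiable at \<open>0\<close> as well\<close>
  define \<phi> where "\<phi> t = integral {-1..t} \<psi>" for t
  have left: "\<phi> t = 0" if "t < a" for t
  proof -
    have "integral {-1..t} \<psi> = integral {-1..t} (\<lambda>_. 0)"
      using that zero by (intro integral_cong) auto
    then show ?thesis by (simp add: \<phi>_def)
  qed
  have deriv: "(\<phi> has_vector_derivative \<psi> t) (at t)" for t
  proof (cases "t < a")
    case True
    have "((\<lambda>_. 0) has_vector_derivative 0) (at t)" by simp
    moreover have "\<psi> t = 0" using zero True by auto
    ultimately have "((\<lambda>_. 0) has_vector_derivative \<psi> t) (at t)" by simp
    then show ?thesis
      by (rule has_vector_derivative_transform_within_open[where S = "{..<a}"]) (use True left in auto)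
  next
    case False
    then have "((\<lambda>u. integral {-1..u} \<psi>) has_vector_derivative \<psi> t) (at t within {-1..t + 1})"
      using ab by (intro integral_has_vector_derivative cont) auto
    moreover have "at t within {-1..t + 1} = at t"
      using False ab by (intro at_within_interior) auto
    ultimately show ?thesis unfolding \<phi>_def by simp
  qed
  have d: "(\<phi> has_field_derivative \<psi> t) (at t)" for t
    using deriv by (simp add: has_real_derivative_iff_has_vector_derivative)
  have deriv_eq: "deriv \<phi> = \<psi>" using DERIV_imp_deriv[OF d] by blast
  have right: "\<phi> t = 0" if "t > b" for t
  proof -
    have i: "(\<psi> has_integral integral {a..b} \<psi>) {a..b}"
      by (intro integrable_integral integrable_continuous_interval cont)
    have "{a..b} \<subseteq> {-1..t}" "{a..b} \<subseteq> {0..1}" using ab that by auto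
    then have *: "(\<psi> has_integral integral {a..b} \<psi>) {-1..t}" "(\<psi> has_integral integral {a..b} \<psi>) {0..1}"
      using has_integral_on_superset[OF i zero] by blast+
    have "integral {0..1} \<psi> = (LINT t|I01. \<psi> t)"
      by (rule lebesgue_integral_eq_integral[symmetric])
         (use integrable_square_integrable[OF square_integrable_continuous[OF cont]] in auto)
    then show ?thesis using * mean unfolding \<phi>_def by (simp add: integral_unique)
  qed
  have "\<forall>t. t \<notin> {a..b} \<longrightarrow> \<phi> t = 0"
    using left right by (metis atLeastAtMost_iff not_le)
  then have "\<exists>a b. 0 < a \<and> b < 1 \<and> (\<forall>t. t \<notin> {a..b} \<longrightarrow> \<phi> t = 0)" using ab by blast
  moreover have "\<forall>t. \<phi> differentiable (at t)" using d by (auto simp: real_differentiable_def)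
  ultimately have "test_function \<phi>" using cont by (simp only: test_function_def deriv_eq simp_thms)
  then show ?thesis using deriv_eq that by blast
qed

text \<open>For each component \<open>y\<close> of \<open>f\<close>, the bounded function \<open>s = y / (1 + |y|)\<close> is a pointwise limit of continuous
  functions almost everywhere. Clipping these to \<open>[-1, 1]\<close> and cutting them off gives bump functions, and
  dominated convergence yields \<open>\<integral> s y = 0\<close>, where \<open>s y\<close> is nonnegative and vanishes only with \<open>y\<close>.\<close>

lemma AE_zero_if_bump_integrals_zero:
  fixes f :: "real \<Rightarrow> 'a::euclidean_space"
  assumes f: "integrable I01 f" and zero: "\<And>\<psi>. bump \<psi> \<Longrightarrow> (LINT t|I01. \<psi> t *\<^sub>R f t) = 0"
  shows "AE t in I01. f t = 0"
proof -
  have comp: "AE t in I01. f t \<bullet> i = 0" if "i \<in> Basis" for i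
  proof -
    define y where "y t = f t \<bullet> i" for t
    have y: "integrable I01 y" unfolding y_def using f by simp
    then have ym [measurable]: "y \<in> borel_measurable I01" by simp
    have yzero: "(LINT t|I01. \<psi> t * y t) = 0" if "bump \<psi>" for \<psi>
    proof -
      have "(LINT t|I01. \<psi> t * y t) = (LINT t|I01. (\<psi> t *\<^sub>R f t) \<bullet> i)" by (simp add: y_def)
      also have "\<dots> = (LINT t|I01. \<psi> t *\<^sub>R f t) \<bullet> i"
        using integrable_bump_scaleR[OF that f] by (intro integral_inner_left)
      finally show ?thesis using zero[OF that] by simp
    qed
    define s where "s t = y t / (1 + \<bar>y t\<bar>)" for t
    have s_bound: "\<bar>s t\<bar> \<le> 1" for t by (simp add: s_def)
    have "s \<in> borel_measurable I01" unfolding s_def by measurable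
    then have "(\<lambda>t. if t \<in> {0..1} then s t else 0) \<in> borel_measurable lebesgue"
      by (intro borel_measurable_if_I) auto
    then have "(\<lambda>t. if t \<in> {0..1} then s t else 0) measurable_on UNIV"
      by (rule lebesgue_measurable_imp_measurable_on_real) simp
    then have "s measurable_on {0..1}" by (simp only: measurable_on_UNIV)
    then obtain N g where N: "negligible N" and g: "\<And>n. continuous_on UNIV (g n :: real \<Rightarrow> real)"
      and lim: "\<And>t. t \<notin> N \<Longrightarrow> (\<lambda>n. g n t) \<longlonglongrightarrow> (if t \<in> {0..1} then s t else 0)"
      unfolding measurable_on_def by blast
    define \<psi> where "\<psi> n t = cutoff n t * max (- 1) (min 1 (g n t))" for n t
    have b: "bump (\<psi> n)" for n
      unfolding \<psi>_def by (intro bump_mult bump_cutoff continuous_intros g)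
    have "N \<in> null_sets lebesgue" using N by (simp add: negligible_iff_null_sets)
    then have "AE t in I01. t \<notin> N"
      by (auto simp: AE_restrict_space_iff intro: eventually_mono[OF AE_not_in])
    then have "AE t in I01. (\<lambda>n. \<psi> n t * y t) \<longlonglongrightarrow> s t * y t"
      using AE_I01_neq[of 0] AE_I01_neq[of 1] AE_I01_in
    proof eventually_elim
      case (elim t)
      then have "(\<lambda>n. \<psi> n t * y t) \<longlonglongrightarrow> (1 * max (- 1) (min 1 (s t))) * y t"
        unfolding \<psi>_def using lim[of t]
        by (intro tendsto_intros cutoff_tendsto) auto
      moreover have "max (- 1) (min 1 (s t)) = s t" using s_bound[of t] by auto
      ultimately show ?case by simp
    qed
    then have "(\<lambda>n. LINT t|I01. \<psi> n t * y t) \<longlonglongrightarrow> (LINT t|I01. s t * y t)"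
    proof (rule integral_dominated_convergence[rotated 3])
      show "AE t in I01. norm (\<psi> n t * y t) \<le> \<bar>y t\<bar>" for n
      proof (rule AE_I2)
        fix t
        have "\<bar>\<psi> n t\<bar> \<le> 1 * 1"
          unfolding \<psi>_def abs_mult using cutoff_range[of n t] by (intro mult_mono) auto
        then have "\<bar>\<psi> n t\<bar> * \<bar>y t\<bar> \<le> 1 * \<bar>y t\<bar>" by (intro mult_right_mono) auto
        then show "norm (\<psi> n t * y t) \<le> \<bar>y t\<bar>" by (simp add: abs_mult)
      qed
      show "(\<lambda>t. \<psi> n t * y t) \<in> borel_measurable I01" for n
        using integrable_bump_scaleR[OF b y, of n] by simp
      show "(\<lambda>t. s t * y t) \<in> borel_measurable I01" unfolding s_def by measurable
    qed (use y in auto)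
    then have "(LINT t|I01. s t * y t) = 0" using yzero[OF b] by (simp add: LIMSEQ_const_iff)
    moreover have sy: "s t * y t = (y t)\<^sup>2 / (1 + \<bar>y t\<bar>)" for t by (simp add: s_def power2_eq_square)
    moreover have "integrable I01 (\<lambda>t. s t * y t)"
    proof (rule Bochner_Integration.integrable_bound[OF y])
      show "(\<lambda>t. s t * y t) \<in> borel_measurable I01" unfolding s_def by measurable
      show "AE t in I01. norm (s t * y t) \<le> norm (y t)"
        using s_bound mult_right_mono[OF s_bound abs_ge_zero] by (auto simp: abs_mult)
    qed
    ultimately have "AE t in I01. s t * y t = 0"
      by (subst (asm) integral_nonneg_eq_0_iff_AE) (auto simp: sy)
    then show "AE t in I01. f t \<bullet> i = 0"
    proof eventually_elim
      case (elim t)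
      have "1 + \<bar>y t\<bar> \<noteq> 0" using abs_ge_zero[of "y t"] by linarith
      with elim[unfolded sy] show ?case by (simp add: y_def)
    qed
  qed
  have "AE t in I01. \<forall>i\<in>Basis. f t \<bullet> i = 0"
    using comp by (subst AE_finite_all) auto
  then show ?thesis by eventually_elim (auto intro: euclidean_eqI)
qed

text \<open>Subtracting a multiple of a fixed bump function of nonzero mean from an arbitrary one makes the mean zero
  and thus produces the derivative of a test function. So \<open>f\<close> pairs with bump functions like a constant.\<close>

lemma du_Bois_Reymond:
  fixes f :: "real \<Rightarrow> 'a::euclidean_space"
  assumes f: "integrable I01 f"
    and zero: "\<And>\<phi>. test_function \<phi> \<Longrightarrow> (LINT t|I01. deriv \<phi> t *\<^sub>R f t) = 0"
  shows "\<exists>c. AE t in I01. f t = c"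
proof -
  have "(\<lambda>n. LINT t|I01. cutoff n t) \<longlonglongrightarrow> (LINT t|I01. 1)"
  proof (rule integral_dominated_convergence[where w = "\<lambda>_. 1"])
    show "AE t in I01. (\<lambda>n. cutoff n t) \<longlonglongrightarrow> 1"
      using AE_I01_neq[of 0] AE_I01_neq[of 1] AE_I01_in by eventually_elim (auto intro: cutoff_tendsto)
    show "cutoff n \<in> borel_measurable I01" for n
      by (intro continuous_imp_measurable_on_sets_lebesgue bump_continuous bump_cutoff) simp
  qed (use cutoff_range in auto)
  then have "\<forall>\<^sub>F n in sequentially. (LINT t|I01. cutoff n t) > 0"
    by (intro order_tendstoD(1)) auto
  then obtain n where n: "(LINT t|I01. cutoff n t) > 0" by (auto simp: eventually_sequentially)
  define m where "m = (LINT t|I01. cutoff n t)"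
  define c where "c = (1 / m) *\<^sub>R (LINT t|I01. cutoff n t *\<^sub>R f t)"
  have m: "m \<noteq> 0" using n by (simp add: m_def)
  have int_bump: "integrable I01 \<psi>" if "bump \<psi>" for \<psi> :: "real \<Rightarrow> real"
    using integrable_square_integrable[OF square_integrable_continuous[OF bump_continuous[OF that]]] .
  have "AE t in I01. f t - c = 0"
  proof (rule AE_zero_if_bump_integrals_zero)
    show "integrable I01 (\<lambda>t. f t - c)" using f by simp
    fix \<psi> assume \<psi>: "bump \<psi>"
    define k where "k = (LINT t|I01. \<psi> t) / m"
    have b: "bump (\<lambda>t. \<psi> t - k * cutoff n t)" by (intro bump_diff \<psi> bump_cutoff)
    have "(LINT t|I01. \<psi> t - k * cutoff n t) = 0"
      using int_bump[OF \<psi>] int_bump[OF bump_cutoff, of n] m by (simp add: k_def m_def)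
    then obtain \<phi> where "test_function \<phi>" "deriv \<phi> = (\<lambda>t. \<psi> t - k * cutoff n t)"
      using bump_antiderivative[OF b] by blast
    then have "(LINT t|I01. (\<psi> t - k * cutoff n t) *\<^sub>R f t) = 0" using zero by metis
    moreover have "(LINT t|I01. (\<psi> t - k * cutoff n t) *\<^sub>R f t) =
        (LINT t|I01. \<psi> t *\<^sub>R f t) - k *\<^sub>R (LINT t|I01. cutoff n t *\<^sub>R f t)"
      using integrable_bump_scaleR[OF \<psi> f] integrable_bump_scaleR[OF bump_cutoff f, of n]
      by (simp add: scaleR_diff_left flip: scaleR_scaleR)
    ultimately have "(LINT t|I01. \<psi> t *\<^sub>R f t) = (LINT t|I01. \<psi> t) *\<^sub>R c"
      using m by (simp add: k_def c_def)
    then show "(LINT t|I01. \<psi> t *\<^sub>R (f t - c)) = 0"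
      using integrable_bump_scaleR[OF \<psi> f] int_bump[OF \<psi>] by (simp add: scaleR_diff_right)
  qed
  then show ?thesis by auto
qed

text \<open>The primitive of \<open>g\<close> has weak derivative \<open>g\<close> by integration by parts; two functions with the same weak
  derivative differ by a constant.\<close>

theorem weak_deriv_iff_prim:
  fixes x g :: "'a::euclidean_space l2"
  shows "weak_deriv x g \<longleftrightarrow> (\<exists>c. AE t in I01. rep_l2 x t = c + prim (rep_l2 g) t)"
proof -
  have parts: "(LINT t|I01. deriv \<phi> t *\<^sub>R prim (rep_l2 g) t) = - (LINT t|I01. \<phi> t *\<^sub>R rep_l2 g t)"
    and mean: "(LINT t|I01. deriv \<phi> t) = 0"
    and int: "integrable I01 (deriv \<phi>)"
    and cont: "continuous_on {0..1} (deriv \<phi>)" if \<phi>: "test_function \<phi>" for \<phi>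
  proof -
    show cont: "continuous_on {0..1} (deriv \<phi>)"
      using \<phi> by (auto simp: test_function_def intro: continuous_on_subset)
    then show int: "integrable I01 (deriv \<phi>)"
      by (intro integrable_square_integrable square_integrable_continuous)
    have 01: "\<phi> 0 = 0" "\<phi> 1 = 0"
      using \<phi> unfolding test_function_def by (metis atLeastAtMost_iff not_le)+
    have "(\<phi> has_vector_derivative deriv \<phi> t) (at t within {0..1})" for t
    proof -
      have "\<phi> field_differentiable at t"
        using \<phi> by (simp add: test_function_def real_differentiable_def field_differentiable_def)
      then have "(\<phi> has_field_derivative deriv \<phi> t) (at t)" by (rule DERIV_deriv_iff_field_differentiable[THEN iffD2])
      then show ?thesis
        by (simp add: has_real_derivative_iff_has_vector_derivative has_vector_derivative_at_within)
    qed
    then have prim: "\<phi> t = 0 + prim (deriv \<phi>) t" if "t \<in> {0..1}" for t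
      using prim_derivative[of \<phi> "deriv \<phi>" t] cont that 01 by simp
    show "(LINT t|I01. deriv \<phi> t) = 0" using prim[of 1] 01 by (simp add: prim_1)
    have "(LINT t|I01. deriv \<phi> t *\<^sub>R prim (rep_l2 g) t) + (LINT t|I01. \<phi> t *\<^sub>R rep_l2 g t) = 0"
      using integration_by_parts_I01[OF bounded_bilinear_scaleR int integrable_rep_l2[of g] prim, of "prim (rep_l2 g)" 0] 01
      by simp
    then show "(LINT t|I01. deriv \<phi> t *\<^sub>R prim (rep_l2 g) t) = - (LINT t|I01. \<phi> t *\<^sub>R rep_l2 g t)"
      by (simp add: eq_neg_iff_add_eq_0)
  qed
  have cont_prim: "continuous_on {0..1} (prim (rep_l2 g))" by (intro continuous_prim) simp
  have [measurable]: "prim (rep_l2 g) \<in> borel_measurable I01"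
    using cont_prim by (intro continuous_imp_measurable_on_sets_lebesgue) auto
  have int_prim: "integrable I01 (prim (rep_l2 g))"
    using cont_prim by (intro integrable_square_integrable square_integrable_continuous)
  have int': "integrable I01 (\<lambda>t. deriv \<phi> t *\<^sub>R f t)" if "test_function \<phi>" "integrable I01 f" for \<phi> and f :: "real \<Rightarrow> 'a"
    using integrable_I01_bounded_mult[OF that(2) cont[OF that(1)] bounded_bilinear.flip[OF bounded_bilinear_scaleR]] .
  show ?thesis
  proof
    assume w: "weak_deriv x g"
    have "\<exists>c. AE t in I01. rep_l2 x t - prim (rep_l2 g) t = c"
    proof (rule du_Bois_Reymond)
      fix \<phi> assume \<phi>: "test_function \<phi>"
      have "(LINT t|I01. deriv \<phi> t *\<^sub>R (rep_l2 x t - prim (rep_l2 g) t)) =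
          (LINT t|I01. deriv \<phi> t *\<^sub>R rep_l2 x t) - (LINT t|I01. deriv \<phi> t *\<^sub>R prim (rep_l2 g) t)"
        using int'[OF \<phi>] int_prim by (simp add: scaleR_diff_right)
      then show "(LINT t|I01. deriv \<phi> t *\<^sub>R (rep_l2 x t - prim (rep_l2 g) t)) = 0"
        using parts[OF \<phi>] w \<phi> by (simp add: weak_deriv_def)
    qed (use int_prim in simp)
    then obtain c where "AE t in I01. rep_l2 x t - prim (rep_l2 g) t = c" by blast
    then have "AE t in I01. rep_l2 x t = c + prim (rep_l2 g) t" by eventually_elim auto
    then show "\<exists>c. AE t in I01. rep_l2 x t = c + prim (rep_l2 g) t" by blast
  next
    assume "\<exists>c. AE t in I01. rep_l2 x t = c + prim (rep_l2 g) t"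
    then obtain c where c: "AE t in I01. rep_l2 x t = c + prim (rep_l2 g) t" by blast
    show "weak_deriv x g"
      unfolding weak_deriv_def
    proof (intro allI impI)
      fix \<phi> assume \<phi>: "test_function \<phi>"
      have [measurable]: "deriv \<phi> \<in> borel_measurable I01" using int[OF \<phi>] by simp
      have "(LINT t|I01. deriv \<phi> t *\<^sub>R rep_l2 x t) = (LINT t|I01. deriv \<phi> t *\<^sub>R c + deriv \<phi> t *\<^sub>R prim (rep_l2 g) t)"
        by (rule integral_cong_AE) (use c in \<open>auto simp: scaleR_add_right elim!: eventually_mono\<close>)
      also have "\<dots> = (LINT t|I01. deriv \<phi> t *\<^sub>R prim (rep_l2 g) t)"
        using int[OF \<phi>] int'[OF \<phi> int_prim] mean[OF \<phi>] by simp
      finally show "(LINT t|I01. deriv \<phi> t *\<^sub>R rep_l2 x t) = - (LINT t|I01. \<phi> t *\<^sub>R rep_l2 g t)"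
        using parts[OF \<phi>] by simp
    qed
  qed
qed

lemma cont_rep_eqI:
  assumes f: "continuous_on {0..1} f" and ae: "AE t in I01. rep_l2 x t = f t" and t: "t \<in> {0..1}"
  shows "cont_rep x t = f t"
proof -
  have "continuous_on {0..1} (cont_rep x) \<and> (AE t in I01. rep_l2 x t = cont_rep x t)"
    unfolding cont_rep_def by (rule someI[of _ f]) (use f ae in blast)
  moreover from this have "AE t in I01. cont_rep x t = f t"
    using ae by (auto elim: eventually_elim2)
  ultimately show ?thesis using continuous_AE_eq[OF _ f _ t] by blast
qed

lemma weak_deriv_cont_rep:
  assumes w: "weak_deriv x g"
  shows "AE t in I01. rep_l2 x t = cont_rep x t"
    and "t \<in> {0..1} \<Longrightarrow> cont_rep x t = cont_rep x 0 + prim (rep_l2 g) t"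
proof -
  obtain c where c: "AE t in I01. rep_l2 x t = c + prim (rep_l2 g) t"
    using w by (auto simp: weak_deriv_iff_prim)
  have "continuous_on {0..1} (\<lambda>t. c + prim (rep_l2 g) t)"
    by (intro continuous_intros continuous_prim integrable_rep_l2)
  then have eq: "cont_rep x t = c + prim (rep_l2 g) t" if "t \<in> {0..1}" for t
    using cont_rep_eqI[OF _ c that] by simp
  show "AE t in I01. rep_l2 x t = cont_rep x t"
    using c AE_I01_in by eventually_elim (simp add: eq)
  show "t \<in> {0..1} \<Longrightarrow> cont_rep x t = cont_rep x 0 + prim (rep_l2 g) t"
    using eq[of t] eq[of 0] by (simp add: prim_0)
qed

text \<open>The primitive of the difference \<open>d\<close> vanishes, so \<open>d\<close> is orthogonal to all polynomials by integration by
  parts, hence to all bump functions by the Weierstrass theorem.\<close>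

lemma weak_deriv_unique:
  assumes "weak_deriv x g" "weak_deriv x h" shows "g = h"
proof -
  define d where "d = g - h"
  have "AE t in I01. rep_l2 d t = 0"
  proof (rule AE_zero_if_bump_integrals_zero[OF integrable_rep_l2])
    have ae: "AE t in I01. rep_l2 g t + (-1) *\<^sub>R rep_l2 h t = rep_l2 d t"
      using rep_minus_l2[of g h] unfolding d_def by eventually_elim simp
    have prim0: "prim (rep_l2 d) t = 0" if t: "t \<in> {0..1}" for t
    proof -
      have "prim (rep_l2 d) t = prim (\<lambda>s. rep_l2 g s + (-1) *\<^sub>R rep_l2 h s) t"
        by (rule prim_cong_AE) (use ae in \<open>measurable, auto elim!: eventually_mono\<close>)
      also have "\<dots> = prim (rep_l2 g) t + prim (\<lambda>s. (-1) *\<^sub>R rep_l2 h s) t"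
        by (intro prim_add) auto
      also have "prim (\<lambda>s. (-1) *\<^sub>R rep_l2 h s) t = (-1) *\<^sub>R prim (rep_l2 h) t"
        by (intro prim_bounded_linear bounded_linear_scaleR_right) simp
      finally show ?thesis
        using weak_deriv_cont_rep(2)[OF assms(1) t] weak_deriv_cont_rep(2)[OF assms(2) t] by simp
    qed
    fix \<psi> assume \<psi>: "bump \<psi>"
    have "norm (LINT t|I01. \<psi> t *\<^sub>R rep_l2 d t) \<le> 0 + e * (LINT t|I01. norm (rep_l2 d t))" if e: "e > 0" for e
    proof -
      \<comment> \<open>bump functions are only continuous, so integration by parts needs a smooth substitute\<close>
      obtain p where p: "real_polynomial_function p" "\<And>t. t \<in> {0..1} \<Longrightarrow> \<bar>\<psi> t - p t\<bar> < e"
        using Stone_Weierstrass_real_polynomial_function[OF compact_Icc bump_continuous[OF \<psi>] e] by blast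
      obtain p' where p': "real_polynomial_function p'" "\<And>t. (p has_real_derivative p' t) (at t)"
        using has_real_derivative_polynomial_function[OF p(1)] by blast
      have cont: "continuous_on {0..1} p" "continuous_on {0..1} p'"
        using p(1) p'(1) by (auto intro!: continuous_at_imp_continuous_on continuous_real_polymonial_function)
      have p_prim: "p t = p 0 + prim p' t" if "t \<in> {0..1}" for t
      proof (rule prim_derivative[OF _ cont(2) that])
        show "(p has_vector_derivative p' s) (at s within {0..1})" for s
          using p'(2)[of s] by (simp add: has_real_derivative_iff_has_vector_derivative has_vector_derivative_at_within)
      qed
      have "(LINT t|I01. p' t *\<^sub>R prim (rep_l2 d) t) + (LINT t|I01. p t *\<^sub>R rep_l2 d t) = 0"
        using integration_by_parts_I01[OF bounded_bilinear_scaleR integrable_square_integrable[OF square_integrable_continuous[OF cont(2)]]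
            integrable_rep_l2[of d] p_prim, of "prim (rep_l2 d)" 0] prim0 by simp
      moreover have "(LINT t|I01. p' t *\<^sub>R prim (rep_l2 d) t) = 0"
        using prim0 by (intro integral_eq_zero_AE) (auto intro!: AE_I2)
      ultimately have p0: "(LINT t|I01. p t *\<^sub>R rep_l2 d t) = 0" by simp
      have int: "integrable I01 (\<lambda>t. f t *\<^sub>R rep_l2 d t)" if "continuous_on {0..1} f" for f :: "real \<Rightarrow> real"
        using integrable_I01_bounded_mult[OF integrable_rep_l2 that bounded_bilinear.flip[OF bounded_bilinear_scaleR]] .
      note ints = int[OF cont(1)] int[OF bump_continuous[OF \<psi>]]
      have "(LINT t|I01. \<psi> t *\<^sub>R rep_l2 d t) = (LINT t|I01. (\<psi> t - p t) *\<^sub>R rep_l2 d t)"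
        using ints p0 by (simp add: scaleR_diff_left)
      also have "norm \<dots> \<le> (LINT t|I01. e * norm (rep_l2 d t))"
      proof (rule Bochner_Integration.integral_norm_bound_integral)
        show "integrable I01 (\<lambda>t. (\<psi> t - p t) *\<^sub>R rep_l2 d t)"
          using ints by (simp add: scaleR_diff_left)
        fix t assume "t \<in> space I01"
        then show "norm ((\<psi> t - p t) *\<^sub>R rep_l2 d t) \<le> e * norm (rep_l2 d t)"
          using p(2)[of t] by (auto intro!: mult_right_mono)
      qed simp
      finally show ?thesis by simp
    qed
    note * = this
    have "norm (LINT t|I01. \<psi> t *\<^sub>R rep_l2 d t) \<le> 0"
    proof (rule field_le_epsilon)
      fix e :: real assume e: "e > 0"
      define L where "L = (LINT t|I01. norm (rep_l2 d t))"
      have "L \<ge> 0" unfolding L_def by simp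
      then have "e / (L + 1) > 0" "e / (L + 1) * L \<le> e" using e by (auto simp: field_simps)
      then show "norm (LINT t|I01. \<psi> t *\<^sub>R rep_l2 d t) \<le> 0 + e"
        using *[of "e / (L + 1)"] unfolding L_def[symmetric] by linarith
    qed
    then show "(LINT t|I01. \<psi> t *\<^sub>R rep_l2 d t) = 0" by simp
  qed
  then have "AE t in I01. rep_l2 g t = rep_l2 h t"
    using rep_minus_l2[of g h] unfolding d_def by eventually_elim simp
  then show ?thesis by (rule l2_eqI)
qed

section \<open>Calculus in Sobolev spaces\<close>

lemma wderiv_eqI: "weak_deriv x g \<Longrightarrow> wderiv x = g"
  unfolding wderiv_def by (rule the_equality) (auto intro: weak_deriv_unique)

lemma prim_rep_add: "prim (rep_l2 (g + h)) t = prim (rep_l2 g) t + prim (rep_l2 h) t"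
proof -
  have "prim (rep_l2 (g + h)) t = prim (\<lambda>s. rep_l2 g s + rep_l2 h s) t"
    by (rule prim_cong_AE[OF rep_plus_l2]) measurable
  then show ?thesis by (simp add: prim_add)
qed

lemma prim_rep_scaleC:
  fixes g :: "'a::{complex_inner, euclidean_space} l2"
  shows "prim (rep_l2 (c *\<^sub>C g)) t = c *\<^sub>C prim (rep_l2 g) t"
proof -
  have bl: "bounded_linear (\<lambda>x::'a. c *\<^sub>C x)"
    by (rule linear_conv_bounded_linear[THEN iffD1, OF linear_scaleC])
  have "(\<lambda>s. c *\<^sub>C rep_l2 g s) \<in> borel_measurable I01"
    using square_integrable_scaleC[OF square_integrable_rep[of g], of c] by (simp add: square_integrable_def)
  then have "prim (rep_l2 (c *\<^sub>C g)) t = prim (\<lambda>s. c *\<^sub>C rep_l2 g s) t"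
    by (intro prim_cong_AE[OF rep_scaleC_l2]) auto
  then show ?thesis by (simp add: prim_bounded_linear[OF bl])
qed

lemma weak_deriv_add:
  assumes "weak_deriv x g" "weak_deriv y h" shows "weak_deriv (x + y) (g + h)"
proof -
  obtain c d where "AE t in I01. rep_l2 x t = c + prim (rep_l2 g) t" "AE t in I01. rep_l2 y t = d + prim (rep_l2 h) t"
    using assms by (auto simp: weak_deriv_iff_prim)
  then have "AE t in I01. rep_l2 (x + y) t = (c + d) + prim (rep_l2 (g + h)) t"
    using rep_plus_l2[of x y] by eventually_elim (simp add: prim_rep_add)
  then show ?thesis unfolding weak_deriv_iff_prim by blast
qed

lemma weak_deriv_scaleC:
  fixes x g :: "'a::{complex_inner, euclidean_space} l2"
  assumes "weak_deriv x g" shows "weak_deriv (c *\<^sub>C x) (c *\<^sub>C g)"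
proof -
  obtain d where "AE t in I01. rep_l2 x t = d + prim (rep_l2 g) t"
    using assms by (auto simp: weak_deriv_iff_prim)
  then have "AE t in I01. rep_l2 (c *\<^sub>C x) t = c *\<^sub>C d + prim (rep_l2 (c *\<^sub>C g)) t"
    using rep_scaleC_l2[of c x] by eventually_elim (simp add: prim_rep_scaleC scaleC_add_right)
  then show ?thesis unfolding weak_deriv_iff_prim by blast
qed

lemma weak_deriv_cont_rep_continuous:
  assumes "weak_deriv x g" shows "continuous_on {0..1} (cont_rep x)"
proof -
  have "continuous_on {0..1} (\<lambda>t. cont_rep x 0 + prim (rep_l2 g) t)"
    by (intro continuous_intros continuous_prim integrable_rep_l2)
  then show ?thesis
    by (rule continuous_on_eq) (simp add: weak_deriv_cont_rep(2)[OF assms, symmetric])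
qed

lemma cont_rep_add:
  assumes "weak_deriv x g" "weak_deriv y h" "t \<in> {0..1}"
  shows "cont_rep (x + y) t = cont_rep x t + cont_rep y t"
proof (rule cont_rep_eqI[OF _ _ assms(3)])
  show "continuous_on {0..1} (\<lambda>t. cont_rep x t + cont_rep y t)"
    by (intro continuous_intros weak_deriv_cont_rep_continuous[OF assms(1)] weak_deriv_cont_rep_continuous[OF assms(2)])
  show "AE t in I01. rep_l2 (x + y) t = cont_rep x t + cont_rep y t"
    using rep_plus_l2[of x y] weak_deriv_cont_rep(1)[OF assms(1)] weak_deriv_cont_rep(1)[OF assms(2)]
    by eventually_elim simp
qed

lemma cont_rep_scaleC:
  fixes x g :: "'a::{complex_inner, euclidean_space} l2"
  assumes "weak_deriv x g" "t \<in> {0..1}"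
  shows "cont_rep (c *\<^sub>C x) t = c *\<^sub>C cont_rep x t"
proof (rule cont_rep_eqI[OF _ _ assms(2)])
  have "bounded_linear (\<lambda>x::'a. c *\<^sub>C x)"
    by (rule linear_conv_bounded_linear[THEN iffD1, OF linear_scaleC])
  then show "continuous_on {0..1} (\<lambda>t. c *\<^sub>C cont_rep x t)"
    by (rule bounded_linear.continuous_on) (rule weak_deriv_cont_rep_continuous[OF assms(1)])
  show "AE t in I01. rep_l2 (c *\<^sub>C x) t = c *\<^sub>C cont_rep x t"
    using rep_scaleC_l2[of c x] weak_deriv_cont_rep(1)[OF assms(1)]
    by eventually_elim simp
qed

lemma sobolev_SucD:
  assumes "x \<in> sobolev (Suc n)" shows "weak_deriv x (wderiv x)" "wderiv x \<in> sobolev n"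
  using assms by (auto simp: wderiv_eqI)

lemma sobolev_weak_deriv:
  "x \<in> sobolev n \<Longrightarrow> k < n \<Longrightarrow> weak_deriv ((wderiv ^^ k) x) ((wderiv ^^ Suc k) x)"
proof (induction n arbitrary: x k)
  case (Suc n)
  note x = sobolev_SucD[OF Suc.prems(1)]
  show ?case
  proof (cases k)
    case (Suc j)
    then have "weak_deriv ((wderiv ^^ j) (wderiv x)) ((wderiv ^^ Suc j) (wderiv x))"
      using Suc.IH[OF x(2)] Suc.prems(2) by simp
    then show ?thesis using Suc by (simp only: funpow_Suc_right o_apply)
  qed (use x in simp)
qed simp

text \<open>An explicit chain of weak derivatives gives membership in the Sobolev space and all derivatives at
  once, without referring to the description operator behind the derivative.\<close>

lemma sobolevI:
  assumes "\<And>k. k < n \<Longrightarrow> weak_deriv (f k) (f (Suc k))"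
  shows "f 0 \<in> sobolev n" "k \<le> n \<Longrightarrow> (wderiv ^^ k) (f 0) = f k"
proof -
  have "f i \<in> sobolev (n - i)" if "i \<le> n" for i
    using that
  proof (induction "n - i" arbitrary: i)
    case (Suc m)
    then have "f (Suc i) \<in> sobolev (n - Suc i)" by (intro Suc.hyps(1)) auto
    moreover have "n - i = Suc (n - Suc i)" using Suc by simp
    moreover have "weak_deriv (f i) (f (Suc i))" using Suc by (intro assms) simp
    ultimately show ?case by auto
  qed simp
  from this[of 0] show "f 0 \<in> sobolev n" by simp
  show "k \<le> n \<Longrightarrow> (wderiv ^^ k) (f 0) = f k"
    by (induction k) (auto simp: wderiv_eqI assms)
qed

lemma sobolev_add:
  assumes "x \<in> sobolev n" "y \<in> sobolev n"
  shows "x + y \<in> sobolev n"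
    and "k \<le> n \<Longrightarrow> (wderiv ^^ k) (x + y) = (wderiv ^^ k) x + (wderiv ^^ k) y"
  using sobolevI[of n "\<lambda>k. (wderiv ^^ k) x + (wderiv ^^ k) y"]
    weak_deriv_add[OF sobolev_weak_deriv[OF assms(1)] sobolev_weak_deriv[OF assms(2)]] by auto

lemma sobolev_scaleC:
  fixes x :: "'a::{complex_inner, euclidean_space} l2"
  assumes "x \<in> sobolev n"
  shows "c *\<^sub>C x \<in> sobolev n"
    and "k \<le> n \<Longrightarrow> (wderiv ^^ k) (c *\<^sub>C x) = c *\<^sub>C (wderiv ^^ k) x"
  using sobolevI[of n "\<lambda>k. c *\<^sub>C (wderiv ^^ k) x"]
    weak_deriv_scaleC[OF sobolev_weak_deriv[OF assms]] by auto

lemma cont_rep_deriv_add: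
  assumes "x \<in> sobolev n" "y \<in> sobolev n" "k < n" "t \<in> {0..1}"
  shows "cont_rep ((wderiv ^^ k) (x + y)) t = cont_rep ((wderiv ^^ k) x) t + cont_rep ((wderiv ^^ k) y) t"
  using sobolev_add(2)[OF assms(1,2), of k] assms(3)
    cont_rep_add[OF sobolev_weak_deriv[OF assms(1,3)] sobolev_weak_deriv[OF assms(2,3)] assms(4)] by simp

lemma cont_rep_deriv_scaleC:
  fixes x :: "'a::{complex_inner, euclidean_space} l2"
  assumes "x \<in> sobolev n" "k < n" "t \<in> {0..1}"
  shows "cont_rep ((wderiv ^^ k) (c *\<^sub>C x)) t = c *\<^sub>C cont_rep ((wderiv ^^ k) x) t"
  using sobolev_scaleC(2)[OF assms(1), of k] assms(2)
    cont_rep_scaleC[OF sobolev_weak_deriv[OF assms(1,2)] assms(3)] by simp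

section \<open>The energy balance\<close>

lemma pos_bij: "bij_betw (pos :: 'n::{finite, linorder} \<Rightarrow> nat) UNIV {1..CARD('n)}"
proof -
  have "pos i < pos j" if "i < j" for i j :: 'n
  proof -
    have "j \<in> {l. l \<le> j}" "j \<notin> {l. l \<le> i}" using that by auto
    moreover have "{l. l \<le> i} \<subseteq> {l. l \<le> j}" using that by auto
    ultimately show ?thesis unfolding pos_def by (intro psubset_card_mono) auto
  qed
  then have "strict_mono (pos :: 'n \<Rightarrow> nat)" by (rule strict_monoI)
  then have inj: "inj (pos :: 'n \<Rightarrow> nat)" by (rule strict_mono_imp_inj_on)
  have "pos i \<in> {1..CARD('n)}" for i :: 'n
    unfolding pos_def by (auto simp: Suc_le_eq card_gt_0_iff intro!: card_mono)
  then have "range (pos :: 'n \<Rightarrow> nat) \<subseteq> {1..CARD('n)}" by blast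
  then have "range (pos :: 'n \<Rightarrow> nat) = {1..CARD('n)}"
    using inj by (intro card_subset_eq) (auto simp: card_image)
  with inj show ?thesis by (simp add: bij_betw_def)
qed

lemma pos_ge_1: "1 \<le> pos (i :: 'n::{finite, linorder})" "pos i \<le> CARD('n)"
  using bij_betw_apply[OF pos_bij, of i] by auto

lemma sum_pos: "(\<Sum>i\<in>(UNIV :: 'n::{finite, linorder} set). F (pos i - 1)) = (\<Sum>a<CARD('n). F a)"
proof -
  have "(\<Sum>i\<in>(UNIV :: 'n set). F (pos i - 1)) = (\<Sum>m\<in>{1..CARD('n)}. F (m - 1))"
    by (rule sum.reindex_bij_betw[OF pos_bij])
  also have "\<dots> = (\<Sum>a<CARD('n). F a)"
    by (rule sum.reindex_bij_witness[of _ Suc "\<lambda>m. m - 1"]) auto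
  finally show ?thesis .
qed

lemma pos_surj:
  assumes "k < CARD('n)" shows "\<exists>i :: 'n::{finite, linorder}. pos i = Suc k"
proof -
  have "Suc k \<in> range (pos :: 'n \<Rightarrow> nat)"
    using assms bij_betw_imp_surj_on[OF pos_bij[where 'n = 'n]] by simp
  then show ?thesis by (metis imageE)
qed

lemma bounded_clinear_linear: "bounded_clinear f \<Longrightarrow> linear f"
  by (simp add: bounded_clinear_def bounded_linear.linear)

text \<open>The real adjoint of a complex-linear operator also represents the Hermitian product, whose imaginary
  part is a real inner product with an argument rotated by \<open>i\<close>.\<close>

lemma cadjoint_eq_adjoint:
  fixes f :: "'a::{complex_inner, euclidean_space} \<Rightarrow> 'b::{complex_inner, euclidean_space}"
  assumes f: "bounded_clinear f" shows "cadjoint f = adjoint f"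
proof -
  have adj: "inner (f x) y = inner x (adjoint f y)" for x y
    using adjoint_works[OF bounded_clinear_linear[OF f]] by simp
  have "cinner (f x) y = cinner x (adjoint f y)" for x y
  proof -
    have "inner (\<i> *\<^sub>C f x) y = inner (\<i> *\<^sub>C x) (adjoint f y)"
      using f adj by (metis bounded_clinear_def)
    then show ?thesis by (simp add: cinner_eq adj)
  qed
  then have "\<exists>g. \<forall>x y. cinner (f x) y = cinner x (g y)" by blast
  then have "\<forall>x y. cinner (f x) y = cinner x (cadjoint f y)"
    unfolding cadjoint_def by (rule someI_ex)
  then have "inner (f x) y = inner x (cadjoint f y)" for x y by (metis Re_cinner)
  then show ?thesis by (intro adjoint_unique[symmetric]) simp
qed

lemma inner_cadjoint:
  fixes f :: "'a::{complex_inner, euclidean_space} \<Rightarrow> 'b::{complex_inner, euclidean_space}"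
  assumes "bounded_clinear f" shows "inner (f x) y = inner x (cadjoint f y)"
  using adjoint_works[OF bounded_clinear_linear[OF assms]] by (simp add: cadjoint_eq_adjoint assms)

lemma inner_mult_op_const:
  assumes "bounded_clinear P"
  shows "inner (mult_op (\<lambda>_. P) x) y = (LINT t|I01. inner (P (rep_l2 x t)) (rep_l2 y t))"
proof -
  have bl: "bounded_linear P" using assms by (simp add: bounded_clinear_def)
  have "P \<in> borel_measurable borel"
    by (intro borel_measurable_continuous_onI linear_continuous_on bl)
  then have [measurable]: "(\<lambda>t. P (rep_l2 x t)) \<in> borel_measurable I01"
    by (rule measurable_compose[OF measurable_rep_l2])
  show ?thesis
    unfolding inner_l2_eq
    by (rule integral_cong_AE) (use rep_mult_op[OF Linf_op_const[OF assms], of x] in \<open>auto elim!: eventually_mono\<close>)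
qed

lemma integration_by_parts_l2:
  assumes P: "bounded_clinear P" and x: "weak_deriv x g" and y: "weak_deriv y h"
  shows "inner (mult_op (\<lambda>_. P) g) y + inner (mult_op (\<lambda>_. P) x) h =
    inner (P (cont_rep x 1)) (cont_rep y 1) - inner (P (cont_rep x 0)) (cont_rep y 0)"
proof -
  have bl: "bounded_linear P" using P by (simp add: bounded_clinear_def)
  have bb: "bounded_bilinear (\<lambda>a b. inner (P a) b)"
    by (rule bounded_bilinear.comp1[OF bounded_bilinear_inner bl])
  have Pm: "P \<in> borel_measurable borel"
    by (intro borel_measurable_continuous_onI linear_continuous_on bl)
  have [measurable]: "(\<lambda>t. P (rep_l2 z t)) \<in> borel_measurable I01" for z
    by (rule measurable_compose[OF measurable_rep_l2 Pm])
  have c: "cont_rep x \<in> borel_measurable I01" "cont_rep y \<in> borel_measurable I01"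
    using weak_deriv_cont_rep_continuous[OF x] weak_deriv_cont_rep_continuous[OF y]
    by (auto intro: continuous_imp_measurable_on_sets_lebesgue)
  note [measurable] = c(2) measurable_compose[OF c(1) Pm]
  have 1: "inner (mult_op (\<lambda>_. P) g) y = (LINT t|I01. inner (P (rep_l2 g t)) (cont_rep y t))"
    unfolding inner_mult_op_const[OF P]
    by (rule integral_cong_AE) (use weak_deriv_cont_rep(1)[OF y] in \<open>auto elim!: eventually_mono\<close>)
  have 2: "inner (mult_op (\<lambda>_. P) x) h = (LINT t|I01. inner (P (cont_rep x t)) (rep_l2 h t))"
    unfolding inner_mult_op_const[OF P]
    by (rule integral_cong_AE) (use weak_deriv_cont_rep(1)[OF x] in \<open>auto elim!: eventually_mono\<close>)
  show ?thesis
    unfolding 1 2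
    by (rule integration_by_parts_I01[OF bb integrable_rep_l2 integrable_rep_l2 weak_deriv_cont_rep(2)[OF x] weak_deriv_cont_rep(2)[OF y]])
qed

lemma sum_alternating_telescope:
  fixes a :: "nat \<Rightarrow> real"
  shows "(\<Sum>m<n. (-1) ^ m * (a m + a (Suc m))) = a 0 - (-1) ^ n * a n"
  by (induction n) (auto simp: algebra_simps)

text \<open>Collecting the entries of the matrix along antidiagonals, on which the coefficient is constant.\<close>

lemma inner_Q_op:
  fixes u v :: "('h::{complex_inner, euclidean_space}, 'n::{finite, linorder}) vec"
  assumes u: "\<And>i. u $ i = U (pos i - 1)" and v: "\<And>i. v $ i = V (pos i - 1)"
  shows "inner u (Q_op P v) = (\<Sum>k<CARD('n). \<Sum>m\<le>k. (-1) ^ m * inner (U m) (P (Suc k) (V (k - m))))"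
proof -
  let ?N = "CARD('n)"
  let ?F = "\<lambda>a b. (-1) ^ a * inner (U a) (P (Suc (a + b)) (V b))"
  have "inner u (Q_op P v) = (\<Sum>i\<in>UNIV. \<Sum>j\<in>UNIV.
      if (pos i - 1) + (pos j - 1) < ?N then ?F (pos (i::'n) - 1) (pos (j::'n) - 1) else 0)"
    unfolding inner_vec_def Q_op_def vec_lambda_beta inner_sum_right
  proof (intro sum.cong refl)
    fix i j :: 'n
    have eqs: "pos i + pos j \<le> ?N + 1 \<longleftrightarrow> (pos i - 1) + (pos j - 1) < ?N"
      "pos i + pos j - 1 = Suc ((pos i - 1) + (pos j - 1))"
      using pos_ge_1[of i] pos_ge_1[of j] by auto
    show "inner (u $ i) (if pos i + pos j \<le> ?N + 1
          then (- 1) ^ (pos i - 1) *\<^sub>R P (pos i + pos j - 1) (v $ j) else 0) =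
        (if (pos i - 1) + (pos j - 1) < ?N then ?F (pos i - 1) (pos j - 1) else 0)"
      unfolding eqs u v by (cases "(pos i - 1) + (pos j - 1) < ?N") (simp_all only: if_True if_False
        inner_scaleR_right inner_zero_right)
  qed
  also have "\<dots> = (\<Sum>a<?N. \<Sum>b<?N. if a + b < ?N then ?F a b else 0)"
    by (simp only: sum_pos[of "\<lambda>b. if a + b < ?N then ?F a b else 0" for a]
        sum_pos[where F = "\<lambda>a. \<Sum>b<?N. if a + b < ?N then ?F a b else 0"])
  also have "\<dots> = (\<Sum>(a, b)\<in>{..<?N} \<times> {..<?N}. if a + b < ?N then ?F a b else 0)"
    by (rule sum.cartesian_product)
  also have "\<dots> = (\<Sum>(a, b)\<in>{(a, b). a + b < ?N}. ?F a b)"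
    by (rule sum.mono_neutral_cong_right) (auto split: if_splits)
  also have "\<dots> = (\<Sum>k<?N. \<Sum>m\<le>k. ?F m (k - m))"
    by (rule sum.triangle_reindex)
  finally show ?thesis by simp
qed

text \<open>For fixed \<open>k\<close> put \<open>I m = \<langle>P\<^sub>k x\<^sup>(\<^sup>k\<^sup>-\<^sup>m\<^sup>), x\<^sup>(\<^sup>m\<^sup>)\<rangle>\<close>. Integration by parts evaluates \<open>I m + I (m + 1)\<close> as a boundary term, the
  alternating sum of these telescopes, and symmetry gives \<open>I k = (-1)\<^sup>k\<^sup>+\<^sup>1 I 0\<close>, so the two ends add up.\<close>

theorem energy_balance:
  fixes P :: "nat \<Rightarrow> 'h::{complex_inner, euclidean_space} \<Rightarrow> 'h" and x :: "'h l2"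
  assumes bdd: "\<And>k. k \<le> CARD('n) \<Longrightarrow> bounded_clinear (P k)"
    and adj: "\<And>k. 1 \<le> k \<Longrightarrow> k \<le> CARD('n) \<Longrightarrow> cadjoint (P k) = (\<lambda>x. (-1) ^ (k + 1) *\<^sub>R P k x)"
    and x: "x \<in> sobolev CARD('n)"
    and u: "u = (boundary_vec x 1 :: ('h, 'n::{finite, linorder}) vec)" and y: "y = (boundary_vec x 0 :: ('h, 'n) vec)"
  shows "2 * inner (diff_op CARD('n) P x) x =
    2 * inner (mult_op (\<lambda>_. P 0) x) x + (inner u (Q_op P u) - inner y (Q_op P y))"
proof -
  let ?N = "CARD('n)"
  define d where "d k = (wderiv ^^ k) x" for k
  define E where "E t k = (\<Sum>m\<le>k. (-1) ^ m * inner (cont_rep (d m) t) (P (Suc k) (cont_rep (d (k - m)) t)))" for t k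
  have d: "weak_deriv (d k) (d (Suc k))" if "k < ?N" for k
    using sobolev_weak_deriv[OF x that] by (simp add: d_def)
  have step: "2 * inner (mult_op (\<lambda>_. P (Suc k)) (d (Suc k))) x = E 1 k - E 0 k" if k: "k < ?N" for k
  proof -
    let ?P = "P (Suc k)"
    have P: "bounded_clinear ?P" using bdd k by simp
    \<comment> \<open>the integral with \<open>m\<close> derivatives moved to the right factor\<close>
    define I where "I m = inner (mult_op (\<lambda>_. ?P) (d (Suc k - m))) (d m)" for m
    have parts: "I m + I (Suc m) = inner (cont_rep (d m) 1) (?P (cont_rep (d (k - m)) 1)) -
        inner (cont_rep (d m) 0) (?P (cont_rep (d (k - m)) 0))" if m: "m \<le> k" for m
      using integration_by_parts_l2[OF P d[of "k - m"] d[of m]] m k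
      by (simp add: I_def Suc_diff_le inner_commute)
    have "E 1 k - E 0 k = (\<Sum>m\<le>k. (-1) ^ m * (I m + I (Suc m)))"
      unfolding E_def sum_subtractf[symmetric] by (intro sum.cong refl) (simp add: parts algebra_simps)
    also have "\<dots> = I 0 - (-1) ^ Suc k * I (Suc k)"
      using sum_alternating_telescope[of I "Suc k"] by (simp add: lessThan_Suc_atMost)
    also have "I (Suc k) = (-1) ^ Suc (Suc k) * I 0"
    proof -
      have sw: "inner (?P a) b = (-1) ^ Suc (Suc k) * inner (?P b) a" for a b
        using inner_cadjoint[OF P, of a b] adj[of "Suc k"] k by (simp add: inner_commute)
      have "I (Suc k) = (LINT t|I01. inner (?P (rep_l2 (d 0) t)) (rep_l2 (d (Suc k)) t))"
        unfolding I_def inner_mult_op_const[OF P] by simp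
      also have "\<dots> = (LINT t|I01. (-1) ^ Suc (Suc k) * inner (?P (rep_l2 (d (Suc k)) t)) (rep_l2 (d 0) t))"
        by (intro Bochner_Integration.integral_cong refl sw)
      also have "\<dots> = (-1) ^ Suc (Suc k) * I 0"
        unfolding I_def inner_mult_op_const[OF P] by simp
      finally show ?thesis .
    qed
    also have "I 0 - (-1) ^ Suc k * ((-1) ^ Suc (Suc k) * I 0) = 2 * I 0"
      by (cases "even k") simp_all
    finally show ?thesis by (simp add: I_def d_def)
  qed
  have "diff_op ?N P x = mult_op (\<lambda>_. P 0) x + (\<Sum>k<?N. mult_op (\<lambda>_. P (Suc k)) (d (Suc k)))"
    unfolding diff_op_def d_def by (subst sum.atMost_shift) simp
  then have "2 * inner (diff_op ?N P x) x = 2 * inner (mult_op (\<lambda>_. P 0) x) x +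
      (\<Sum>k<?N. 2 * inner (mult_op (\<lambda>_. P (Suc k)) (d (Suc k))) x)"
    by (simp add: inner_add_left inner_sum_left sum_distrib_left)
  also have "(\<Sum>k<?N. 2 * inner (mult_op (\<lambda>_. P (Suc k)) (d (Suc k))) x) = (\<Sum>k<?N. E 1 k) - (\<Sum>k<?N. E 0 k)"
    by (simp add: step sum_subtractf)
  also have "(\<Sum>k<?N. E 1 k) = inner u (Q_op P u)"
    unfolding E_def by (rule inner_Q_op[symmetric]) (simp_all add: u boundary_vec_def d_def)
  also have "(\<Sum>k<?N. E 0 k) = inner y (Q_op P y)"
    unfolding E_def by (rule inner_Q_op[symmetric]) (simp_all add: y boundary_vec_def d_def)
  finally show ?thesis .
qed

section \<open>Symmetric and adjoint operators\<close>

lemma bounded_clinearI: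
  fixes f :: "'a::{complex_inner, euclidean_space} \<Rightarrow> 'b::complex_inner"
  assumes "linear f" "\<And>c x. f (c *\<^sub>C x) = c *\<^sub>C f x" shows "bounded_clinear f"
  using assms by (simp add: bounded_clinear_def linear_conv_bounded_linear)

lemma bounded_clinear_scaleC: "bounded_clinear f \<Longrightarrow> f (c *\<^sub>C x) = c *\<^sub>C f x"
  by (simp add: bounded_clinear_def)

lemma scaleC_minus: "c *\<^sub>C (- x) = - (c *\<^sub>C (x::'a::complex_inner))"
  by (rule linear_neg[OF linear_scaleC])

lemma scaleC_diff: "c *\<^sub>C (x - y) = c *\<^sub>C x - c *\<^sub>C (y::'a::complex_inner)"
  by (rule linear_diff[OF linear_scaleC])

lemma inner_scaleC_i: "inner (\<i> *\<^sub>C x) y = - inner x (\<i> *\<^sub>C (y::'a::complex_inner))"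
proof -
  have "inner x (\<i> *\<^sub>C y) = Re (cnj (cinner (\<i> *\<^sub>C y) x))"
    by (metis Re_cinner cinner_commute)
  also have "\<dots> = Im (cinner x y)"
    by (simp add: cinner_scaleC_left cinner_commute[of x y])
  also have "\<dots> = - inner (\<i> *\<^sub>C x) y" by (simp add: cinner_eq)
  finally show ?thesis by simp
qed

text \<open>The imaginary part is \<open>- \<langle>i x, S x\<rangle>\<close>. Moving \<open>S\<close> and then \<open>i\<close>, which is skew-adjoint for the
  real inner product, to the other side shows that this number equals its own negative.\<close>

lemma Im_cinner_symmetric:
  assumes sym: "\<And>x y. inner (S x) y = inner x (S y)" and lin: "\<And>x. S (\<i> *\<^sub>C x) = \<i> *\<^sub>C S x"
  shows "Im (cinner x (S x)) = 0"
proof -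
  have "inner (\<i> *\<^sub>C x) (S x) = inner (\<i> *\<^sub>C S x) x" using sym[of "\<i> *\<^sub>C x" x] lin by simp
  also have "\<dots> = - inner (\<i> *\<^sub>C x) (S x)" using inner_scaleC_i[of x "S x"] by (simp add: inner_commute inner_scaleC_i)
  finally show ?thesis by (simp add: cinner_eq)
qed

lemma op_nonneg_iff:
  assumes "\<And>x y. inner (S x) y = inner x (S y)" "\<And>x. S (\<i> *\<^sub>C x) = \<i> *\<^sub>C S x"
  shows "op_nonneg S \<longleftrightarrow> (\<forall>x. 0 \<le> inner x (S x))"
  using Im_cinner_symmetric[OF assms]
  by (simp add: op_nonneg_def complex_nonneg_Reals_iff Re_cinner)

text \<open>Realness of the quadratic form at \<open>x + i y\<close> makes the mixed terms cancel (polarization).\<close>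

lemma op_nonneg_symmetric:
  fixes S :: "'a::complex_inner \<Rightarrow> 'a"
  assumes S: "bounded_clinear S" and nn: "op_nonneg S"
  shows "inner (S x) y = inner x (S y)" and "0 \<le> inner x (S x)"
proof -
  have lin: "linear S" using S by (rule bounded_clinear_linear)
  have im: "inner (\<i> *\<^sub>C z) (S z) = 0" and re: "0 \<le> inner z (S z)" for z
    using nn by (auto simp: op_nonneg_def complex_nonneg_Reals_iff cinner_eq dest: spec[of _ z])
  show "0 \<le> inner x (S x)" by (rule re)
  define w where "w = \<i> *\<^sub>C y"
  have iw: "\<i> *\<^sub>C w = - y"
    unfolding w_def by (simp add: scaleC_scaleC) (metis scaleC_of_real of_real_1 of_real_minus scaleR_minus1_left)
  have "inner (\<i> *\<^sub>C (x + w)) (S (x + w)) = 0" by (rule im)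
  then have "inner (\<i> *\<^sub>C x) (S w) + inner (\<i> *\<^sub>C w) (S x) = 0"
    using im[of x] im[of w] lin by (simp add: scaleC_add_right inner_add_left inner_add_right linear_add)
  moreover have "S w = \<i> *\<^sub>C S y" unfolding w_def using S by (simp add: bounded_clinear_scaleC)
  moreover have "inner (\<i> *\<^sub>C x) (\<i> *\<^sub>C S y) = inner x (S y)"
  proof -
    have "inner (\<i> *\<^sub>C x) (\<i> *\<^sub>C S y) = - inner x (\<i> *\<^sub>C \<i> *\<^sub>C S y)" by (rule inner_scaleC_i)
    also have "\<i> *\<^sub>C \<i> *\<^sub>C S y = - S y"
      by (simp add: scaleC_scaleC) (metis scaleC_of_real of_real_1 of_real_minus scaleR_minus1_left)
    finally show ?thesis by simp
  qed
  ultimately show "inner (S x) y = inner x (S y)" using iw by (simp add: inner_commute)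
qed

lemma op_nonpos_Re_op_iff:
  fixes P :: "'a::{complex_inner, euclidean_space} \<Rightarrow> 'a"
  assumes P: "bounded_clinear P"
  shows "op_nonpos (Re_op P) \<longleftrightarrow> (\<forall>x. inner (P x) x \<le> 0)"
proof -
  have adj: "inner (P x) y = inner x (cadjoint P y)" for x y by (rule inner_cadjoint[OF P])
  have adj': "inner (cadjoint P x) y = inner x (P y)" for x y using adj by (metis inner_commute)
  have sym: "inner (Re_op P x) y = inner x (Re_op P y)" for x y
    by (simp add: Re_op_def inner_add_left inner_add_right adj adj')
  have cl: "cadjoint P (\<i> *\<^sub>C x) = \<i> *\<^sub>C cadjoint P x" for x
  proof (rule euclidean_eqI)
    fix b :: 'a
    have "inner (cadjoint P (\<i> *\<^sub>C x)) b = - inner x (P (\<i> *\<^sub>C b))"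
      using P by (simp add: adj' inner_scaleC_i bounded_clinear_scaleC)
    also have "\<dots> = inner (\<i> *\<^sub>C cadjoint P x) b" by (simp add: inner_scaleC_i adj')
    finally show "inner (cadjoint P (\<i> *\<^sub>C x)) b = inner (\<i> *\<^sub>C cadjoint P x) b" .
  qed
  have lin: "Re_op P (\<i> *\<^sub>C x) = \<i> *\<^sub>C Re_op P x" for x
    using P by (simp add: Re_op_def cl bounded_clinear_scaleC scaleC_scaleR scaleC_add_right)
  have "inner x (Re_op P x) = inner (P x) x" for x
    using adj[of x x] by (simp add: Re_op_def inner_add_right inner_commute)
  then show ?thesis
    using Im_cinner_symmetric[of "Re_op P", OF sym lin]
    by (simp add: op_nonpos_def complex_nonpos_Reals_iff Re_cinner)
qed

lemma onorm_le_1_iff: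
  assumes "bounded_linear V" shows "onorm V \<le> 1 \<longleftrightarrow> (\<forall>x. norm (V x) \<le> norm x)"
proof
  assume *: "onorm V \<le> 1"
  show "\<forall>x. norm (V x) \<le> norm x"
  proof
    fix x
    have "norm (V x) \<le> onorm V * norm x" by (rule onorm[OF assms])
    also have "\<dots> \<le> 1 * norm x" using * by (intro mult_right_mono) auto
    finally show "norm (V x) \<le> norm x" by simp
  qed
qed (auto intro: onorm_bound)

text \<open>From \<open>\<parallel>V\<^sup>* w\<parallel>\<^sup>2 = \<langle>V V\<^sup>* w, w\<rangle> \<le> \<parallel>V\<^sup>* w\<parallel> \<parallel>w\<parallel>\<close>.\<close>

lemma adjoint_contraction:
  fixes V :: "'a::euclidean_space \<Rightarrow> 'a"
  assumes V: "linear V" "\<And>x. norm (V x) \<le> norm x" shows "norm (adjoint V w) \<le> norm w"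
proof (cases "adjoint V w = 0")
  case False
  have "norm (adjoint V w) * norm (adjoint V w) = inner (V (adjoint V w)) w"
    using adjoint_works[OF V(1), of "adjoint V w" w]
    by (simp add: power2_eq_square[symmetric] power2_norm_eq_inner inner_commute)
  also have "\<dots> \<le> norm (V (adjoint V w)) * norm w" by (rule norm_cauchy_schwarz)
  also have "\<dots> \<le> norm (adjoint V w) * norm w" by (intro mult_right_mono V(2)) simp
  finally show ?thesis using False by simp
qed simp

section \<open>Boundary conditions in finite dimensions\<close>

lemma inner_polarization: "4 * inner f e = (norm (f + e))\<^sup>2 - (norm (f - e))\<^sup>2"
  by (simp add: power2_norm_eq_inner inner_add_left inner_add_right inner_diff_left inner_diff_right inner_commute)

locale boundary_operator =
  fixes W :: "'v \<times> 'v \<Rightarrow> 'v::{complex_inner, euclidean_space}"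
  assumes W: "bounded_clinear W"
begin

text \<open>The operator \<open>W\<^sub>1 + W\<^sub>2\<close>, that is, \<open>W\<close> on the diagonal.\<close>

definition diag :: "'v \<Rightarrow> 'v" where "diag u = W (u, 0) + W (0, u)"

lemma linW: "linear W" by (rule bounded_clinear_linear[OF W])

lemma diag_eq: "diag u = W (u, u)"
  using linear_add[OF linW, of "(u, 0)" "(0, u)"] by (simp add: diag_def)

lemma lin_diag: "linear diag"
  unfolding diag_eq using linW by (intro linearI) (metis add_Pair linear_add, metis scaleR_Pair linear_cmul)

definition contr :: bool where
  "contr \<longleftrightarrow> (\<exists>V. bounded_clinear V \<and> onorm V \<le> 1 \<and>
    (\<forall>f e. W (f, e) = (1/2) *\<^sub>R diag (f + V f + (e - V e))))"

definition dissip :: bool where "dissip \<longleftrightarrow> (\<forall>f e. W (f, e) = 0 \<longrightarrow> inner f e \<le> 0)"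

definition nonneg :: bool where "nonneg \<longleftrightarrow> op_nonneg (W \<circ> (\<lambda>(u, y). (y, u)) \<circ> cadjoint W)"

text \<open>The operator \<open>(W\<^sub>1 + W\<^sub>2)\<^sup>-\<^sup>1 (W\<^sub>1 - W\<^sub>2)\<close>, meaningful if \<open>W\<^sub>1 + W\<^sub>2\<close> is invertible.\<close>

definition cayley :: "'v \<Rightarrow> 'v" where "cayley x = inv diag (W (x, - x))"

lemma W_decomp: "W (f, e) = (1/2) *\<^sub>R (W (f + e, f + e) + W (f - e, - (f - e)))"
proof -
  have "W (f + e, f + e) + W (f - e, - (f - e)) = W (2 *\<^sub>R (f, e))"
    by (simp add: linear_add[OF linW, symmetric] scaleR_2)
  then show ?thesis by (simp only: linear_cmul[OF linW]) simp
qed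

context
  assumes inj: "inj diag"
begin

lemma bij_diag: "bij diag"
  using inj linear_injective_imp_surjective[OF lin_diag inj] by (simp add: bij_def)

lemma diag_cayley: "diag (cayley x) = W (x, - x)"
  unfolding cayley_def using bij_diag by (simp add: bij_is_surj surj_f_inv_f)

lemma cayley_eqI: "diag z = W (x, - x) \<Longrightarrow> cayley x = z"
  using inj by (metis diag_cayley injD)

lemma clinear_cayley: "bounded_clinear cayley"
proof (rule bounded_clinearI)
  show "linear cayley"
  proof (rule linearI)
    show "cayley (x + y) = cayley x + cayley y" for x y
      by (rule cayley_eqI) (simp add: linear_add[OF lin_diag] diag_cayley linear_add[OF linW, symmetric])
    show "cayley (r *\<^sub>R x) = r *\<^sub>R cayley x" for r x
      by (rule cayley_eqI) (simp add: linear_cmul[OF lin_diag] diag_cayley linear_cmul[OF linW, symmetric])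
  qed
  show "cayley (c *\<^sub>C x) = c *\<^sub>C cayley x" for c x
  proof (rule cayley_eqI)
    have "diag (c *\<^sub>C cayley x) = c *\<^sub>C diag (cayley x)"
      using bounded_clinear_scaleC[OF W, of c "(cayley x, cayley x)"] by (simp add: diag_eq scaleC_prod_def)
    also have "\<dots> = W (c *\<^sub>C x, - (c *\<^sub>C x))"
      using bounded_clinear_scaleC[OF W, of c "(x, - x)"] by (simp add: diag_cayley scaleC_prod_def scaleC_minus)
    finally show "diag (c *\<^sub>C cayley x) = W (c *\<^sub>C x, - (c *\<^sub>C x))" .
  qed
qed

lemma lin_cayley: "linear cayley" by (rule bounded_clinear_linear[OF clinear_cayley])

lemma W_eq_diag: "W (f, e) = (1/2) *\<^sub>R diag (f + e + cayley (f - e))"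
proof -
  have "diag (f + e + cayley (f - e)) = diag (f + e) + diag (cayley (f - e))"
    by (rule linear_add[OF lin_diag])
  also have "\<dots> = W (f + e, f + e) + W (f - e, - (f - e))"
    unfolding diag_cayley unfolding diag_eq ..
  finally show ?thesis using W_decomp[of f e] by simp
qed

lemma W_zero_iff: "W (f, e) = 0 \<longleftrightarrow> f + e = - cayley (f - e)"
proof -
  have "W (f, e) = 0 \<longleftrightarrow> diag (f + e + cayley (f - e)) = diag 0"
    by (simp add: W_eq_diag linear_0[OF lin_diag])
  also have "\<dots> \<longleftrightarrow> f + e + cayley (f - e) = 0" using inj by (simp add: inj_eq)
  finally show ?thesis by (simp add: eq_neg_iff_add_eq_0)
qed

text \<open>An operator \<open>V\<close> as in the factorization is determined by its values: evaluating at \<open>(x, -x)\<close> shows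
  \<open>V = cayley\<close>.\<close>

lemma contr_iff_cayley: "contr \<longleftrightarrow> (\<forall>x. norm (cayley x) \<le> norm x)"
proof
  assume contr
  then obtain V where V: "bounded_clinear V" "onorm V \<le> 1"
    and eq: "\<And>f e. W (f, e) = (1/2) *\<^sub>R diag (f + V f + (e - V e))"
    unfolding contr_def by blast
  have linV: "linear V" by (rule bounded_clinear_linear[OF V(1)])
  have "cayley x = V x" for x
  proof (rule cayley_eqI)
    have "W (x, - x) = (1/2) *\<^sub>R diag (2 *\<^sub>R V x)"
      by (simp add: eq linear_neg[OF linV] scaleR_2)
    then show "diag (V x) = W (x, - x)" by (simp add: linear_cmul[OF lin_diag])
  qed
  then show "\<forall>x. norm (cayley x) \<le> norm x"
    using V onorm_le_1_iff[of V] by (simp add: bounded_clinear_def)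
next
  assume le: "\<forall>x. norm (cayley x) \<le> norm x"
  have "f + cayley f + (e - cayley e) = f + e + cayley (f - e)" for f e
    by (simp add: linear_diff[OF lin_cayley])
  then have "W (f, e) = (1/2) *\<^sub>R diag (f + cayley f + (e - cayley e))" for f e
    by (simp only: W_eq_diag)
  then show contr
    unfolding contr_def
    using clinear_cayley le onorm_le_1_iff[of cayley] by (intro exI[of _ cayley]) (simp add: bounded_clinear_def)
qed

text \<open>On the kernel \<open>f + e = - V (f - e)\<close>, and \<open>f - e\<close> takes every value there.\<close>

lemma dissip_iff_cayley: "dissip \<longleftrightarrow> (\<forall>x. norm (cayley x) \<le> norm x)"
proof
  assume d: dissip
  show "\<forall>x. norm (cayley x) \<le> norm x"
  proof
    fix x
    \<comment> \<open>the element of the kernel with \<open>f - e = x\<close>\<close>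
    define f e where "f = (1/2) *\<^sub>R (x - cayley x)" and "e = (1/2) *\<^sub>R (- cayley x - x)"
    have sum: "f + e = - cayley x" and diff: "f - e = x"
      by (simp_all add: f_def e_def algebra_simps flip: scaleR_add_left)
    then have "W (f, e) = 0" unfolding W_zero_iff by simp
    then have "inner f e \<le> 0" using d by (simp add: dissip_def)
    then have "(norm (cayley x))\<^sup>2 \<le> (norm x)\<^sup>2"
      using inner_polarization[of f e] unfolding sum diff norm_minus_cancel by linarith
    then show "norm (cayley x) \<le> norm x" by (rule power2_le_imp_le) simp
  qed
next
  assume le: "\<forall>x. norm (cayley x) \<le> norm x"
  show dissip
    unfolding dissip_def W_zero_iff
  proof (intro allI impI)
    fix f e assume eq: "f + e = - cayley (f - e)"
    have "(norm (f + e))\<^sup>2 \<le> (norm (f - e))\<^sup>2"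
      unfolding eq using le by (simp add: power_mono)
    then show "inner f e \<le> 0" using inner_polarization[of f e] by linarith
  qed
qed

end

lemma adjW: "inner (W p) y = inner p (cadjoint W y)"
  by (rule inner_cadjoint[OF W])

lemma nonneg_iff: "nonneg \<longleftrightarrow> (\<forall>y. 0 \<le> inner (fst (cadjoint W y)) (snd (cadjoint W y)))"
proof -
  define S where "S = W \<circ> (\<lambda>(u, y). (y, u)) \<circ> cadjoint W"
  have S: "inner (S x) y = inner (snd (cadjoint W x)) (fst (cadjoint W y)) +
      inner (fst (cadjoint W x)) (snd (cadjoint W y))" for x y
    by (simp add: S_def adjW inner_prod_def case_prod_beta)
  have cl: "cadjoint W (\<i> *\<^sub>C x) = \<i> *\<^sub>C cadjoint W x" for x
  proof (rule euclidean_eqI)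
    fix b :: "'v \<times> 'v"
    have adj': "inner (cadjoint W x) y = inner x (W y)" for x y using adjW by (metis inner_commute)
    have "inner (cadjoint W (\<i> *\<^sub>C x)) b = - inner x (W (\<i> *\<^sub>C b))"
      using W by (simp add: adj' inner_scaleC_i bounded_clinear_scaleC)
    also have "\<dots> = inner (\<i> *\<^sub>C cadjoint W x) b" by (simp add: inner_scaleC_i adj')
    finally show "inner (cadjoint W (\<i> *\<^sub>C x)) b = inner (\<i> *\<^sub>C cadjoint W x) b" .
  qed
  have "op_nonneg S \<longleftrightarrow> (\<forall>y. 0 \<le> inner y (S y))"
  proof (rule op_nonneg_iff)
    show "inner (S x) y = inner x (S y)" for x y
      unfolding S[of x y] inner_commute[of x "S y"] S[of y x] by (simp add: inner_commute)
    show "S (\<i> *\<^sub>C x) = \<i> *\<^sub>C S x" for x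
      using bounded_clinear_scaleC[OF W, of \<i> "(snd (cadjoint W x), fst (cadjoint W x))"]
      by (simp add: S_def cl scaleC_prod_def case_prod_beta)
  qed
  moreover have "inner y (S y) = 2 * inner (fst (cadjoint W y)) (snd (cadjoint W y))" for y
    by (simp add: inner_commute[of y] S) (simp add: inner_commute)
  ultimately show ?thesis by (simp add: nonneg_def S_def)
qed

lemma adjoint_diag: "adjoint diag y = fst (cadjoint W y) + snd (cadjoint W y)"
proof -
  have "adjoint diag = (\<lambda>y. fst (cadjoint W y) + snd (cadjoint W y))"
    by (rule adjoint_unique) (simp add: diag_eq adjW inner_prod_def inner_add_right)
  then show ?thesis by simp
qed

text \<open>The components \<open>a\<close>, \<open>b\<close> of \<open>W\<^sup>* y\<close> satisfy \<open>a - b = V\<^sup>* (a + b)\<close>, and \<open>a + b = (W\<^sub>1 + W\<^sub>2)\<^sup>* y\<close> is arbitrary. By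
  polarization \<open>W \<Sigma> W\<^sup>* \<ge> 0\<close> says that \<open>V\<^sup>*\<close> is a contraction.\<close>

lemma nonneg_iff_cayley:
  assumes inj: "inj diag" shows "nonneg \<longleftrightarrow> (\<forall>x. norm (cayley x) \<le> norm x)"
proof -
  note linV = lin_cayley[OF inj]
  have diff: "fst (cadjoint W y) - snd (cadjoint W y) = adjoint cayley (adjoint diag y)" for y
  proof (rule euclidean_eqI)
    fix b :: 'v
    have "inner b (fst (cadjoint W y) - snd (cadjoint W y)) = inner (W (b, - b)) y"
      by (simp add: adjW inner_prod_def inner_diff_right)
    also have "\<dots> = inner b (adjoint cayley (adjoint diag y))"
      by (simp add: diag_cayley[OF inj, symmetric] adjoint_works[OF linV] adjoint_works[OF lin_diag])
    finally show "inner (fst (cadjoint W y) - snd (cadjoint W y)) b = inner (adjoint cayley (adjoint diag y)) b"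
      by (simp add: inner_commute)
  qed
  have "nonneg \<longleftrightarrow> (\<forall>y. norm (adjoint cayley (adjoint diag y)) \<le> norm (adjoint diag y))"
  proof -
    have "0 \<le> inner (fst (cadjoint W y)) (snd (cadjoint W y)) \<longleftrightarrow>
        norm (adjoint cayley (adjoint diag y)) \<le> norm (adjoint diag y)" for y
    proof -
      have "norm (adjoint cayley (adjoint diag y)) \<le> norm (adjoint diag y) \<longleftrightarrow>
          (norm (adjoint cayley (adjoint diag y)))\<^sup>2 \<le> (norm (adjoint diag y))\<^sup>2"
        by simp
      then show ?thesis
        using inner_polarization[of "fst (cadjoint W y)" "snd (cadjoint W y)"]
        unfolding diff adjoint_diag[symmetric] by linarith
    qed
    then show ?thesis by (simp add: nonneg_iff)
  qed
  also have "\<dots> \<longleftrightarrow> (\<forall>w. norm (adjoint cayley w) \<le> norm w)"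
  proof -
    have "surj (adjoint diag)" using inj surj_adjoint_iff_inj[OF lin_diag] by simp
    then show ?thesis by (metis surjD)
  qed
  also have "\<dots> \<longleftrightarrow> (\<forall>x. norm (cayley x) \<le> norm x)"
    using adjoint_contraction[OF linV] adjoint_contraction[OF adjoint_linear[OF linV]]
    by (auto simp: adjoint_adjoint[OF linV])
  finally show ?thesis .
qed

lemma surj_W_if_inj: "inj diag \<Longrightarrow> surj W"
proof -
  assume "inj diag"
  then have "surj diag" using bij_diag bij_is_surj by blast
  then show ?thesis by (metis diag_eq surj_def)
qed

lemma inj_if_dissip: "dissip \<Longrightarrow> inj diag"
  unfolding linear_injective_0[OF lin_diag] dissip_def diag_eq
  by (metis inner_eq_zero_iff inner_ge_zero antisym)

text \<open>A vector \<open>y\<close> in the kernel of \<open>(W\<^sub>1 + W\<^sub>2)\<^sup>*\<close> has \<open>W\<^sup>* y = (a, -a)\<close>, so \<open>\<langle>a, -a\<rangle> \<ge> 0\<close> forces \<open>W\<^sup>* y = 0\<close>, and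
  surjectivity of \<open>W\<close> forces \<open>y = 0\<close>.\<close>

lemma inj_if_surj_nonneg:
  assumes s: "surj W" and nn: nonneg shows "inj diag"
proof -
  have "inj (adjoint diag)"
    unfolding linear_injective_0[OF adjoint_linear[OF lin_diag]]
  proof (intro allI impI)
    fix y assume "adjoint diag y = 0"
    then have ab: "snd (cadjoint W y) = - fst (cadjoint W y)"
      by (simp add: adjoint_diag add_eq_0_iff)
    have "0 \<le> inner (fst (cadjoint W y)) (snd (cadjoint W y))" using nn by (simp add: nonneg_iff)
    then have "inner (fst (cadjoint W y)) (fst (cadjoint W y)) \<le> 0" by (simp add: ab)
    then have "fst (cadjoint W y) = 0" by (metis inner_eq_zero_iff inner_ge_zero antisym)
    with ab have "cadjoint W y = 0" by (simp add: prod_eq_iff)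
    moreover obtain p where "y = W p" using s by (metis surjD)
    ultimately have "inner y y = 0" using adjW[of p y] by simp
    then show "y = 0" by simp
  qed
  then have "surj diag" using inj_adjoint_iff_surj[OF lin_diag] by simp
  then show ?thesis using linear_surjective_imp_injective[OF lin_diag] by simp
qed

lemma inj_if_surj_contr:
  assumes s: "surj W" and c: contr shows "inj diag"
proof -
  obtain V where eq: "\<And>f e. W (f, e) = (1/2) *\<^sub>R diag (f + V f + (e - V e))"
    using c unfolding contr_def by blast
  have "surj diag"
    unfolding surj_def
  proof
    fix y obtain p where p: "y = W p" using s by (metis surjD)
    have "y = diag ((1/2) *\<^sub>R (fst p + V (fst p) + (snd p - V (snd p))))"
      using eq[of "fst p" "snd p"] p by (simp add: linear_cmul[OF lin_diag])
    then show "\<exists>x. y = diag x" ..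
  qed
  then show ?thesis using linear_surjective_imp_injective[OF lin_diag] by simp
qed

text \<open>Each condition implies that \<open>W\<^sub>1 + W\<^sub>2\<close> is invertible and then says that \<open>V\<close> is a contraction.\<close>

theorem boundary_conditions_equivalent:
  "inj diag \<and> nonneg \<longleftrightarrow> dissip" "inj diag \<and> contr \<longleftrightarrow> dissip"
  "surj W \<and> nonneg \<longleftrightarrow> dissip" "surj W \<and> contr \<longleftrightarrow> dissip"
proof -
  show 1: "inj diag \<and> nonneg \<longleftrightarrow> dissip" "inj diag \<and> contr \<longleftrightarrow> dissip"
    using inj_if_dissip nonneg_iff_cayley contr_iff_cayley dissip_iff_cayley by blast+
  show "surj W \<and> nonneg \<longleftrightarrow> dissip" "surj W \<and> contr \<longleftrightarrow> dissip"
    using 1 surj_W_if_inj inj_if_surj_nonneg inj_if_surj_contr by blast+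
qed

end

section \<open>The boundary matrix\<close>

lemma bounded_clinear_Q_op:
  fixes P :: "nat \<Rightarrow> 'h::{complex_inner, euclidean_space} \<Rightarrow> 'h"
  assumes bdd: "\<And>k. k \<le> CARD('n) \<Longrightarrow> bounded_clinear (P k)"
  shows "bounded_clinear (Q_op P :: ('h, 'n::{finite, linorder}) vec \<Rightarrow> _)"
proof (rule bounded_clinearI)
  have lin: "linear (P (pos i + pos j - 1))" and cl: "P (pos i + pos j - 1) (c *\<^sub>C x) = c *\<^sub>C P (pos i + pos j - 1) x"
    if "pos i + pos j \<le> CARD('n) + 1" for i j :: 'n and c x
    using bdd[of "pos i + pos j - 1"] that by (auto simp: bounded_clinear_linear bounded_clinear_scaleC)
  note lin = lin[simplified] and cl = cl[simplified]
  show "linear (Q_op P :: ('h, 'n) vec \<Rightarrow> _)"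
  proof (rule linearI)
    show "Q_op P (u + v) = Q_op P u + Q_op P v" for u v :: "('h, 'n) vec"
      unfolding Q_op_def vec_eq_iff vector_add_component vec_lambda_beta sum.distrib[symmetric]
      by (intro allI sum.cong refl) (auto simp: linear_add[OF lin] scaleR_add_right)
    show "Q_op P (r *\<^sub>R u) = r *\<^sub>R Q_op P u" for r and u :: "('h, 'n) vec"
      unfolding Q_op_def vec_eq_iff vector_scaleR_component vec_lambda_beta scaleR_sum_right
      by (intro allI sum.cong refl) (auto simp: linear_cmul[OF lin])
  qed
  show "Q_op P (c *\<^sub>C u) = c *\<^sub>C Q_op P u" for c and u :: "('h, 'n) vec"
    unfolding Q_op_def vec_eq_iff scaleC_vec_def vec_lambda_beta linear_sum[OF linear_scaleC]
    by (intro allI sum.cong refl) (auto simp: cl scaleC_scaleR)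
qed

lemma symmetric_Q_op:
  fixes P :: "nat \<Rightarrow> 'h::{complex_inner, euclidean_space} \<Rightarrow> 'h" and u v :: "('h, 'n::{finite, linorder}) vec"
  assumes bdd: "\<And>k. k \<le> CARD('n) \<Longrightarrow> bounded_clinear (P k)"
    and adj: "\<And>k. 1 \<le> k \<Longrightarrow> k \<le> CARD('n) \<Longrightarrow> cadjoint (P k) = (\<lambda>x. (-1) ^ (k + 1) *\<^sub>R P k x)"
  shows "inner (Q_op P u) v = inner u (Q_op P v)"
proof -
  define comp where "comp w a = (w :: ('h, 'n) vec) $ (inv pos (Suc a))" for w a
  have comp: "w $ i = comp w (pos i - 1)" for w i
  proof -
    have "inj (pos :: 'n \<Rightarrow> nat)" using pos_bij by (rule bij_betw_imp_inj_on)
    then show ?thesis using pos_ge_1[of i] by (simp add: comp_def)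
  qed
  have flip: "inner (comp v m) (P (Suc k) w) = (-1) ^ k * inner (P (Suc k) (comp v m)) w"
    if "k < CARD('n)" for v m k w
    using inner_cadjoint[OF bdd[of "Suc k"], of "comp v m" w] adj[of "Suc k"] that by simp
  have "inner v (Q_op P u) = (\<Sum>k<CARD('n). \<Sum>m\<le>k. (-1) ^ m * inner (comp v m) (P (Suc k) (comp u (k - m))))"
    by (rule inner_Q_op[OF comp comp])
  also have "\<dots> = (\<Sum>k<CARD('n). \<Sum>m\<le>k. (-1) ^ (k - m) * inner (comp v (k - m)) (P (Suc k) (comp u m)))"
  proof (rule sum.cong[OF refl])
    fix k
    show "(\<Sum>m\<le>k. (-1) ^ m * inner (comp v m) (P (Suc k) (comp u (k - m)))) =
        (\<Sum>m\<le>k. (-1) ^ (k - m) * inner (comp v (k - m)) (P (Suc k) (comp u m)))"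
      by (rule sum.reindex_bij_witness[of _ "(-) k" "(-) k"]) auto
  qed
  also have "\<dots> = (\<Sum>k<CARD('n). \<Sum>m\<le>k. (-1) ^ m * inner (comp u m) (P (Suc k) (comp v (k - m))))"
  proof (intro sum.cong refl)
    fix k m assume k: "k \<in> {..<CARD('n)}" and m: "m \<in> {..k}"
    then have "(-1 :: real) ^ m = (-1) ^ (k - m) * (-1) ^ k" by (simp add: minus_one_power_iff)
    moreover have "inner (comp v (k - m)) (P (Suc k) (comp u m)) =
        (-1) ^ k * inner (comp u m) (P (Suc k) (comp v (k - m)))"
      using k flip[of k v "k - m" "comp u m"] by (simp only: inner_commute[of "comp u m"] lessThan_iff)
    ultimately show "(-1) ^ (k - m) * inner (comp v (k - m)) (P (Suc k) (comp u m)) =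
        (-1) ^ m * inner (comp u m) (P (Suc k) (comp v (k - m)))"
      by (simp only: mult.assoc)
  qed
  also have "\<dots> = inner u (Q_op P v)" by (rule inner_Q_op[OF comp comp, symmetric])
  finally show ?thesis by (simp add: inner_commute)
qed

text \<open>The matrix is triangular with respect to the antidiagonal, whose entries are \<open>\<plusminus> P\<^sub>N\<close>.\<close>

lemma bij_Q_op:
  fixes P :: "nat \<Rightarrow> 'h::{complex_inner, euclidean_space} \<Rightarrow> 'h"
  assumes bdd: "\<And>k. k \<le> CARD('n) \<Longrightarrow> bounded_clinear (P k)" and bij: "bij (P CARD('n))"
  shows "bij (Q_op P :: ('h, 'n::{finite, linorder}) vec \<Rightarrow> _)"
proof -
  let ?N = "CARD('n)"
  have lin: "linear (Q_op P :: ('h, 'n) vec \<Rightarrow> _)"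
    using bounded_clinear_Q_op[OF bdd] by (rule bounded_clinear_linear)
  have P0: "P k 0 = 0" if "k \<le> ?N" for k
    using bdd[OF that] by (intro linear_0 bounded_clinear_linear)
  have "u = 0" if Qu: "Q_op P u = 0" for u :: "('h, 'n) vec"
  proof -
    have "\<forall>i. pos i = Suc b \<longrightarrow> u $ i = 0" if "b < ?N" for b
      using that
    proof (induction b rule: less_induct)
      case (less b)
      show ?case
      proof (intro allI impI)
        fix i :: 'n assume i: "pos i = Suc b"
        \<comment> \<open>the row in which the unknown \<open>u\<close> at position \<open>b + 1\<close> meets the antidiagonal\<close>
        obtain r :: 'n where r: "pos r = ?N - b"
          using pos_surj[of "?N - Suc b", where 'n = 'n] Suc_diff_Suc[OF less.prems] less.prems by auto
        have "(0::'h) = Q_op P u $ r" using Qu by simp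
        also have "\<dots> = (\<Sum>j\<in>UNIV. if j = i then (-1) ^ (pos r - 1) *\<^sub>R P ?N (u $ i) else 0)"
          unfolding Q_op_def vec_lambda_beta
        proof (intro sum.cong refl)
          fix j :: 'n
          have "pos j \<noteq> pos i" if "j \<noteq> i"
            using that bij_betw_imp_inj_on[OF pos_bij[where 'n = 'n]] by (simp add: inj_eq)
          moreover have "u $ j = 0" if "pos j < Suc b"
            using less.IH[of "pos j - 1"] that pos_ge_1[of j] less.prems by simp
          ultimately show "(if pos r + pos j \<le> ?N + 1 then (- 1) ^ (pos r - 1) *\<^sub>R P (pos r + pos j - 1) (u $ j) else 0) =
              (if j = i then (-1) ^ (pos r - 1) *\<^sub>R P ?N (u $ i) else 0)"
            using r i less.prems by (cases "pos j" "Suc b" rule: linorder_cases) (auto simp: P0)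
        qed
        finally have "P ?N (u $ i) = P ?N 0" by (simp add: P0)
        then show "u $ i = 0" using bij by (meson bij_is_inj injD)
      qed
    qed
    then have "u $ i = 0" for i
      using pos_ge_1[of i] by (metis Suc_le_D Suc_le_lessD One_nat_def)
    then show "u = 0" by (simp add: vec_eq_iff)
  qed
  then have "inj (Q_op P :: ('h, 'n) vec \<Rightarrow> _)" by (simp add: linear_injective_0[OF lin])
  then show ?thesis using linear_injective_imp_surjective[OF lin] by (simp add: bij_def)
qed

section \<open>Initial value problems\<close>

definition constl2 :: "'a::euclidean_space \<Rightarrow> 'a l2" where "constl2 c = abs_l2 (\<lambda>_. c)"

definition vop :: "'a::euclidean_space l2 \<Rightarrow> 'a l2" where "vop g = abs_l2 (prim (rep_l2 g))"

lemma rep_constl2: "AE t in I01. rep_l2 (constl2 c) t = c"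
  unfolding constl2_def by (rule rep_abs_l2[OF square_integrable_const])

lemma rep_vop: "AE t in I01. rep_l2 (vop g) t = prim (rep_l2 g) t"
  unfolding vop_def
  by (intro rep_abs_l2 square_integrable_continuous continuous_prim integrable_rep_l2)

lemma rep_constl2_vop: "AE t in I01. rep_l2 (constl2 c + vop g) t = c + prim (rep_l2 g) t"
  using rep_plus_l2[of "constl2 c" "vop g"] rep_constl2[of c] rep_vop[of g] by eventually_elim simp

lemma weak_deriv_constl2_vop: "weak_deriv (constl2 c + vop g) g"
  unfolding weak_deriv_iff_prim using rep_constl2_vop by blast

lemma cont_rep_constl2_vop: "cont_rep (constl2 c + vop g) 0 = c"
proof -
  have "cont_rep (constl2 c + vop g) 0 = c + prim (rep_l2 g) 0"
    by (rule cont_rep_eqI[OF _ rep_constl2_vop])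
       (auto intro!: continuous_intros continuous_prim)
  then show ?thesis by (simp add: prim_0)
qed

lemma weak_deriv_eq_constl2_vop:
  assumes "weak_deriv x g" shows "x = constl2 (cont_rep x 0) + vop g"
proof (rule l2_eqI)
  show "AE t in I01. rep_l2 x t = rep_l2 (constl2 (cont_rep x 0) + vop g) t"
    using weak_deriv_cont_rep(1)[OF assms] rep_constl2_vop[of "cont_rep x 0" g] AE_I01_in
  proof eventually_elim
    case (elim t)
    show ?case unfolding elim(1) elim(2) by (rule weak_deriv_cont_rep(2)[OF assms elim(3)])
  qed
qed

lemma linear_vop: "linear (vop :: 'a::{complex_inner, euclidean_space} l2 \<Rightarrow> 'a l2)"
proof (rule linearI)
  show "vop (f + g) = vop f + vop g" for f g :: "'a l2"
    using rep_vop[of "f + g"] rep_vop[of f] rep_vop[of g] rep_plus_l2[of "vop f" "vop g"]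
    by (intro l2_eqI, eventually_elim) (simp add: prim_rep_add)
  show "vop (r *\<^sub>R f) = r *\<^sub>R vop f" for r and f :: "'a l2"
    using rep_vop[of "r *\<^sub>R f"] rep_vop[of f] rep_scaleR_l2[of r "vop f"]
    by (intro l2_eqI, eventually_elim) (simp add: prim_rep_scaleC[of "of_real r" f, unfolded scaleC_of_real])
qed

lemma constl2_0: "constl2 0 = (0 :: 'a::euclidean_space l2)"
proof (rule l2_eqI)
  show "AE t in I01. rep_l2 (constl2 0) t = rep_l2 (0 :: 'a l2) t"
    using rep_constl2[of "0::'a"] rep_zero_l2[where 'a = 'a] by eventually_elim simp
qed

text \<open>The derivatives, from the highest downwards, of the function with highest derivative \<open>v\<close> and initial
  values \<open>c\<close>: entry \<open>m\<close> is the derivative of order \<open>n - m\<close>.\<close>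

primrec tower :: "(nat \<Rightarrow> 'a::euclidean_space) \<Rightarrow> nat \<Rightarrow> 'a l2 \<Rightarrow> nat \<Rightarrow> 'a l2" where
  "tower c n v 0 = v"
| "tower c n v (Suc m) = constl2 (c (n - Suc m)) + vop (tower c n v m)"

lemma tower_step:
  assumes "k < n"
  shows "tower c n v (n - k) = constl2 (c k) + vop (tower c n v (n - Suc k))"
proof -
  have "n - k = Suc (n - Suc k)" using assms by (simp add: Suc_diff_Suc)
  then show ?thesis using assms by simp
qed

lemma tower_sobolev:
  shows "tower c n v n \<in> sobolev n"
    and "k \<le> n \<Longrightarrow> (wderiv ^^ k) (tower c n v n) = tower c n v (n - k)"
    and "k < n \<Longrightarrow> cont_rep ((wderiv ^^ k) (tower c n v n)) 0 = c k"
proof -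
  have step: "weak_deriv (tower c n v (n - k)) (tower c n v (n - Suc k))" if "k < n" for k
    unfolding tower_step[OF that] by (rule weak_deriv_constl2_vop)
  show "tower c n v n \<in> sobolev n" using sobolevI(1)[of n "\<lambda>k. tower c n v (n - k)"] step by simp
  show eq: "k \<le> n \<Longrightarrow> (wderiv ^^ k) (tower c n v n) = tower c n v (n - k)" for k
    using sobolevI(2)[of n "\<lambda>k. tower c n v (n - k)"] step by simp
  show "k < n \<Longrightarrow> cont_rep ((wderiv ^^ k) (tower c n v n)) 0 = c k"
    by (simp add: eq tower_step cont_rep_constl2_vop)
qed

lemma sobolev_eq_tower:
  assumes x: "x \<in> sobolev n" and c: "\<And>k. k < n \<Longrightarrow> cont_rep ((wderiv ^^ k) x) 0 = c k"
  shows "x = tower c n ((wderiv ^^ n) x) n"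
proof -
  have "m \<le> n \<Longrightarrow> (wderiv ^^ (n - m)) x = tower c n ((wderiv ^^ n) x) m" for m
  proof (induction m)
    case (Suc m)
    define k where "k = n - Suc m"
    have k: "k < n" "Suc k = n - m" using Suc.prems by (auto simp: k_def)
    have "(wderiv ^^ k) x = constl2 (c k) + vop ((wderiv ^^ Suc k) x)"
      using weak_deriv_eq_constl2_vop[OF sobolev_weak_deriv[OF x k(1)]] c[OF k(1)] by metis
    also have "(wderiv ^^ Suc k) x = tower c n ((wderiv ^^ n) x) m"
      using Suc.IH Suc.prems by (simp only: k(2))
    finally show ?case by (simp only: tower.simps k_def[symmetric])
  qed simp
  from this[of n] show ?thesis by simp
qed

lemma tower_split:
  fixes c :: "nat \<Rightarrow> 'a::{complex_inner, euclidean_space}"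
  shows "tower c n v m = tower c n 0 m + (vop ^^ m) v"
  by (induction m) (auto simp: linear_add[OF linear_vop])

lemma linear_vop_pow: "linear ((vop :: 'a::{complex_inner, euclidean_space} l2 \<Rightarrow> 'a l2) ^^ m)"
proof (induction m)
  case 0
  show ?case unfolding funpow.simps(1) by (rule linear_id)
next
  case (Suc m)
  show ?case unfolding funpow.simps(2) by (rule linear_compose[OF Suc.IH linear_vop])
qed

text \<open>Operators dominated pointwise by the antiderivative of the modulus: these include the positive
  powers of the antiderivative operator, and their iterates decay factorially.\<close>

definition volterra :: "('a::euclidean_space l2 \<Rightarrow> 'a l2) \<Rightarrow> bool" where
  "volterra T \<longleftrightarrow> (\<exists>C\<ge>0. \<forall>v. AE t in I01. norm (rep_l2 (T v) t) \<le> C * prim (\<lambda>s. norm (rep_l2 v s)) t)"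

lemma integrable_norm_rep [simp]: "integrable I01 (\<lambda>s. norm (rep_l2 v s))"
  by simp

lemma prim_norm_nonneg: "0 \<le> prim (\<lambda>s. norm (f s)) t"
  unfolding prim_def by (rule Bochner_Integration.integral_nonneg) simp

lemma prim_norm_le: "prim (\<lambda>s. norm (rep_l2 v s)) t \<le> (LINT s|I01. norm (rep_l2 v s))"
  unfolding prim_def
  by (rule integral_mono) (use integrable_indicator_I01[of "\<lambda>s. norm (rep_l2 v s)"] in \<open>auto simp: indicator_def\<close>)

lemma volterra_vop_pow: "volterra (vop ^^ Suc m)"
proof -
  have "AE t in I01. norm (rep_l2 ((vop ^^ Suc m) v) t) \<le> prim (\<lambda>s. norm (rep_l2 v s)) t" for v :: "'a l2"
  proof (induction m)
    case 0
    show ?case using rep_vop[of v] by eventually_elim (simp add: norm_prim_le)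
  next
    case (Suc m)
    let ?u = "(vop ^^ Suc m) v" and ?p = "prim (\<lambda>s. norm (rep_l2 v s))"
    have int_p: "integrable I01 ?p"
      by (rule integrable_square_integrable[OF square_integrable_continuous[OF continuous_prim[OF integrable_norm_rep]]])
    have p: "prim (\<lambda>s. norm (rep_l2 ?u s)) t \<le> prim ?p t" for t
      by (rule prim_mono) (use Suc.IH int_p in auto)
    have "prim ?p t \<le> ?p t" for t
    proof -
      have "prim ?p t \<le> (LINT s|I01. ?p t)"
        unfolding prim_def[of ?p]
      proof (rule integral_mono)
        show "integrable I01 (\<lambda>s. indicator {..t} s *\<^sub>R ?p s)" by (rule integrable_indicator_I01[OF int_p])
        show "indicator {..t} s *\<^sub>R ?p s \<le> ?p t" for s
          using prim_norm_nonneg[of "rep_l2 v" t]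
          by (cases "s \<le> t") (auto intro!: prim_mono)
      qed simp
      then show ?thesis by simp
    qed
    then have *: "prim (\<lambda>s. norm (rep_l2 ?u s)) t \<le> ?p t" for t using p[of t] by (rule order_trans[rotated])
    have "AE t in I01. rep_l2 (vop ?u) t = prim (rep_l2 ?u) t" by (rule rep_vop)
    then have "AE t in I01. norm (rep_l2 (vop ?u) t) \<le> ?p t"
    proof eventually_elim
      case (elim t)
      show ?case unfolding elim using norm_prim_le[OF integrable_rep_l2, of ?u t] * by (rule order_trans)
    qed
    then show ?case by simp
  qed
  then show ?thesis unfolding volterra_def by (intro exI[of _ 1]) simp
qed

lemma volterra_zero: "volterra (\<lambda>_. 0)"
  unfolding volterra_def using rep_zero_l2 prim_norm_nonneg by (intro exI[of _ 0]) auto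

lemma volterra_add:
  assumes "volterra S" "volterra T" shows "volterra (\<lambda>v. S v + T v)"
proof -
  obtain C D where CD: "C \<ge> 0" "D \<ge> 0"
    "\<And>v. AE t in I01. norm (rep_l2 (S v) t) \<le> C * prim (\<lambda>s. norm (rep_l2 v s)) t"
    "\<And>v. AE t in I01. norm (rep_l2 (T v) t) \<le> D * prim (\<lambda>s. norm (rep_l2 v s)) t"
    using assms unfolding volterra_def by blast
  have "AE t in I01. norm (rep_l2 (S v + T v) t) \<le> (C + D) * prim (\<lambda>s. norm (rep_l2 v s)) t" for v
    using CD(3)[of v] CD(4)[of v] rep_plus_l2[of "S v" "T v"]
  proof eventually_elim
    case (elim t)
    show ?case unfolding elim(3) using norm_triangle_ineq[of "rep_l2 (S v) t" "rep_l2 (T v) t"] elim(1,2)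
      by (simp add: distrib_right)
  qed
  then show ?thesis unfolding volterra_def using CD(1,2) by (intro exI[of _ "C + D"]) auto
qed

lemma volterra_mult_op:
  assumes M: "Linf_op M" and T: "volterra T" shows "volterra (\<lambda>v. mult_op M (T v))"
proof -
  obtain C where C: "C \<ge> 0"
    "\<And>v. AE t in I01. norm (rep_l2 (T v) t) \<le> C * prim (\<lambda>s. norm (rep_l2 v s)) t"
    using T unfolding volterra_def by blast
  obtain B where B: "B \<ge> 0" "AE t in I01. \<forall>v. norm (M t v) \<le> B * norm v" using Linf_op_bound[OF M] .
  have "AE t in I01. norm (rep_l2 (mult_op M (T v)) t) \<le> (B * C) * prim (\<lambda>s. norm (rep_l2 v s)) t" for v
    using C(2)[of v] B(2) rep_mult_op[OF M, of "T v"]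
  proof eventually_elim
    case (elim t)
    have "norm (M t (rep_l2 (T v) t)) \<le> B * norm (rep_l2 (T v) t)" using elim(2) by blast
    also have "\<dots> \<le> B * (C * prim (\<lambda>s. norm (rep_l2 v s)) t)" using elim(1) B(1) by (rule mult_left_mono)
    finally show ?case by (simp add: elim(3) mult.assoc)
  qed
  then show ?thesis unfolding volterra_def using B(1) C(1) by (intro exI[of _ "B * C"]) auto
qed

lemma volterra_sum: "finite A \<Longrightarrow> (\<And>a. a \<in> A \<Longrightarrow> volterra (T a)) \<Longrightarrow> volterra (\<lambda>v. \<Sum>a\<in>A. T a v)"
  by (induction A rule: finite_induct) (auto intro: volterra_zero volterra_add)

text \<open>Induction gives \<open>|T\<^sup>n\<^sup>+\<^sup>1 v| (t) \<le> C\<^sup>n\<^sup>+\<^sup>1 \<parallel>v\<parallel>\<^sub>1 t\<^sup>n / n!\<close> almost everywhere.\<close>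

lemma volterra_iterates_summable:
  assumes T: "volterra T" shows "summable (\<lambda>n. norm ((T ^^ n) v))"
proof -
  obtain C where C: "C \<ge> 0"
    "\<And>v. AE t in I01. norm (rep_l2 (T v) t) \<le> C * prim (\<lambda>s. norm (rep_l2 v s)) t"
    using T unfolding volterra_def by blast
  define L where "L = (LINT s|I01. norm (rep_l2 v s))"
  have L: "L \<ge> 0" unfolding L_def by simp
  have prim_pow: "prim (\<lambda>s. a * (s ^ n / fact n)) t = a * (t ^ Suc n / fact (Suc n))" if "t \<in> {0..1}" for a t :: real and n
  proof -
    have "((\<lambda>s. a * (s ^ Suc n / fact (Suc n))) has_vector_derivative a * (s ^ n / fact n)) (at s within {0..1})" for s :: real
    proof -
      have "((\<lambda>s. a * (s ^ Suc n / fact (Suc n))) has_real_derivative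
          a * (real (Suc n) * s ^ n / fact (Suc n))) (at s within {0..1})"
        using DERIV_cmult[OF DERIV_cdivide[OF DERIV_pow[of "Suc n" s "{0..1}"], of "fact (Suc n)"], of a]
        by (simp only: diff_Suc_Suc minus_nat.diff_0)
      moreover have "real (Suc n) * s ^ n / fact (Suc n) = s ^ n / fact n" by simp
      ultimately show ?thesis by (simp only: has_real_derivative_iff_has_vector_derivative)
    qed
    from prim_derivative[OF this _ that] show ?thesis by (simp add: continuous_intros)
  qed
  have bound: "AE t in I01. norm (rep_l2 ((T ^^ Suc n) v) t) \<le> (C ^ Suc n * L) * (t ^ n / fact n)" for n
  proof (induction n)
    case 0
    show ?case using C(2)[of v]
    proof eventually_elim
      case (elim t)
      have "C * prim (\<lambda>s. norm (rep_l2 v s)) t \<le> C * L"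
        using prim_norm_le[of v t] C(1) unfolding L_def by (rule mult_left_mono)
      with elim show ?case by simp
    qed
  next
    case (Suc n)
    let ?u = "(T ^^ Suc n) v" and ?g = "\<lambda>s. (C ^ Suc n * L) * (s ^ n / fact n)"
    have "integrable I01 ?g"
      by (intro integrable_square_integrable square_integrable_continuous continuous_intros) simp
    then have "prim (\<lambda>s. norm (rep_l2 ?u s)) t \<le> prim ?g t" for t
      using Suc.IH by (intro prim_mono) auto
    note le = this
    show ?case using C(2)[of ?u] AE_I01_in
    proof eventually_elim
      case (elim t)
      have "norm (rep_l2 (T ?u) t) \<le> C * prim ?g t"
        using elim(1) mult_left_mono[OF le[of t] C(1)] by (rule order_trans)
      also have "\<dots> = (C ^ Suc (Suc n) * L) * (t ^ Suc n / fact (Suc n))"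
        unfolding prim_pow[OF elim(2)] by simp
      finally show ?case by simp
    qed
  qed
  have "norm ((T ^^ Suc n) v) \<le> (C * L) * (inverse (fact n) * C ^ n)" for n
  proof (rule norm_l2_le_const)
    show "AE t in I01. norm (rep_l2 ((T ^^ Suc n) v) t) \<le> (C * L) * (inverse (fact n) * C ^ n)"
      using bound[of n] AE_I01_in
    proof eventually_elim
      case (elim t)
      have "t ^ n / fact n \<le> 1 / fact n"
        using elim(2) by (intro divide_right_mono power_le_one) auto
      then have "(C ^ Suc n * L) * (t ^ n / fact n) \<le> (C ^ Suc n * L) * (1 / fact n)"
        using C(1) L by (intro mult_left_mono) auto
      with elim(1) show ?case by (simp add: divide_inverse mult_ac)
    qed
  qed (use C(1) L in simp)
  then have "summable (\<lambda>n. norm ((T ^^ Suc n) v))"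
    by (intro summable_comparison_test'[OF summable_mult[OF summable_exp[of C]], of 0 _ "C * L"]) auto
  then show ?thesis by (subst (asm) summable_Suc_iff)
qed

lemma volterra_bounded_linear:
  assumes lin: "linear T" and T: "volterra T" shows "bounded_linear T"
proof -
  obtain C where C: "C \<ge> 0"
    "\<And>v. AE t in I01. norm (rep_l2 (T v) t) \<le> C * prim (\<lambda>s. norm (rep_l2 v s)) t"
    using T unfolding volterra_def by blast
  have "norm (T v) \<le> C * norm v" for v
  proof -
    have "ennreal (LINT s|I01. norm (rep_l2 v s)) \<le> ennreal (norm v + e)" if "e > 0" for e
    proof -
      have "ennreal (LINT s|I01. norm (rep_l2 v s)) = (\<integral>\<^sup>+ s. ennreal (norm (rep_l2 v s)) \<partial>I01)"
        by (rule nn_integral_eq_integral[symmetric]) auto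
      also have "\<dots> \<le> ennreal (norm v + e)"
        using that by (intro nn_integral_norm_l2_le) (auto simp: add_nonneg_pos)
      finally show ?thesis .
    qed
    note le = this
    have "(LINT s|I01. norm (rep_l2 v s)) \<le> norm v + e" if e: "e > 0" for e
    proof -
      have "0 \<le> norm v + e" using e by (simp add: add_nonneg_nonneg)
      then show ?thesis using le[OF e] ennreal_le_iff by blast
    qed
    then have L: "(LINT s|I01. norm (rep_l2 v s)) \<le> norm v" by (rule field_le_epsilon)
    show ?thesis
    proof (rule norm_l2_le_const)
      show "AE t in I01. norm (rep_l2 (T v) t) \<le> C * norm v"
        using C(2)[of v]
      proof eventually_elim
        case (elim t)
        have "C * prim (\<lambda>s. norm (rep_l2 v s)) t \<le> C * norm v"
          using order_trans[OF prim_norm_le L, of t] C(1) by (rule mult_left_mono)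
        with elim show ?case by simp
      qed
    qed (use C(1) in simp)
  qed
  then show ?thesis
    using lin by (intro bounded_linear_intro[of _ C]) (auto simp: linear_add linear_cmul mult.commute)
qed

text \<open>The Neumann series inverts \<open>I - T\<close>; a fixed point of \<open>T\<close> is its own iterate and these tend to zero.\<close>

lemma bij_id_minus_if_iterates_summable:
  fixes T :: "'b::banach \<Rightarrow> 'b"
  assumes bl: "bounded_linear T" and sum: "\<And>v. summable (\<lambda>n. norm ((T ^^ n) v))"
  shows "bij (\<lambda>v. v - T v)"
proof (rule bijI)
  have lin: "linear T" by (rule bounded_linear.linear[OF bl])
  have "v = 0" if "v - T v = 0" for v
  proof -
    have "T v = v" using that by simp
    then have "(T ^^ n) v = v" for n by (induction n) auto
    then have "(\<lambda>n. norm v) \<longlonglongrightarrow> 0" using summable_LIMSEQ_zero[OF sum[of v]] by simp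
    then show ?thesis by (simp add: LIMSEQ_const_iff)
  qed
  moreover have "linear (\<lambda>v. v - T v)" by (intro linear_compose_sub lin linear_ident)
  ultimately show "inj (\<lambda>v. v - T v)" by (simp add: linear_injective_0)
  show "surj (\<lambda>v. v - T v)"
    unfolding surj_def
  proof
    fix w
    have s: "summable (\<lambda>n. (T ^^ n) w)" by (rule summable_norm_cancel[OF sum])
    define v where "v = (\<Sum>n. (T ^^ n) w)"
    have "T v = (\<Sum>n. (T ^^ Suc n) w)"
      unfolding v_def using bounded_linear.suminf[OF bl s] by simp
    also have "\<dots> = v - w" using suminf_split_head[OF s] by (simp add: v_def)
    finally show "\<exists>v. w = v - T v" by (intro exI[of _ v]) simp
  qed
qed

text \<open>The equation \<open>M z - (P\<^sub>0 z + \<dots> + P\<^sub>N z\<^sup>(\<^sup>N\<^sup>)) = y\<close> with a bounded measurable coefficient \<open>M\<close>.\<close>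

locale ode =
  fixes P :: "nat \<Rightarrow> 'h::{complex_inner, euclidean_space} \<Rightarrow> 'h" and N :: nat and M :: "real \<Rightarrow> 'h \<Rightarrow> 'h"
  assumes N: "0 < N" and P: "\<And>k. k \<le> N \<Longrightarrow> bounded_clinear (P k)" and P_bij: "bij (P N)" and M: "Linf_op M"
begin

abbreviation Pm :: "nat \<Rightarrow> 'h l2 \<Rightarrow> 'h l2" where "Pm k \<equiv> mult_op (\<lambda>_. P k)"

text \<open>The homogeneous equation solved for the highest derivative, as a function of the derivatives of lower
  order.\<close>

definition top_deriv :: "(nat \<Rightarrow> 'h l2) \<Rightarrow> 'h l2" where
  "top_deriv f = mult_op (\<lambda>_. inv (P N)) (mult_op M (f 0) + (-1) *\<^sub>R (\<Sum>k<N. Pm k (f k)))"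

lemma lin_Pm: "k \<le> N \<Longrightarrow> linear (Pm k)"
  by (intro linear_mult_op Linf_op_const P)

lemma inv_P: "Linf_op (\<lambda>_. inv (P N))"
proof (rule Linf_op_const, rule bounded_clinearI)
  have lin: "linear (P N)" and cl: "\<And>c x. P N (c *\<^sub>C x) = c *\<^sub>C P N x"
    using P[of N] by (auto simp: bounded_clinear_linear bounded_clinear_scaleC)
  have inv: "inv (P N) y = x \<longleftrightarrow> y = P N x" for x y
    using P_bij by (metis bij_inv_eq_iff)
  have PI: "P N (inv (P N) y) = y" for y using inv[of y "inv (P N) y"] by simp
  show "linear (inv (P N))"
    by (rule linearI) (simp_all add: inv linear_add[OF lin] linear_cmul[OF lin] PI)
  show "inv (P N) (c *\<^sub>C x) = c *\<^sub>C inv (P N) x" for c x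
    by (simp add: inv cl PI)
qed

lemma inv_Pm: "mult_op (\<lambda>_. inv (P N)) (Pm N x) = x" "Pm N (mult_op (\<lambda>_. inv (P N)) x) = x"
proof -
  have *: "inv (P N) (P N a) = a" "P N (inv (P N) a) = a" for a
    using P_bij by (simp_all add: bij_is_inj bij_is_surj surj_f_inv_f)
  have PN: "Linf_op (\<lambda>_. P N)" by (intro Linf_op_const P) simp
  show "mult_op (\<lambda>_. inv (P N)) (Pm N x) = x"
    using rep_mult_op[OF inv_P, of "Pm N x"] rep_mult_op[OF PN, of x]
    by (intro l2_eqI, eventually_elim) (simp add: *)
  show "Pm N (mult_op (\<lambda>_. inv (P N)) x) = x"
    using rep_mult_op[OF PN, of "mult_op (\<lambda>_. inv (P N)) x"] rep_mult_op[OF inv_P, of x]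
    by (intro l2_eqI, eventually_elim) (simp add: *)
qed

lemma top_deriv_cong: "(\<And>k. k < N \<Longrightarrow> f k = g k) \<Longrightarrow> top_deriv f = top_deriv g"
  unfolding top_deriv_def using N by simp

lemma top_deriv_add: "top_deriv (\<lambda>k. f k + g k) = top_deriv f + top_deriv g"
  unfolding top_deriv_def
  by (simp add: linear_add[OF linear_mult_op[OF inv_P]] linear_add[OF linear_mult_op[OF M]]
      linear_diff[OF linear_mult_op[OF inv_P]] linear_neg[OF linear_mult_op[OF inv_P]]
      linear_add[OF lin_Pm] sum.distrib)

text \<open>The dependence of the right-hand side on the highest derivative \<open>v\<close> when all initial values are zero, in which
  case the derivative of order \<open>k\<close> is the \<open>(N - k)\<close>-fold primitive of \<open>v\<close>.\<close>

definition K :: "'h l2 \<Rightarrow> 'h l2" where "K v = top_deriv (\<lambda>k. (vop ^^ (N - k)) v)"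

lemma lin_K: "linear K"
proof (rule linearI)
  show "K (v + w) = K v + K w" for v w
    unfolding K_def by (simp add: linear_add[OF linear_vop_pow] top_deriv_add)
  show "K (r *\<^sub>R v) = r *\<^sub>R K v" for r v
    unfolding K_def top_deriv_def
    by (simp add: linear_cmul[OF linear_vop_pow] linear_cmul[OF linear_mult_op[OF inv_P]] linear_cmul[OF linear_mult_op[OF M]]
        linear_diff[OF linear_mult_op[OF inv_P]] linear_cmul[OF lin_Pm] scaleR_diff_right flip: scaleR_sum_right)
qed

lemma volterra_K: "volterra K"
proof -
  have pow: "volterra (vop ^^ (N - k))" if "k < N" for k
    using volterra_vop_pow[of "N - Suc k"] that by (simp add: Suc_diff_Suc del: funpow.simps)
  have uminus: "Linf_op (\<lambda>_ v::'h. - v)"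
    by (intro Linf_op_const bounded_clinearI) (auto intro: linear_uminus simp: scaleC_minus)
  have minus: "(-1) *\<^sub>R x = mult_op (\<lambda>_ v. - v) x" for x :: "'h l2"
  proof (rule l2_eqI)
    show "AE t in I01. rep_l2 ((-1) *\<^sub>R x) t = rep_l2 (mult_op (\<lambda>_ v. - v) x) t"
      using rep_mult_op[OF uminus, of x] rep_scaleR_l2[of "-1" x] by eventually_elim simp
  qed
  show ?thesis
    unfolding K_def top_deriv_def minus
    using N P by (intro volterra_mult_op volterra_add volterra_sum inv_P M pow Linf_op_const uminus) auto
qed

lemma bij_K: "bij (\<lambda>v. v - K v)"
  by (rule bij_id_minus_if_iterates_summable[OF volterra_bounded_linear[OF lin_K volterra_K]
        volterra_iterates_summable[OF volterra_K]])

lemma equation_iff: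
  "mult_op M z - diff_op N P z = y \<longleftrightarrow>
    (wderiv ^^ N) z = top_deriv (\<lambda>k. (wderiv ^^ k) z) + (-1) *\<^sub>R mult_op (\<lambda>_. inv (P N)) y"
proof -
  let ?I = "mult_op (\<lambda>_. inv (P N))" and ?v = "(wderiv ^^ N) z"
  let ?R = "mult_op M z + (-1) *\<^sub>R (\<Sum>k<N. Pm k ((wderiv ^^ k) z))"
  have "diff_op N P z = (\<Sum>k<N. Pm k ((wderiv ^^ k) z)) + Pm N ?v"
    unfolding diff_op_def by (simp add: lessThan_Suc_atMost[symmetric])
  then have "mult_op M z - diff_op N P z = y \<longleftrightarrow> Pm N ?v = ?R - y"
    by (auto simp: algebra_simps)
  also have "\<dots> \<longleftrightarrow> ?v = ?I (?R - y)"
  proof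
    assume "Pm N ?v = ?R - y"
    then have "?I (Pm N ?v) = ?I (?R - y)" by (rule arg_cong)
    then show "?v = ?I (?R - y)" by (simp only: inv_Pm)
  next
    assume "?v = ?I (?R - y)"
    then have "Pm N ?v = Pm N (?I (?R - y))" by (rule arg_cong)
    then show "Pm N ?v = ?R - y" by (simp only: inv_Pm)
  qed
  also have "?I (?R - y) = top_deriv (\<lambda>k. (wderiv ^^ k) z) + (-1) *\<^sub>R ?I y"
    unfolding top_deriv_def by (simp add: linear_diff[OF linear_mult_op[OF inv_P]])
  finally show ?thesis .
qed

text \<open>With the derivatives written as a tower, the equation becomes \<open>v - K v = w\<close> for the highest derivative,
  where \<open>w\<close> depends on the initial values and on \<open>y\<close>.\<close>

lemma initial_value_existence:
  "\<exists>z\<in>sobolev N. mult_op M z - diff_op N P z = y \<and> (\<forall>k<N. cont_rep ((wderiv ^^ k) z) 0 = c k)"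
proof -
  define w where "w = top_deriv (\<lambda>k. tower c N 0 (N - k)) + (-1) *\<^sub>R mult_op (\<lambda>_. inv (P N)) y"
  obtain v where v: "v - K v = w" using bij_K by (metis bij_is_surj surjD)
  define z where "z = tower c N v N"
  have "top_deriv (\<lambda>k. (wderiv ^^ k) z) = top_deriv (\<lambda>k. tower c N 0 (N - k) + (vop ^^ (N - k)) v)"
    unfolding top_deriv_def z_def using tower_sobolev(2)[of _ N c v] N
    by (simp add: tower_split[of c N v])
  also have "\<dots> = top_deriv (\<lambda>k. tower c N 0 (N - k)) + K v"
    by (simp only: top_deriv_add K_def)
  finally have "v = top_deriv (\<lambda>k. (wderiv ^^ k) z) + (-1) *\<^sub>R mult_op (\<lambda>_. inv (P N)) y"
    using v by (simp add: w_def algebra_simps)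
  moreover have "(wderiv ^^ N) z = v" unfolding z_def using tower_sobolev(2)[of N N c v] by simp
  ultimately have "mult_op M z - diff_op N P z = y" by (simp only: equation_iff)
  then show ?thesis
    using tower_sobolev(1)[of c N v] tower_sobolev(3)[of _ N c v] unfolding z_def by blast
qed

lemma initial_value_uniqueness:
  assumes z: "z \<in> sobolev N" and eq: "mult_op M z - diff_op N P z = 0"
    and zero: "\<And>k. k < N \<Longrightarrow> cont_rep ((wderiv ^^ k) z) 0 = 0"
  shows "z = 0"
proof -
  define v where "v = (wderiv ^^ N) z"
  have tower0: "tower (\<lambda>_. 0) N w m = (vop ^^ m) w" for w :: "'h l2" and m
    by (induction m) (auto simp: constl2_0)
  have z_eq: "z = (vop ^^ N) v"
    using sobolev_eq_tower[OF z, of "\<lambda>_. 0"] zero by (simp add: v_def tower0)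
  have d: "(wderiv ^^ k) z = (vop ^^ (N - k)) v" if "k \<le> N" for k
    unfolding z_eq using tower_sobolev(2)[of k N "\<lambda>_. 0" v] that by (simp add: tower0)
  have "top_deriv (\<lambda>k. (wderiv ^^ k) z) = K v"
    unfolding K_def by (rule top_deriv_cong) (rule d, simp)
  moreover have "v = top_deriv (\<lambda>k. (wderiv ^^ k) z) + (-1) *\<^sub>R mult_op (\<lambda>_. inv (P N)) 0"
    using eq unfolding equation_iff v_def by blast
  ultimately have "v - K v = 0 - K 0"
    by (simp add: linear_0[OF linear_mult_op[OF inv_P]] linear_0[OF lin_K])
  then have "v = 0" using bij_K by (meson bij_is_inj injD)
  then show ?thesis using z_eq by (simp add: linear_0[OF linear_vop_pow])
qed

end

section \<open>Boundary value problems\<close>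

lemma diff_op_add:
  assumes P: "\<And>k. k \<le> N \<Longrightarrow> bounded_clinear (P k)" and "x \<in> sobolev N" "y \<in> sobolev N"
  shows "diff_op N P (x + y) = diff_op N P x + diff_op N P y"
  unfolding diff_op_def sum.distrib[symmetric]
  using assms by (intro sum.cong refl) (simp add: sobolev_add(2) mult_op_add Linf_op_const)

lemma diff_op_scaleC:
  fixes x :: "'h::{complex_inner, euclidean_space} l2"
  assumes P: "\<And>k. k \<le> N \<Longrightarrow> bounded_clinear (P k)" and "x \<in> sobolev N"
  shows "diff_op N P (c *\<^sub>C x) = c *\<^sub>C diff_op N P x"
  unfolding diff_op_def linear_sum[OF linear_scaleC]
  using assms by (intro sum.cong refl) (simp add: sobolev_scaleC(2) mult_op_scaleC Linf_op_const)

lemma boundary_vec_add: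
  assumes "x \<in> sobolev CARD('n)" "y \<in> sobolev CARD('n)" "t \<in> {0..1}"
  shows "(boundary_vec (x + y) t :: ('h::{complex_inner, euclidean_space}, 'n::{finite, linorder}) vec) =
    boundary_vec x t + boundary_vec y t"
  unfolding vec_eq_iff boundary_vec_def vector_add_component vec_lambda_beta
  using pos_ge_1[where 'n = 'n] assms by (intro allI cont_rep_deriv_add) (auto simp: less_eq_Suc_le)

lemma boundary_vec_scaleC:
  assumes "x \<in> sobolev CARD('n)" "t \<in> {0..1}"
  shows "(boundary_vec (c *\<^sub>C x) t :: ('h::{complex_inner, euclidean_space}, 'n::{finite, linorder}) vec) =
    c *\<^sub>C boundary_vec x t"
  unfolding vec_eq_iff boundary_vec_def scaleC_vec_def vec_lambda_beta
  using pos_ge_1[where 'n = 'n] assms by (intro allI cont_rep_deriv_scaleC) (auto simp: less_eq_Suc_le)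

lemma boundary_map_add:
  assumes "x \<in> sobolev CARD('n)" "y \<in> sobolev CARD('n)"
  shows "(boundary_map (x + y) :: ('h::{complex_inner, euclidean_space}, 'n::{finite, linorder}) vec \<times> _) =
    boundary_map x + boundary_map y"
  by (simp add: boundary_map_def boundary_vec_add assms)

lemma boundary_map_scaleC:
  assumes "x \<in> sobolev CARD('n)"
  shows "(boundary_map (c *\<^sub>C x) :: ('h::{complex_inner, euclidean_space}, 'n::{finite, linorder}) vec \<times> _) =
    c *\<^sub>C boundary_map x"
  by (simp add: boundary_map_def boundary_vec_scaleC assms scaleC_prod_def)

lemma scaleC_zero_left: "0 *\<^sub>C (x::'a::complex_inner) = 0"
  using scaleC_of_real[of 0 x] by simp

text \<open>Solutions of the homogeneous equation are parametrized linearly by their initial values in \<open>H\<^sup>N\<close>. On this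
  space the boundary operator is injective by the uniqueness assumption, hence onto, and can correct the
  boundary values of any solution of the inhomogeneous equation.\<close>

theorem boundary_value_problem:
  fixes P :: "nat \<Rightarrow> 'h::{complex_inner, euclidean_space} \<Rightarrow> 'h"
    and What :: "('h, 'n::{finite, linorder}) vec \<times> ('h, 'n) vec \<Rightarrow> ('h, 'n) vec"
  assumes P: "\<And>k. k \<le> CARD('n) \<Longrightarrow> bounded_clinear (P k)" and P_bij: "bij (P CARD('n))"
    and M: "Linf_op M" and What: "bounded_clinear What"
    and unique: "\<And>z. z \<in> op_domain What \<Longrightarrow> mult_op M z - diff_op CARD('n) P z = 0 \<Longrightarrow> z = 0"
  shows "\<exists>z\<in>op_domain What. mult_op M z - diff_op CARD('n) P z = y"
proof -
  let ?N = "CARD('n)"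
  interpret ode P ?N M by standard (use P P_bij M in auto)
  let ?E = "\<lambda>z. mult_op M z - diff_op ?N P z"
  have linWhat: "linear What" by (rule bounded_clinear_linear[OF What])
  have E_add: "?E (x + z) = ?E x + ?E z" if "x \<in> sobolev ?N" "z \<in> sobolev ?N" for x z
    using that by (simp add: mult_op_add[OF M] diff_op_add[OF P])
  have E_scaleC: "?E (c *\<^sub>C x) = c *\<^sub>C ?E x" if "x \<in> sobolev ?N" for x c
    using that by (simp add: mult_op_scaleC[OF M] diff_op_scaleC[OF P] scaleC_diff)
  have ex: "\<exists>z\<in>sobolev ?N. ?E z = y \<and> boundary_vec z 0 = c" for y and c :: "('h, 'n) vec"
  proof -
    have inj: "inj (pos :: 'n \<Rightarrow> nat)" using pos_bij by (rule bij_betw_imp_inj_on)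
    obtain z where z: "z \<in> sobolev ?N" "?E z = y" "\<forall>k<?N. cont_rep ((wderiv ^^ k) z) 0 = c $ (inv pos (Suc k))"
      using initial_value_existence[of y "\<lambda>k. c $ (inv pos (Suc k))"] by blast
    have "boundary_vec z 0 = c"
      unfolding vec_eq_iff boundary_vec_def vec_lambda_beta
    proof
      fix i :: 'n
      have "pos i - 1 < ?N" "Suc (pos i - 1) = pos i" using pos_ge_1[of i] by auto
      then show "cont_rep ((wderiv ^^ (pos i - 1)) z) 0 = c $ i" using z(3) inj by simp
    qed
    with z show ?thesis by blast
  qed
  have uniq0: "z = 0" if "z \<in> sobolev ?N" "?E z = 0" "boundary_vec z 0 = (0 :: ('h, 'n) vec)" for z
  proof (rule initial_value_uniqueness[OF that(1,2)])
    fix k assume "k < ?N"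
    then obtain i :: 'n where i: "pos i = Suc k" using pos_surj by blast
    have "boundary_vec z 0 $ i = (0 :: 'h)" using that(3) by simp
    then show "cont_rep ((wderiv ^^ k) z) 0 = 0" by (simp add: boundary_vec_def i)
  qed
  have sub: "x + (-1) *\<^sub>C z = x - z" for x z :: "'h l2"
    by (metis of_real_1 of_real_minus scaleC_of_real scaleR_minus1_left uminus_add_conv_diff add.commute)
  have sub': "x + (-1) *\<^sub>C z = x - z" for x z :: "('h, 'n) vec"
    by (metis of_real_1 of_real_minus scaleC_of_real scaleR_minus1_left uminus_add_conv_diff add.commute)
  have uniq: "x = z" if "x \<in> sobolev ?N" "?E x = ?E z" "boundary_vec x 0 = (boundary_vec z 0 :: ('h, 'n) vec)"
    "z \<in> sobolev ?N" for x z
  proof -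
    have z': "(-1) *\<^sub>C z \<in> sobolev ?N" using that by (simp add: sobolev_scaleC)
    have "x + (-1) *\<^sub>C z = 0"
    proof (rule uniq0)
      show "x + (-1) *\<^sub>C z \<in> sobolev ?N" using that(1) z' by (simp add: sobolev_add)
      show "?E (x + (-1) *\<^sub>C z) = 0"
        unfolding E_add[OF that(1) z'] E_scaleC[OF that(4)] that(2) by (simp only: sub diff_self)
      show "boundary_vec (x + (-1) *\<^sub>C z) 0 = (0 :: ('h, 'n) vec)"
        using boundary_vec_add[OF that(1) z', of 0] boundary_vec_scaleC[OF that(4), of 0 "-1"] that(3) by (simp add: sub')
    qed
    then show ?thesis by (simp add: sub)
  qed
  \<comment> \<open>the solution of the homogeneous equation with initial values \<open>c\<close>, linear in \<open>c\<close> by uniqueness\<close>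
  define Z where "Z c = (SOME z. z \<in> sobolev ?N \<and> ?E z = 0 \<and> boundary_vec z 0 = c)" for c :: "('h, 'n) vec"
  have Z: "Z c \<in> sobolev ?N" "?E (Z c) = 0" "boundary_vec (Z c) 0 = c" for c
  proof -
    have "\<exists>z. z \<in> sobolev ?N \<and> ?E z = 0 \<and> boundary_vec z 0 = c" using ex[of 0 c] by blast
    from someI_ex[OF this] show "Z c \<in> sobolev ?N" "?E (Z c) = 0" "boundary_vec (Z c) 0 = c"
      unfolding Z_def by auto
  qed
  have Z_add: "Z (a + b) = Z a + Z b" for a b
  proof (rule uniq[OF Z(1)])
    show "?E (Z (a + b)) = ?E (Z a + Z b)" unfolding E_add[OF Z(1) Z(1)] Z(2) by simp
  qed (simp_all add: boundary_vec_add Z sobolev_add)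
  have Z_scaleC: "Z (r *\<^sub>C a) = r *\<^sub>C Z a" for r a
  proof (rule uniq[OF Z(1)])
    show "?E (Z (r *\<^sub>C a)) = ?E (r *\<^sub>C Z a)" unfolding E_scaleC[OF Z(1)] Z(2) by simp
  qed (simp_all add: boundary_vec_scaleC Z sobolev_scaleC)
  define L where "L c = What (boundary_map (Z c))" for c
  have "linear L"
  proof (rule linearI)
    show "L (a + b) = L a + L b" for a b
      by (simp add: L_def Z_add boundary_map_add Z(1) linear_add[OF linWhat])
    show "L (r *\<^sub>R a) = r *\<^sub>R L a" for r a
      using bounded_clinear_scaleC[OF What, of "of_real r" "boundary_map (Z a)"]
      by (simp add: L_def Z_scaleC boundary_map_scaleC Z(1) flip: scaleC_of_real)
  qed
  moreover have "c = 0" if "L c = 0" for c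
  proof -
    have "Z c \<in> op_domain What" using that Z(1) by (simp add: op_domain_def L_def)
    then have "Z c = 0" using Z(2) by (rule unique)
    then have "Z c = 0 *\<^sub>C Z c" by simp
    then have "c = boundary_vec (0 *\<^sub>C Z c) 0" using Z(3)[of c] by simp
    also have "\<dots> = 0 *\<^sub>C c" using boundary_vec_scaleC[OF Z(1), of 0 0 c] Z(3)[of c] by simp
    finally show ?thesis by (simp add: scaleC_zero_left)
  qed
  ultimately have "surj L"
    by (intro linear_injective_imp_surjective) (simp_all add: linear_injective_0)
  obtain x where x: "x \<in> sobolev ?N" "?E x = y" using ex[of y 0] by blast
  obtain c where c: "L c = - What (boundary_map x)" using \<open>surj L\<close> by (metis surjD)
  have "What (boundary_map (Z c + x)) = 0"
    using c by (simp add: boundary_map_add Z(1) x linear_add[OF linWhat] L_def)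
  then have "Z c + x \<in> op_domain What"
    using sobolev_add(1)[OF Z(1) x(1)] by (simp add: op_domain_def)
  moreover have "?E (Z c + x) = y" unfolding E_add[OF Z(1) x(1)] Z(2) x(2) by simp
  ultimately show ?thesis by blast
qed

section \<open>Polynomials with prescribed boundary values\<close>

definition poly_l2 :: "real poly \<Rightarrow> 'a::euclidean_space \<Rightarrow> 'a l2" where
  "poly_l2 p h = abs_l2 (\<lambda>t. poly p t *\<^sub>R h)"

lemma continuous_poly_scaleR: "continuous_on S (\<lambda>t. poly (p :: real poly) t *\<^sub>R (h :: 'a::euclidean_space))"
  by (intro continuous_intros)

lemma rep_poly_l2: "AE t in I01. rep_l2 (poly_l2 p h) t = poly p t *\<^sub>R h"
  unfolding poly_l2_def by (intro rep_abs_l2 square_integrable_continuous continuous_poly_scaleR)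

lemma cont_rep_poly_l2: "t \<in> {0..1} \<Longrightarrow> cont_rep (poly_l2 p h) t = poly p t *\<^sub>R h"
  by (rule cont_rep_eqI[OF continuous_poly_scaleR rep_poly_l2])

lemma weak_deriv_poly_l2: "weak_deriv (poly_l2 p h) (poly_l2 (pderiv p) h)"
  unfolding weak_deriv_iff_prim
proof (intro exI)
  have cont: "continuous_on {0..1} (\<lambda>t. poly (pderiv p) t *\<^sub>R h)" by (rule continuous_poly_scaleR)
  have meas: "(\<lambda>t. poly (pderiv p) t *\<^sub>R h) \<in> borel_measurable I01"
    using square_integrable_continuous[OF cont] by (simp add: square_integrable_def)
  have "((\<lambda>t. poly p t *\<^sub>R h) has_vector_derivative poly (pderiv p) t *\<^sub>R h) (at t within {0..1})" for t
    using has_vector_derivative_scaleR[OF DERIV_subset[OF poly_DERIV[of p t] subset_UNIV] has_vector_derivative_const[of h]] by simp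
  then have ftc: "poly p t *\<^sub>R h = poly p 0 *\<^sub>R h + prim (\<lambda>t. poly (pderiv p) t *\<^sub>R h) t" if "t \<in> {0..1}" for t
    by (rule prim_derivative[OF _ cont that])
  have eq: "prim (rep_l2 (poly_l2 (pderiv p) h)) t = prim (\<lambda>t. poly (pderiv p) t *\<^sub>R h) t" for t
    by (rule prim_cong_AE[OF rep_poly_l2 measurable_rep_l2 meas])
  show "AE t in I01. rep_l2 (poly_l2 p h) t = poly p 0 *\<^sub>R h + prim (rep_l2 (poly_l2 (pderiv p) h)) t"
    using rep_poly_l2[of p h] AE_I01_in
  proof eventually_elim
    case (elim t)
    show ?case unfolding elim(1) eq by (rule ftc[OF elim(2)])
  qed
qed

lemma poly_l2_sobolev: "poly_l2 p h \<in> sobolev n"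
  "(wderiv ^^ k) (poly_l2 p h) = poly_l2 ((pderiv ^^ k) p) h"
  using sobolevI[of n "\<lambda>k. poly_l2 ((pderiv ^^ k) p) h"] sobolevI(2)[of k "\<lambda>k. poly_l2 ((pderiv ^^ k) p) h" k]
    weak_deriv_poly_l2 by auto

lemma boundary_vec_poly_l2:
  assumes "t \<in> {0..1}"
  shows "(boundary_vec (poly_l2 p h) t :: ('h::euclidean_space, 'n::{finite, linorder}) vec) =
    (\<chi> i. poly ((pderiv ^^ (pos i - 1)) p) t *\<^sub>R h)"
  unfolding boundary_vec_def poly_l2_sobolev(2) cont_rep_poly_l2[OF assms] ..

lemma higher_pderiv_add: "(pderiv ^^ k) (p + q) = (pderiv ^^ k) p + (pderiv ^^ k) q"
  for p q :: "real poly"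
  by (induction k) (auto simp: pderiv_add)

lemma higher_pderiv_smult: "(pderiv ^^ k) (smult c p) = smult c ((pderiv ^^ k) p)"
  for p :: "real poly"
  by (induction k) (auto simp: pderiv_smult)

text \<open>Each differentiation lowers the multiplicity of the root by at most one.\<close>

lemma higher_pderiv_at_multiple_root:
  fixes r :: "real poly"
  shows "k < n \<Longrightarrow> poly ((pderiv ^^ k) ([:- a, 1:] ^ n * r)) a = 0"
proof (induction k arbitrary: n r)
  case (Suc k)
  then obtain m where m: "n = Suc m" "k < m" by (metis Suc_lessE)
  have "pderiv ([:- a, 1:] ^ n * r) = [:- a, 1:] ^ m * ([:- a, 1:] * pderiv r + smult (1 + of_nat m) r)"
    unfolding m(1) by (simp only: pderiv_mult pderiv_power_Suc) (simp add: pderiv_pCons algebra_simps)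
  then show ?case using Suc.IH[OF m(2)] by (simp only: funpow_Suc_right o_apply)
qed simp

lemma higher_pderiv_linear_power: "(pderiv ^^ j) ([:- a, 1:] ^ j) = [:fact j :: real:]"
proof (induction j)
  case (Suc j)
  have "pderiv ([:- a, 1:] ^ Suc j) = smult (of_nat (Suc j)) ([:- a, 1::real:] ^ j)"
    by (simp only: pderiv_power_Suc) (simp add: pderiv_pCons)
  then show ?case by (simp only: funpow_Suc_right o_apply higher_pderiv_smult Suc.IH) simp
qed simp

text \<open>For \<open>a\<close> equal to \<open>0\<close> or \<open>1\<close> this is the distance from \<open>a\<close>: it maps the unit interval to itself, with
  value \<open>0\<close> at \<open>a\<close> and \<open>1\<close> at the other end.\<close>

definition ramp :: "real \<Rightarrow> real poly" where "ramp a = smult (1 - 2 * a) [:- a, 1:]"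

text \<open>A polynomial with \<open>j\<close>-th derivative \<open>1\<close> at \<open>a\<close>, while its other derivatives of order below \<open>n\<close> vanish at \<open>a\<close>, and
  those of order below \<open>m\<close> vanish at the other end. The factor \<open>(1 - s\<^sup>n)\<^sup>m\<close> does not change derivatives of order
  below \<open>n\<close> at \<open>a\<close>, and for large \<open>m\<close> makes the polynomial small in \<open>L\<^sup>2\<close>.\<close>

definition hermite :: "nat \<Rightarrow> real \<Rightarrow> nat \<Rightarrow> nat \<Rightarrow> real poly" where
  "hermite n a j m = smult (1 / fact j) ([:- a, 1:] ^ j) * (1 - ramp a ^ n) ^ m"

text \<open>Modulo \<open>(t - a)\<^sup>n\<close> the polynomial is \<open>(t - a)\<^sup>j / j!\<close>.\<close>

lemma hermite_at_own:
  assumes "k < n" shows "poly ((pderiv ^^ k) (hermite n a j m)) a = (if k = j then 1 else 0)"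
proof -
  have "(1 - ramp a ^ n) - 1 dvd (1 - ramp a ^ n) ^ m - 1 ^ m"
    by (metis dvd_triv_left power_diff_sumr2)
  then have "ramp a ^ n dvd (1 - ramp a ^ n) ^ m - 1" by simp
  then obtain s where s: "(1 - ramp a ^ n) ^ m = 1 + ramp a ^ n * s"
    by (metis dvdE diff_add_cancel add.commute)
  have "hermite n a j m = smult (1 / fact j) ([:- a, 1:] ^ j) +
      [:- a, 1:] ^ n * (smult ((1 - 2 * a) ^ n) s * smult (1 / fact j) ([:- a, 1:] ^ j))"
  proof -
    have "X * (1 + smult c Y * s) = X + Y * (smult c s * X)" for X Y :: "real poly" and c
      by (simp add: algebra_simps)
    moreover have "ramp a ^ n = smult ((1 - 2 * a) ^ n) ([:- a, 1:] ^ n)"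
      unfolding ramp_def smult_power ..
    ultimately show ?thesis unfolding hermite_def s by simp
  qed
  then have "poly ((pderiv ^^ k) (hermite n a j m)) a = (1 / fact j) * poly ((pderiv ^^ k) ([:- a, 1:] ^ j)) a"
    using higher_pderiv_at_multiple_root[OF assms]
    by (simp only: higher_pderiv_add higher_pderiv_smult poly_add poly_smult)
  also have "poly ((pderiv ^^ k) ([:- a, 1:] ^ j)) a = (if k = j then fact j else 0)"
  proof (cases k j rule: linorder_cases)
    case less
    then show ?thesis using higher_pderiv_at_multiple_root[of k j a 1] by simp
  next
    case equal
    then show ?thesis by (simp add: higher_pderiv_linear_power)
  next
    case greater
    then obtain i where k: "k = Suc i + j" by (metis add.commute add_Suc_right less_natE)
    have "(pderiv ^^ Suc i) [:fact j :: real:] = 0"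
      by (induction i) (auto simp: pderiv_pCons)
    then have "(pderiv ^^ k) ([:- a, 1:] ^ j) = 0"
      unfolding k funpow_add o_apply higher_pderiv_linear_power .
    then show ?thesis using greater by simp
  qed
  finally show ?thesis by simp
qed

text \<open>The factor \<open>1 - s\<^sup>n\<close> has a zero at the other end.\<close>

lemma hermite_at_other:
  assumes "k < m" "a \<in> {0, 1}" shows "poly ((pderiv ^^ k) (hermite n a j m)) (1 - a) = 0"
proof -
  have "poly (1 - ramp a ^ n) (1 - a) = 0" using assms(2) by (auto simp: ramp_def)
  then obtain r where r: "1 - ramp a ^ n = [:- (1 - a), 1:] * r"
    by (metis dvdE poly_eq_0_iff_dvd)
  have "hermite n a j m = [:- (1 - a), 1:] ^ m * (r ^ m * smult (1 / fact j) ([:- a, 1:] ^ j))"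
    unfolding hermite_def r power_mult_distrib by (simp only: mult_ac)
  then show ?thesis by (simp only: higher_pderiv_at_multiple_root[OF assms(1)])
qed

lemma hermite_bound:
  assumes a: "a \<in> {0, 1}" and t: "t \<in> {0..1}" and n: "0 < n"
  shows "\<bar>poly (hermite n a j m) t\<bar> \<le> 1"
    and "t \<noteq> a \<Longrightarrow> (\<lambda>m. poly (hermite n a j m) t) \<longlonglongrightarrow> 0"
proof -
  define s where "s = (1 - 2 * a) * (t - a)"
  have s: "0 \<le> s" "s \<le> 1" using a t by (auto simp: s_def)
  have eq: "poly (hermite n a j m) t = (1 / fact j * (t - a) ^ j) * (1 - s ^ n) ^ m" for m
    by (simp add: hermite_def ramp_def s_def algebra_simps)
  have sn: "0 \<le> 1 - s ^ n" "1 - s ^ n \<le> 1" using s by (auto intro: power_le_one)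
  have "\<bar>t - a\<bar> ^ j \<le> 1" using a t by (intro power_le_one) auto
  then have "\<bar>1 / fact j * (t - a) ^ j\<bar> \<le> 1 * 1"
    unfolding abs_mult power_abs by (intro mult_mono) (auto simp: fact_ge_1)
  moreover have "\<bar>(1 - s ^ n) ^ m\<bar> \<le> 1" using sn by (simp add: power_le_one power_abs)
  ultimately have "\<bar>1 / fact j * (t - a) ^ j\<bar> * \<bar>(1 - s ^ n) ^ m\<bar> \<le> 1 * 1"
    by (intro mult_mono) auto
  then show "\<bar>poly (hermite n a j m) t\<bar> \<le> 1" unfolding eq abs_mult by simp
  assume "t \<noteq> a"
  then have "s > 0" using a t by (auto simp: s_def)
  then have "\<bar>1 - s ^ n\<bar> < 1" using sn by simp
  then have "(\<lambda>m. (1 / fact j * (t - a) ^ j) * (1 - s ^ n) ^ m) \<longlonglongrightarrow> (1 / fact j * (t - a) ^ j) * 0"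
    by (intro tendsto_intros LIMSEQ_power_zero) simp
  then show "(\<lambda>m. poly (hermite n a j m) t) \<longlonglongrightarrow> 0" unfolding eq by simp
qed

lemma hermite_tendsto_0:
  fixes h :: "'a::euclidean_space"
  assumes a: "a \<in> {0, 1}" and n: "0 < n"
  shows "(\<lambda>m. poly_l2 (hermite n a j m) h) \<longlonglongrightarrow> 0"
proof -
  let ?q = "\<lambda>m t. poly (hermite n a j m) t"
  have "(\<lambda>m. LINT t|I01. (norm (?q m t *\<^sub>R h))\<^sup>2) \<longlonglongrightarrow> (LINT t|I01. 0)"
  proof (rule integral_dominated_convergence[where w = "\<lambda>_. (norm h)\<^sup>2"])
    show "AE t in I01. (\<lambda>m. (norm (?q m t *\<^sub>R h))\<^sup>2) \<longlonglongrightarrow> 0"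
      using AE_I01_neq[of a] AE_I01_in
    proof eventually_elim
      case (elim t)
      then have "(\<lambda>m. (norm (?q m t *\<^sub>R h))\<^sup>2) \<longlonglongrightarrow> (norm (0 *\<^sub>R h))\<^sup>2"
        by (intro tendsto_intros hermite_bound(2)[OF a _ n]) auto
      then show ?case by simp
    qed
    show "AE t in I01. norm ((norm (?q m t *\<^sub>R h))\<^sup>2) \<le> (norm h)\<^sup>2" for m
    proof (rule AE_I2)
      fix t assume "t \<in> space I01"
      then have "\<bar>?q m t\<bar> \<le> 1" using hermite_bound(1)[OF a _ n] by simp
      then have "\<bar>?q m t\<bar> * norm h \<le> 1 * norm h" by (intro mult_right_mono) auto
      then have "(\<bar>?q m t\<bar> * norm h)\<^sup>2 \<le> (norm h)\<^sup>2" by (intro power_mono) auto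
      then show "norm ((norm (?q m t *\<^sub>R h))\<^sup>2) \<le> (norm h)\<^sup>2" by simp
    qed
    show "(\<lambda>t. (norm (?q m t *\<^sub>R h))\<^sup>2) \<in> borel_measurable I01" for m
      using square_integrable_continuous[OF continuous_poly_scaleR, of "hermite n a j m" h]
      by (simp add: square_integrable_def borel_measurable_integrable)
  qed auto
  moreover have "(LINT t|I01. (norm (?q m t *\<^sub>R h))\<^sup>2) = (norm (poly_l2 (hermite n a j m) h))\<^sup>2" for m
    unfolding norm_l2_power2
  proof (rule integral_cong_AE)
    show "(\<lambda>t. (norm (?q m t *\<^sub>R h))\<^sup>2) \<in> borel_measurable I01"
      using square_integrable_continuous[OF continuous_poly_scaleR, of "hermite n a j m" h]
      by (simp add: square_integrable_def borel_measurable_integrable)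
    show "AE t in I01. (norm (?q m t *\<^sub>R h))\<^sup>2 = (norm (rep_l2 (poly_l2 (hermite n a j m) h) t))\<^sup>2"
      using rep_poly_l2[of "hermite n a j m" h] by eventually_elim simp
  qed measurable
  ultimately have "(\<lambda>m. (norm (poly_l2 (hermite n a j m) h))\<^sup>2) \<longlonglongrightarrow> 0" by simp
  then have "(\<lambda>m. sqrt ((norm (poly_l2 (hermite n a j m) h))\<^sup>2)) \<longlonglongrightarrow> sqrt 0" by (rule tendsto_real_sqrt)
  then show ?thesis by (simp add: tendsto_norm_zero_iff)
qed

lemma sobolev_0: "(0 :: 'h::{complex_inner, euclidean_space} l2) \<in> sobolev n"
  using sobolev_scaleC(1)[OF poly_l2_sobolev(1)[of 0 "undefined::'h" n], of 0] by (simp add: scaleC_zero_left)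

lemma sobolev_sum:
  fixes f :: "'i \<Rightarrow> 'h::{complex_inner, euclidean_space} l2"
  assumes "finite A" "\<And>i. i \<in> A \<Longrightarrow> f i \<in> sobolev CARD('n)" "t \<in> {0..1}"
  shows "sum f A \<in> sobolev CARD('n) \<and>
    (boundary_vec (sum f A) t :: ('h, 'n::{finite, linorder}) vec) = (\<Sum>i\<in>A. boundary_vec (f i) t)"
  using assms
proof (induction A rule: finite_induct)
  case empty
  have "boundary_vec (0 *\<^sub>C (0 :: 'h l2)) t = 0 *\<^sub>C (boundary_vec 0 t :: ('h, 'n) vec)"
    by (rule boundary_vec_scaleC[OF sobolev_0 assms(3)])
  then show ?case by (simp add: sobolev_0 scaleC_zero_left)
next
  case (insert i A)
  then show ?case by (simp add: sobolev_add(1) boundary_vec_add)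
qed

text \<open>A superposition of the polynomials above for the two end points, with the exponent of the damping factor
  as the index of the sequence.\<close>

theorem boundary_data_small_norm:
  fixes u y :: "('h::{complex_inner, euclidean_space}, 'n::{finite, linorder}) vec"
  shows "\<exists>x. (\<forall>m. x m \<in> sobolev CARD('n) \<and> boundary_map (x m) = (u, y)) \<and> x \<longlonglongrightarrow> 0"
proof -
  let ?N = "CARD('n)"
  \<comment> \<open>boundary vector \<open>w\<close> at \<open>a\<close> and zero at \<open>1 - a\<close>; \<open>m + N\<close> makes the order of the zero there sufficient\<close>
  define X where "X a w m = (\<Sum>i\<in>UNIV. poly_l2 (hermite ?N a (pos i - 1) (m + ?N)) (w $ i))"
    for a and w :: "('h, 'n) vec" and m
  have X: "X a w m \<in> sobolev ?N" for a w m
    unfolding X_def by (rule conjunct1[OF sobolev_sum[where t = 0 and 'n = 'n]]) (auto simp: poly_l2_sobolev)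
  have bdry: "boundary_vec (X a w m) t = (\<Sum>i\<in>UNIV. \<chi> l. poly ((pderiv ^^ (pos l - 1)) (hermite ?N a (pos i - 1) (m + ?N))) t *\<^sub>R (w $ i))"
    if "t \<in> {0..1}" for a w m t
    unfolding X_def boundary_vec_poly_l2[OF that, symmetric]
    by (rule conjunct2[OF sobolev_sum]) (use that in \<open>auto simp: poly_l2_sobolev\<close>)
  have less: "pos l - 1 < ?N" for l :: 'n using pos_ge_1[of l] by auto
  have own: "boundary_vec (X a w m) a = w" if a: "a \<in> {0, 1}" for a w m
  proof -
    have "pos l - 1 = pos i - 1 \<longleftrightarrow> i = l" for i l :: 'n
    proof -
      have "pos l - 1 = pos i - 1 \<longleftrightarrow> pos i = pos l" using pos_ge_1[of i] pos_ge_1[of l] by auto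
      then show ?thesis using bij_betw_imp_inj_on[OF pos_bij[where 'n = 'n]] by (simp add: inj_eq)
    qed
    then have "poly ((pderiv ^^ (pos l - 1)) (hermite ?N a (pos i - 1) (m + ?N))) a *\<^sub>R (w $ i) = (if i = l then w $ i else 0)"
      for i l :: 'n using hermite_at_own[OF less, of l a "pos i - 1" "m + ?N"] by simp
    moreover have "a \<in> {0..1}" using a by auto
    ultimately show ?thesis by (simp add: bdry vec_eq_iff sum_component)
  qed
  have other: "boundary_vec (X a w m) (1 - a) = (0 :: ('h, 'n) vec)" if a: "a \<in> {0, 1}" for a w m
  proof -
    have "poly ((pderiv ^^ (pos l - 1)) (hermite ?N a (pos i - 1) (m + ?N))) (1 - a) = 0" for i l :: 'n
      using less[of l] a by (intro hermite_at_other) auto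
    moreover have "1 - a \<in> {0..1}" using a by auto
    ultimately show ?thesis by (simp add: bdry vec_eq_iff sum_component)
  qed
  have lim: "(\<lambda>m. X a w m) \<longlonglongrightarrow> 0" if "a \<in> {0, 1}" for a w
  proof -
    have "(\<lambda>m. X a w m) \<longlonglongrightarrow> (\<Sum>i\<in>(UNIV :: 'n set). 0)"
      unfolding X_def
      by (intro tendsto_sum LIMSEQ_ignore_initial_segment hermite_tendsto_0 that) auto
    then show ?thesis by simp
  qed
  define x where "x m = X 1 u m + X 0 y m" for m
  have "boundary_map (x m) = (u, y)" for m
    using own[of 1 u m] own[of 0 y m] other[of 1 u m] other[of 0 y m]
    by (simp add: x_def boundary_map_def boundary_vec_add X)
  moreover have "x m \<in> sobolev ?N" for m by (simp add: x_def sobolev_add(1) X)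
  moreover have "(\<lambda>m. X 1 u m + X 0 y m) \<longlonglongrightarrow> 0 + 0" by (intro tendsto_add lim) auto
  then have "x \<longlonglongrightarrow> 0" by (simp add: x_def[abs_def])
  ultimately show ?thesis by blast
qed

section \<open>Dissipativity and boundary conditions\<close>

text \<open>Inserting functions with given boundary data whose norms tend to zero into the energy balance removes the
  \<open>P\<^sub>0\<close> term. Inserting \<open>t\<^sup>N (t - 1)\<^sup>N h\<close>, whose boundary data vanish, leaves only that term.\<close>

theorem dissipative_iff_boundary:
  fixes P :: "nat \<Rightarrow> 'h::{complex_inner, euclidean_space} \<Rightarrow> 'h"
    and What :: "('h, 'n::{finite, linorder}) vec \<times> ('h, 'n) vec \<Rightarrow> ('h, 'n) vec"
  assumes bdd: "\<And>k. k \<le> CARD('n) \<Longrightarrow> bounded_clinear (P k)"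
    and adj: "\<And>k. 1 \<le> k \<Longrightarrow> k \<le> CARD('n) \<Longrightarrow> cadjoint (P k) = (\<lambda>x. (-1) ^ (k + 1) *\<^sub>R P k x)"
    and What: "bounded_clinear What"
  shows "(\<forall>x\<in>op_domain What. inner (diff_op CARD('n) P x) x \<le> 0) \<longleftrightarrow>
    (\<forall>h. inner (P 0 h) h \<le> 0) \<and>
    (\<forall>u y. What (u, y) = 0 \<longrightarrow> inner u (Q_op P u) - inner y (Q_op P y) \<le> 0)" (is "?D \<longleftrightarrow> ?P0 \<and> ?B")
proof -
  let ?N = "CARD('n)"
  have P0: "bounded_clinear (P 0)" using bdd by simp
  have energy: "2 * inner (diff_op ?N P x) x = 2 * inner (mult_op (\<lambda>_. P 0) x) x +
      (inner u (Q_op P u) - inner y (Q_op P y))"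
    if "x \<in> sobolev ?N" "boundary_map x = (u, y)" for x and u y :: "('h, 'n) vec"
    using energy_balance[where P = P and x = x, OF bdd adj that(1) refl refl] that(2) by (simp add: boundary_map_def)
  show ?thesis
  proof
    assume D: ?D
    have ?B
    proof (intro allI impI)
      fix u y assume uy: "What (u, y) = 0"
      obtain x where x: "\<And>m. x m \<in> sobolev ?N" "\<And>m. boundary_map (x m) = (u, y)" "x \<longlonglongrightarrow> 0"
        using boundary_data_small_norm[of u y] by blast
      have "2 * inner (mult_op (\<lambda>_. P 0) (x m)) (x m) + (inner u (Q_op P u) - inner y (Q_op P y)) \<le> 0" for m
    proof -
      have "x m \<in> op_domain What" using x(1,2) uy by (simp add: op_domain_def)
      then have "inner (diff_op ?N P (x m)) (x m) \<le> 0" using D by blast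
      then show ?thesis using energy[OF x(1,2), of m] by linarith
    qed
      moreover have "(\<lambda>m. 2 * inner (mult_op (\<lambda>_. P 0) (x m)) (x m) + (inner u (Q_op P u) - inner y (Q_op P y)))
          \<longlonglongrightarrow> 2 * inner (mult_op (\<lambda>_. P 0) 0) 0 + (inner u (Q_op P u) - inner y (Q_op P y))"
        by (intro tendsto_intros bounded_linear.tendsto[OF bounded_linear_mult_op[OF Linf_op_const[OF P0]]] x(3))
      ultimately have "2 * inner (mult_op (\<lambda>_. P 0) 0) (0 :: 'h l2) + (inner u (Q_op P u) - inner y (Q_op P y)) \<le> 0"
        by (intro LIMSEQ_le_const2) auto
      then show "inner u (Q_op P u) - inner y (Q_op P y) \<le> 0" by simp
    qed
    moreover have ?P0
    proof
      fix h
      define r :: "real poly" where "r = [:- 0, 1:] ^ ?N * [:- 1, 1:] ^ ?N"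
      have r': "r = [:- 1, 1:] ^ ?N * [:- 0, 1:] ^ ?N" by (simp add: r_def mult.commute)
      have less: "pos l - 1 < ?N" for l :: 'n using pos_ge_1[of l] by auto
      have "boundary_map (poly_l2 r h) = (0 :: ('h, 'n) vec \<times> ('h, 'n) vec)"
        using higher_pderiv_at_multiple_root[OF less, of _ 0 "[:- 1, 1:] ^ ?N", folded r_def]
          higher_pderiv_at_multiple_root[OF less, of _ 1 "[:- 0, 1:] ^ ?N", folded r']
        by (simp add: boundary_map_def boundary_vec_poly_l2 vec_eq_iff zero_prod_def)
      then have bd: "boundary_map (poly_l2 r h) = (0 :: ('h, 'n) vec, 0 :: ('h, 'n) vec)" by (simp add: zero_prod_def)
      have Q0: "inner (0 :: ('h, 'n) vec) v = 0" for v by simp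
      have "poly_l2 r h \<in> op_domain What"
        using bd linear_0[OF bounded_clinear_linear[OF What]]
        by (simp add: op_domain_def poly_l2_sobolev zero_prod_def)
      then have "inner (mult_op (\<lambda>_. P 0) (poly_l2 r h)) (poly_l2 r h) \<le> 0"
        using D energy[OF poly_l2_sobolev(1) bd] by (fastforce simp: Q0)
      also have "inner (mult_op (\<lambda>_. P 0) (poly_l2 r h)) (poly_l2 r h) =
          (LINT t|I01. (poly r t)\<^sup>2 * inner (P 0 h) h)"
        unfolding inner_l2_eq
      proof (rule integral_cong_AE)
        show "AE t in I01. inner (rep_l2 (mult_op (\<lambda>_. P 0) (poly_l2 r h)) t) (rep_l2 (poly_l2 r h) t) =
            (poly r t)\<^sup>2 * inner (P 0 h) h"
          using rep_poly_l2[of r h] rep_mult_op[OF Linf_op_const[OF P0], of "poly_l2 r h"]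
          by eventually_elim (simp add: linear_cmul[OF bounded_clinear_linear[OF P0]] power2_eq_square)
        show "(\<lambda>t. (poly r t)\<^sup>2 * inner (P 0 h) h) \<in> borel_measurable I01"
          by (intro continuous_imp_measurable_on_sets_lebesgue continuous_intros) auto
      qed measurable
      also have "\<dots> = (LINT t|I01. (poly r t)\<^sup>2) * inner (P 0 h) h" by simp
      finally have le: "(LINT t|I01. (poly r t)\<^sup>2) * inner (P 0 h) h \<le> 0" .
      have c: "continuous_on {0..1} (\<lambda>t. (poly r t)\<^sup>2)" by (intro continuous_intros)
      have "integral {0..1} (\<lambda>t. (poly r t)\<^sup>2) = (LINT t|I01. (poly r t)\<^sup>2)"
        by (rule lebesgue_integral_eq_integral[symmetric])
           (use integrable_square_integrable[OF square_integrable_continuous[OF c]] in auto)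
      moreover have "poly r (1/2) \<noteq> 0" by (simp add: r_def)
      ultimately have "(LINT t|I01. (poly r t)\<^sup>2) \<noteq> 0"
        using integral_eq_0_iff[OF c] by (auto dest!: bspec[of _ _ "1/2"])
      moreover have "(LINT t|I01. (poly r t)\<^sup>2) \<ge> 0" by simp
      ultimately have "(LINT t|I01. (poly r t)\<^sup>2) > 0" by linarith
      then show "inner (P 0 h) h \<le> 0" using le by (simp add: mult_le_0_iff)
    qed
    ultimately show "?P0 \<and> ?B" by blast
  next
    assume PB: "?P0 \<and> ?B"
    show ?D
    proof
      fix x assume x: "x \<in> op_domain What"
      obtain u y where uy: "boundary_map x = (u, y :: ('h, 'n) vec)" by (cases "boundary_map x :: ('h, 'n) vec \<times> ('h, 'n) vec")
      have "inner (mult_op (\<lambda>_. P 0) x) x \<le> 0"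
      proof -
        have "0 \<le> (LINT t|I01. - inner (P 0 (rep_l2 x t)) (rep_l2 x t))"
          using PB by (intro Bochner_Integration.integral_nonneg) simp
        then show ?thesis unfolding inner_mult_op_const[OF P0] by simp
      qed
      moreover have "inner u (Q_op P u) - inner y (Q_op P y) \<le> 0"
        using PB x uy by (simp add: op_domain_def)
      ultimately show "inner (diff_op ?N P x) x \<le> 0"
        using energy[OF _ uy] x by (simp add: op_domain_def)
    qed
  qed
qed

section \<open>The weighted space and generation\<close>

text \<open>Positivity of the quadratic form at \<open>v - r S v\<close> for a suitable \<open>r\<close>, as in the proof of the
  Cauchy--Schwarz inequality.\<close>

lemma positive_operator_bound:
  fixes S :: "'a::real_inner \<Rightarrow> 'a"
  assumes lin: "linear S" and sym: "\<And>x y. inner (S x) y = inner x (S y)" and nn: "\<And>x. 0 \<le> inner x (S x)"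
    and C: "\<And>x. norm (S x) \<le> C * norm x" "C > 0"
  shows "(norm (S v))\<^sup>2 \<le> C * inner v (S v)"
proof -
  \<comment> \<open>minimizes the bound on the quadratic form along \<open>v - r S v\<close>\<close>
  define r where "r = 1 / C"
  have "inner (S v) (S (S v)) \<le> C * (norm (S v))\<^sup>2"
    using order_trans[OF norm_cauchy_schwarz mult_left_mono[OF C(1) norm_ge_zero], of "S v" "S v"]
    by (simp add: power2_eq_square mult_ac)
  then have "r\<^sup>2 * inner (S v) (S (S v)) \<le> r\<^sup>2 * (C * (norm (S v))\<^sup>2)"
    by (rule mult_left_mono) simp
  also have "\<dots> = r * (norm (S v))\<^sup>2" using C(2) by (simp add: r_def power2_eq_square)
  finally have "r\<^sup>2 * inner (S v) (S (S v)) \<le> r * (norm (S v))\<^sup>2" .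
  moreover have "inner (v - r *\<^sub>R S v) (S (v - r *\<^sub>R S v)) =
      inner v (S v) - 2 * r * (norm (S v))\<^sup>2 + r\<^sup>2 * inner (S v) (S (S v))"
  proof -
    have "inner v (S (S v)) = (norm (S v))\<^sup>2"
      using sym[of v "S v"] by (simp add: power2_norm_eq_inner)
    moreover have "inner (S v) (S v) = (norm (S v))\<^sup>2" by (simp add: power2_norm_eq_inner)
    ultimately show ?thesis
      by (simp add: linear_diff[OF lin] linear_cmul[OF lin] inner_diff_left inner_diff_right
          power2_eq_square[of r] algebra_simps)
  qed
  ultimately have "0 \<le> inner v (S v) - r * (norm (S v))\<^sup>2"
    using nn[of "v - r *\<^sub>R S v"] by linarith
  then show ?thesis using C(2) by (simp add: r_def field_simps)
qed

locale weight =
  fixes \<H> :: "real \<Rightarrow> 'h \<Rightarrow> 'h::{complex_inner, euclidean_space}"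
  assumes H_pos: "AE \<zeta> in lebesgue_on {0..1}. op_nonneg (\<H> \<zeta>) \<and> bij (\<H> \<zeta>)"
    and H_Linf: "Linf_op \<H>" and H_inv_Linf: "Linf_op (\<lambda>\<zeta>. inv (\<H> \<zeta>))"
begin

abbreviation "Hm \<equiv> mult_op \<H>"
abbreviation "Hinv \<equiv> mult_op (\<lambda>\<zeta>. inv (\<H> \<zeta>))"

lemma H_clinear: "AE t in I01. bounded_clinear (\<H> t)"
  using H_Linf by (simp add: Linf_op_def)

lemma Hm_Hinv: "Hm (Hinv x) = x" "Hinv (Hm x) = x"
proof -
  show "Hm (Hinv x) = x"
  proof (rule l2_eqI)
    show "AE t in I01. rep_l2 (Hm (Hinv x)) t = rep_l2 x t"
      using rep_mult_op[OF H_Linf, of "Hinv x"] rep_mult_op[OF H_inv_Linf, of x] H_pos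
      by eventually_elim (simp add: bij_is_surj surj_f_inv_f)
  qed
  show "Hinv (Hm x) = x"
  proof (rule l2_eqI)
    show "AE t in I01. rep_l2 (Hinv (Hm x)) t = rep_l2 x t"
      using rep_mult_op[OF H_inv_Linf, of "Hm x"] rep_mult_op[OF H_Linf, of x] H_pos
      by eventually_elim (simp add: bij_is_inj)
  qed
qed

lemma Hm_symmetric: "inner (Hm x) y = inner x (Hm y)"
  unfolding inner_l2_eq
proof (rule integral_cong_AE)
  show "AE t in I01. inner (rep_l2 (Hm x) t) (rep_l2 y t) = inner (rep_l2 x t) (rep_l2 (Hm y) t)"
    using rep_mult_op[OF H_Linf, of x] rep_mult_op[OF H_Linf, of y] H_pos H_clinear
    by eventually_elim (simp add: op_nonneg_symmetric(1))
qed measurable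

text \<open>Positivity alone is not coercivity. It is combined with the bound on the inverse:
  \<open>\<parallel>v\<parallel>\<^sup>2 \<le> \<parallel>\<H>\<^sup>-\<^sup>1\<parallel>\<^sup>2 \<parallel>\<H> v\<parallel>\<^sup>2 \<le> \<parallel>\<H>\<^sup>-\<^sup>1\<parallel>\<^sup>2 \<parallel>\<H>\<parallel> \<langle>v, \<H> v\<rangle>\<close>.\<close>

lemma Hm_lower_bound: "\<exists>K>0. \<forall>x. (norm x)\<^sup>2 \<le> K * inner x (Hm x)"
proof -
  obtain C where C: "C \<ge> 0" "AE t in I01. \<forall>v. norm (\<H> t v) \<le> C * norm v" using Linf_op_bound[OF H_Linf] .
  obtain E where E: "E \<ge> 0" "AE t in I01. \<forall>v. norm (inv (\<H> t) v) \<le> E * norm v" using Linf_op_bound[OF H_inv_Linf] .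
  define K where "K = (E\<^sup>2 + 1) * (C + 1)"
  have K: "K > 0" unfolding K_def using C(1) by (intro mult_pos_pos) (auto simp: add_nonneg_pos)
  have "(norm x)\<^sup>2 \<le> K * inner x (Hm x)" for x
  proof -
    have "AE t in I01. (norm (rep_l2 x t))\<^sup>2 \<le> K * inner (rep_l2 x t) (rep_l2 (Hm x) t)"
      using C(2) E(2) rep_mult_op[OF H_Linf, of x] H_pos H_clinear
    proof eventually_elim
      case (elim t)
      let ?v = "rep_l2 x t" and ?S = "\<H> t"
      have S: "linear ?S" using elim(5) by (rule bounded_clinear_linear)
      have sym: "inner (?S a) b = inner a (?S b)" "0 \<le> inner a (?S a)" for a b
        using op_nonneg_symmetric[OF elim(5)] elim(4) by auto
      have bd: "norm (?S a) \<le> (C + 1) * norm a" for a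
        using elim(1)[rule_format, of a] norm_ge_zero[of a] unfolding distrib_right mult_1_left by linarith
      have "(norm (?S ?v))\<^sup>2 \<le> (C + 1) * inner ?v (?S ?v)"
        using C(1) by (intro positive_operator_bound[OF S sym bd]) simp
      moreover have "(norm ?v)\<^sup>2 \<le> (E\<^sup>2 + 1) * (norm (?S ?v))\<^sup>2"
      proof -
        have "inv ?S (?S ?v) = ?v" using elim(4) by (simp add: bij_is_inj)
        then have "norm ?v \<le> E * norm (?S ?v)" using elim(2)[rule_format, of "?S ?v"] by simp
        then have "(norm ?v)\<^sup>2 \<le> (E * norm (?S ?v))\<^sup>2" by (intro power_mono) auto
        also have "\<dots> \<le> (E\<^sup>2 + 1) * (norm (?S ?v))\<^sup>2" by (simp add: power_mult_distrib distrib_right)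
        finally show ?thesis .
      qed
      moreover have "(E\<^sup>2 + 1) * (norm (?S ?v))\<^sup>2 \<le> (E\<^sup>2 + 1) * ((C + 1) * inner ?v (?S ?v))"
        using calculation(1) by (intro mult_left_mono) auto
      ultimately show ?case unfolding elim(3) K_def by (simp only: mult.assoc)
    qed
    then have "(norm x)\<^sup>2 \<le> (LINT t|I01. K * inner (rep_l2 x t) (rep_l2 (Hm x) t))"
      unfolding norm_l2_power2 by (intro integral_mono_AE) (auto intro!: integrable_inner)
    then show ?thesis by (simp add: inner_l2_eq)
  qed
  with K show ?thesis by blast
qed

lemma Hm_pos: "0 \<le> inner x (Hm x)" "inner x (Hm x) \<le> 0 \<Longrightarrow> x = 0"
proof -
  obtain K where K: "K > 0" "\<And>x. (norm x)\<^sup>2 \<le> K * inner x (Hm x)" using Hm_lower_bound by blast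
  show "0 \<le> inner x (Hm x)"
    using order_trans[OF zero_le_power2 K(2)] K(1) by (simp add: zero_le_mult_iff)
  assume "inner x (Hm x) \<le> 0"
  then have "K * inner x (Hm x) \<le> 0" using K(1) by (simp add: mult_nonneg_nonpos)
  then have "(norm x)\<^sup>2 \<le> 0" using K(2)[of x] by linarith
  then show "x = 0" by simp
qed

lemma Hm_add: "Hm (x + y) = Hm x + Hm y" and Hm_scaleC: "Hm (c *\<^sub>C x) = c *\<^sub>C Hm x"
  by (rule mult_op_add[OF H_Linf], rule mult_op_scaleC[OF H_Linf])

definition ip :: "'h l2 \<Rightarrow> 'h l2 \<Rightarrow> complex" where "ip x z = cinner x (Hm z)"

lemma Re_ip: "Re (ip x z) = inner x (Hm z)"
  by (simp add: ip_def Re_cinner)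

sublocale hilbert_form ip
proof
  fix x y z :: "'h l2" and c :: complex
  show "ip (x + y) z = ip x z + ip y z" by (simp add: ip_def cinner_add_left)
  show "ip (c *\<^sub>C x) z = c * ip x z" by (simp add: ip_def cinner_scaleC_left)
  show "ip x y = cnj (ip y x)"
  proof -
    have "inner (\<i> *\<^sub>C x) (Hm y) = inner (\<i> *\<^sub>C Hm x) y" by (simp add: Hm_symmetric[symmetric] Hm_scaleC)
    also have "\<dots> = - inner (\<i> *\<^sub>C y) (Hm x)" by (simp add: inner_scaleC_i inner_commute)
    finally have "inner (\<i> *\<^sub>C x) (Hm y) = - inner (\<i> *\<^sub>C y) (Hm x)" .
    moreover have "inner x (Hm y) = inner y (Hm x)" by (metis Hm_symmetric inner_commute)
    ultimately show ?thesis by (simp add: ip_def cinner_eq complex_eq_iff)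
  qed
  show "0 \<le> Re (ip x x)" by (simp add: Re_ip Hm_pos)
  obtain K where K: "K > 0" "\<And>x. (norm x)\<^sup>2 \<le> K * inner x (Hm x)" using Hm_lower_bound by blast
  obtain B where B: "B > 0" "\<And>x. norm (Hm x) \<le> B * norm x"
    using bounded_linear.pos_bounded[OF bounded_linear_mult_op[OF H_Linf]] by (auto simp: mult.commute)
  have ip_norm: "ip_norm ip x = sqrt (inner x (Hm x))" for x by (simp add: ip_norm_def Re_ip)
  have lower: "norm x \<le> sqrt K * ip_norm ip x" for x
    using real_sqrt_le_mono[OF K(2)[of x]] by (simp add: ip_norm real_sqrt_mult)
  have upper: "ip_norm ip x \<le> sqrt B * norm x" for x
  proof -
    have "inner x (Hm x) \<le> B * (norm x)\<^sup>2"
      using order_trans[OF norm_cauchy_schwarz mult_left_mono[OF B(2) norm_ge_zero], of x x]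
      by (simp add: power2_eq_square mult_ac)
    then show ?thesis using real_sqrt_le_mono[of "inner x (Hm x)" "B * (norm x)\<^sup>2"] by (simp add: ip_norm real_sqrt_mult)
  qed
  have "norm x \<le> (sqrt K + sqrt B) * ip_norm ip x \<and> ip_norm ip x \<le> (sqrt K + sqrt B) * norm x" for x
  proof -
    have "0 \<le> sqrt B * ip_norm ip x" "0 \<le> sqrt K * norm x"
      using B(1) K(1) Hm_pos(1)[of x] by (auto simp: ip_norm)
    then show ?thesis using lower[of x] upper[of x] unfolding distrib_right by linarith
  qed
  moreover have "sqrt K + sqrt B > 0" using K(1) B(1) by (simp add: add_pos_pos)
  ultimately show "\<exists>K>0. \<forall>x. norm x \<le> K * ip_norm ip x \<and> ip_norm ip x \<le> K * norm x" by blast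
qed

end

lemma diff_op_scale_coefficients:
  fixes P :: "nat \<Rightarrow> 'h::{complex_inner, euclidean_space} \<Rightarrow> 'h"
  assumes P: "\<And>k. k \<le> N \<Longrightarrow> bounded_clinear (P k)"
  shows "k \<le> N \<Longrightarrow> bounded_clinear (\<lambda>v. r *\<^sub>R P k v)"
    and "diff_op N (\<lambda>k v. r *\<^sub>R P k v) x = r *\<^sub>R diff_op N P x"
proof -
  show cl: "bounded_clinear (\<lambda>v. r *\<^sub>R P k v)" if "k \<le> N" for k
    using P[OF that] by (auto simp: bounded_clinear_def scaleC_scaleR intro: bounded_linear_const_scaleR)
  show "diff_op N (\<lambda>k v. r *\<^sub>R P k v) x = r *\<^sub>R diff_op N P x"
    unfolding diff_op_def scaleR_sum_right
  proof (intro sum.cong refl l2_eqI)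
    fix k assume "k \<in> {..N}"
    then have k: "k \<le> N" by simp
    show "AE t in I01. rep_l2 (mult_op (\<lambda>_ v. r *\<^sub>R P k v) ((wderiv ^^ k) x)) t =
        rep_l2 (r *\<^sub>R mult_op (\<lambda>_. P k) ((wderiv ^^ k) x)) t"
      using rep_mult_op[OF Linf_op_const[OF cl[OF k]], of "(wderiv ^^ k) x"]
        rep_mult_op[OF Linf_op_const[OF P[OF k]], of "(wderiv ^^ k) x"]
        rep_scaleR_l2[of r "mult_op (\<lambda>_. P k) ((wderiv ^^ k) x)"]
      by eventually_elim simp
  qed
qed

context weight
begin

text \<open>Since \<open>\<langle>A \<H> x, x\<rangle>\<^sub>\<H> = \<langle>A z, z\<rangle>\<close> for \<open>z = \<H> x\<close>, dissipativity of \<open>A \<H>\<close> in the weighted space and of \<open>A\<close> in \<open>L\<^sup>2\<close>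
  coincide. The equation \<open>x - h A \<H> x = f\<close> becomes \<open>\<H>\<^sup>-\<^sup>1 z - h A z = f\<close>, whose homogeneous version has only the
  zero solution in the domain because \<open>\<langle>\<H>\<^sup>-\<^sup>1 z, z\<rangle> = h \<langle>A z, z\<rangle> \<le> 0\<close>.\<close>

theorem generation_iff_dissipative:
  fixes P :: "nat \<Rightarrow> 'h \<Rightarrow> 'h"
    and What :: "('h, 'n::{finite, linorder}) vec \<times> ('h, 'n) vec \<Rightarrow> ('h, 'n) vec"
  assumes P: "\<And>k. k \<le> CARD('n) \<Longrightarrow> bounded_clinear (P k)" and P_bij: "bij (P CARD('n))"
    and What: "bounded_clinear What"
  shows "generates_contraction_semigroup ip {x. Hm x \<in> op_domain What} (\<lambda>x. diff_op CARD('n) P (Hm x)) \<longleftrightarrow>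
    (\<forall>z\<in>op_domain What. inner (diff_op CARD('n) P z) z \<le> 0)" (is "?G \<longleftrightarrow> ?D")
proof
  let ?A = "diff_op CARD('n) P"
  assume ?G
  then obtain T where T: "contraction_semigroup ip T"
    and graph: "generator_graph ip T = {(x, ?A (Hm x)) | x. x \<in> {x. Hm x \<in> op_domain What}}"
    unfolding generates_contraction_semigroup_def by blast
  show ?D
  proof
    fix z assume z: "z \<in> op_domain What"
    then have "(Hinv z, ?A z) \<in> generator_graph ip T"
      unfolding graph using Hm_Hinv(1)[of z] by force
    then have "re_ip (?A z) (Hinv z) \<le> 0" by (rule generator_dissipative[OF T])
    then show "inner (?A z) z \<le> 0" by (simp add: re_ip_def Re_ip Hm_Hinv)
  qed
next
  let ?N = "CARD('n)"
  let ?A = "diff_op ?N P"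
  assume D: ?D
  have linWhat: "linear What" by (rule bounded_clinear_linear[OF What])
  have dom_add: "x + y \<in> op_domain What" if "x \<in> op_domain What" "y \<in> op_domain What" for x y
    using that by (simp add: op_domain_def sobolev_add(1) boundary_map_add linear_add[OF linWhat])
  have dom_scaleC: "c *\<^sub>C x \<in> op_domain What" if "x \<in> op_domain What" for x c
    using that by (simp add: op_domain_def sobolev_scaleC(1) boundary_map_scaleC bounded_clinear_scaleC[OF What])
  have dom_sob: "x \<in> sobolev ?N" if "x \<in> op_domain What" for x
    using that by (simp add: op_domain_def)
  have "m_dissipative ip {x. Hm x \<in> op_domain What} (\<lambda>x. ?A (Hm x))"
  proof (unfold_locales, goal_cases)
    case (1 x y) then show ?case by (simp add: Hm_add dom_add)
  next
    case (2 x c) then show ?case by (simp add: Hm_scaleC dom_scaleC)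
  next
    case (3 x y) then show ?case using diff_op_add[where P = P and x = "Hm x" and y = "Hm y", OF P dom_sob dom_sob] by (simp add: Hm_add)
  next
    case (4 x c) then show ?case using diff_op_scaleC[where P = P and x = "Hm x" and c = c, OF P dom_sob] by (simp add: Hm_scaleC)
  next
    case (5 x) then show ?case using D by (simp add: Re_ip Hm_symmetric[symmetric] inner_commute)
  next
    case (6 h f)
    \<comment> \<open>the step size is absorbed into the coefficients, so that the weight enters unscaled\<close>
    let ?P = "\<lambda>k v. h *\<^sub>R P k v"
    have A: "diff_op ?N ?P z = h *\<^sub>R ?A z" for z by (rule diff_op_scale_coefficients(2)[where P = P, OF P])
    have "bij (\<lambda>v::'h. h *\<^sub>R v)"
      using 6 by (intro bij_betw_byWitness[where f' = "\<lambda>v. inverse h *\<^sub>R v"]) auto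
    then have "bij (?P ?N)" using bij_comp[OF P_bij] by (simp add: o_def)
    then have "\<exists>z\<in>op_domain What. Hinv z - diff_op ?N ?P z = f"
    proof (intro boundary_value_problem[where P = ?P] H_inv_Linf What)
      show "bounded_clinear (?P k)" if "k \<le> ?N" for k
        by (rule diff_op_scale_coefficients(1)[where P = P, OF P that])
      fix z assume z: "z \<in> op_domain What" and eq: "Hinv z - diff_op ?N ?P z = 0"
      have "inner (Hinv z) (Hm (Hinv z)) = h * inner (?A z) z"
      proof -
        have "Hinv z = h *\<^sub>R ?A z" using eq by (simp add: A)
        then have "inner (Hinv z) z = h * inner (?A z) z" by simp
        then show ?thesis by (simp only: Hm_Hinv)
      qed
      also have "\<dots> \<le> 0" using D z 6 by (simp add: mult_nonneg_nonpos)
      finally have "Hinv z = 0" by (rule Hm_pos(2))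
      then have "z = Hm 0" using Hm_Hinv(1)[of z] by simp
      then show "z = 0" by (simp add: linear_0[OF linear_mult_op[OF H_Linf]])
    qed
    then obtain z where z: "z \<in> op_domain What" "Hinv z - h *\<^sub>R ?A z = f" by (auto simp: A)
    then show ?case by (intro bexI[of _ "Hinv z"]) (simp_all add: Hm_Hinv)
  qed
  then show ?G by (rule m_dissipative.Lumer_Phillips)
qed

end

section \<open>The characterization\<close>

text \<open>The substitution \<open>f = Q u - Q y\<close>, \<open>e = u + y\<close> is invertible because \<open>Q\<close> is, so \<open>W\<close> is \<open>What\<close> in the new
  variables.\<close>

lemma W_op_substitution:
  fixes P :: "nat \<Rightarrow> 'h::{complex_inner, euclidean_space} \<Rightarrow> 'h"
    and What :: "('h, 'n::{finite, linorder}) vec \<times> ('h, 'n) vec \<Rightarrow> ('h, 'n) vec"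
  assumes bdd: "\<And>k. k \<le> CARD('n) \<Longrightarrow> bounded_clinear (P k)" and bij: "bij (P CARD('n))"
    and What: "bounded_clinear What"
  shows "bounded_clinear (W_op P What)"
    and "W_op P What (Q_op P u - Q_op P y, u + y) = What (u, y)"
    and "\<exists>u y. (f, e) = (Q_op P u - Q_op P y, u + (y :: ('h, 'n) vec))"
proof -
  define T where "T = (\<lambda>(u, y). (Q_op P u - Q_op P y, u + (y :: ('h, 'n) vec)))"
  have Q: "bounded_clinear (Q_op P :: ('h, 'n) vec \<Rightarrow> _)" by (rule bounded_clinear_Q_op[where P = P and 'n = 'n, OF bdd])
  have linQ: "linear (Q_op P :: ('h, 'n) vec \<Rightarrow> _)" by (rule bounded_clinear_linear[OF Q])
  have injQ: "inj (Q_op P :: ('h, 'n) vec \<Rightarrow> _)" using bij_Q_op[where P = P and 'n = 'n, OF bdd bij] by (simp add: bij_is_inj)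
  have linT: "linear T"
    by (rule linearI) (auto simp: T_def linear_add[OF linQ] linear_cmul[OF linQ] scaleR_diff_right scaleR_add_right)
  have "p = 0" if "T p = 0" for p
  proof -
    obtain u y where p: "p = (u, y)" by (cases p)
    then have "Q_op P u = Q_op P y" "u + y = 0" using that by (auto simp: T_def zero_prod_def)
    then have "u = y" "u + y = 0" using injQ by (auto simp: inj_eq)
    then have "2 *\<^sub>R u = 0" by (simp add: scaleR_2)
    then show "p = 0" using \<open>u = y\<close> p by (simp add: zero_prod_def)
  qed
  then have "inj T" by (simp add: linear_injective_0[OF linT])
  then have T: "bij T" using linear_injective_imp_surjective[OF linT] by (simp add: bij_def)
  have W: "W_op P What p = What (inv T p)" for p by (simp add: W_op_def T_def)
  have invT: "inv T p = q \<longleftrightarrow> p = T q" for p q using T by (metis bij_inv_eq_iff)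
  have TI: "T (inv T p) = p" for p using invT[of p "inv T p"] by simp
  show "bounded_clinear (W_op P What)"
  proof (rule bounded_clinearI)
    show "linear (W_op P What)"
    proof (rule linearI)
      fix p q r
      have "inv T (p + q) = inv T p + inv T q" unfolding invT by (simp add: linear_add[OF linT] TI)
      then show "W_op P What (p + q) = W_op P What p + W_op P What q"
        by (simp add: W linear_add[OF bounded_clinear_linear[OF What]])
      have "inv T (r *\<^sub>R p) = r *\<^sub>R inv T p" unfolding invT by (simp add: linear_cmul[OF linT] TI)
      then show "W_op P What (r *\<^sub>R p) = r *\<^sub>R W_op P What p"
        by (simp add: W linear_cmul[OF bounded_clinear_linear[OF What]])
    qed
    fix c p
    have "T (c *\<^sub>C q) = c *\<^sub>C T q" for q
      by (cases q) (simp add: T_def scaleC_prod_def bounded_clinear_scaleC[OF Q] scaleC_diff scaleC_add_right)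
    then have "inv T (c *\<^sub>C p) = c *\<^sub>C inv T p" unfolding invT by (simp add: TI)
    then show "W_op P What (c *\<^sub>C p) = c *\<^sub>C W_op P What p"
      by (simp add: W bounded_clinear_scaleC[OF What])
  qed
  have "inv T (T (u, y)) = (u, y)" for u y unfolding invT ..
  then show "W_op P What (Q_op P u - Q_op P y, u + y) = What (u, y)"
    using W[of "T (u, y)"] by (simp add: T_def)
  show "\<exists>u y. (f, e) = (Q_op P u - Q_op P y, u + (y :: ('h, 'n) vec))"
    using TI[of "(f, e)"] by (cases "inv T (f, e)") (auto simp: T_def)
qed

theorem corollary2p3:
  fixes P :: "nat \<Rightarrow> 'h::{complex_inner, euclidean_space} \<Rightarrow> 'h"
    and \<H> :: "real \<Rightarrow> 'h \<Rightarrow> 'h"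
    and What :: "('h, 'n::{finite, linorder}) vec \<times> ('h, 'n) vec \<Rightarrow> ('h, 'n) vec"
    and N :: nat
  assumes N: "N = CARD('n)"
    and P_bounded: "\<And>k. k \<le> N \<Longrightarrow> bounded_clinear (P k)"
    and P_N_invertible: "bij (P N)"
    and P_adjoint: "\<And>k. 1 \<le> k \<Longrightarrow> k \<le> N \<Longrightarrow> cadjoint (P k) = (\<lambda>x. (-1) ^ (k + 1) *\<^sub>R P k x)"
    and H_pos: "AE \<zeta> in lebesgue_on {0..1}. op_nonneg (\<H> \<zeta>) \<and> bij (\<H> \<zeta>)"
    and H_Linf: "Linf_op \<H>"
    and H_inv_Linf: "Linf_op (\<lambda>\<zeta>. inv (\<H> \<zeta>))"
    and What_bounded: "bounded_clinear What"
  shows "let A = diff_op N P;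
             D = op_domain What;
             Q = Q_op P;
             W = W_op P What;
             W\<^sub>1 = (\<lambda>u. W (u, 0));
             W\<^sub>2 = (\<lambda>y. W (0, y));
             \<Sigma> = (\<lambda>(u, y). (y, u));
             ReP\<^sub>0 = op_nonpos (Re_op (P 0));
             W_inj = inj (\<lambda>u. W\<^sub>1 u + W\<^sub>2 u);
             W_surj = surj W;
             W_nonneg = op_nonneg (W \<circ> \<Sigma> \<circ> cadjoint W);
             W_contr = (\<exists>V. bounded_clinear V \<and> onorm V \<le> 1 \<and>
                (\<forall>f e. W (f, e) = (1/2) *\<^sub>R (W\<^sub>1 (f + V f + (e - V e)) + W\<^sub>2 (f + V f + (e - V e)))));
             S1 = generates_contraction_semigroup (\<lambda>x z. cinner x (mult_op \<H> z))
                    {x. mult_op \<H> x \<in> D} (\<lambda>x. A (mult_op \<H> x));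
             S2 = (\<forall>x\<in>D. Re (cinner (A x) x) \<le> 0);
             S3 = (ReP\<^sub>0 \<and> W_inj \<and> W_nonneg);
             S4 = (ReP\<^sub>0 \<and> W_inj \<and> W_contr);
             S5 = (ReP\<^sub>0 \<and> (\<forall>u y. What (u, y) = 0 \<longrightarrow> cinner u (Q u) - cinner y (Q y) \<in> \<real>\<^sub>\<le>\<^sub>0));
             S6 = (ReP\<^sub>0 \<and> W_surj \<and> W_nonneg);
             S7 = (ReP\<^sub>0 \<and> W_surj \<and> W_contr)
         in (S1 \<longleftrightarrow> S2) \<and> (S2 \<longleftrightarrow> S3) \<and> (S3 \<longleftrightarrow> S4) \<and> (S4 \<longleftrightarrow> S5) \<and> (S5 \<longleftrightarrow> S6) \<and> (S6 \<longleftrightarrow> S7)"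
proof -
  let ?N = "CARD('n)" and ?Q = "Q_op P :: ('h, 'n) vec \<Rightarrow> ('h, 'n) vec"
  have P: "\<And>k. k \<le> ?N \<Longrightarrow> bounded_clinear (P k)" and P_bij: "bij (P ?N)"
    and adj: "\<And>k. 1 \<le> k \<Longrightarrow> k \<le> ?N \<Longrightarrow> cadjoint (P k) = (\<lambda>x. (-1) ^ (k + 1) *\<^sub>R P k x)"
    using P_bounded P_N_invertible P_adjoint unfolding N by blast+
  interpret weight \<H> by standard (fact H_pos H_Linf H_inv_Linf)+
  interpret boundary_operator "W_op P What"
    by standard (rule W_op_substitution(1)[where P = P, OF P P_bij What_bounded])
  have Q: "bounded_clinear ?Q" by (rule bounded_clinear_Q_op[where P = P and 'n = 'n, OF P])
  have symQ: "inner (?Q u) v = inner u (?Q v)" for u v by (rule symmetric_Q_op[where P = P, OF P adj])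
  have ip: "ip = (\<lambda>x z. cinner x (mult_op \<H> z))" by (simp add: fun_eq_iff ip_def)
  have S1: "generates_contraction_semigroup (\<lambda>x z. cinner x (mult_op \<H> z))
      {x. mult_op \<H> x \<in> op_domain What} (\<lambda>x. diff_op N P (mult_op \<H> x)) \<longleftrightarrow>
      (\<forall>x\<in>op_domain What. inner (diff_op N P x) x \<le> 0)"
    unfolding N ip[symmetric] by (rule generation_iff_dissipative[where P = P, OF P P_bij What_bounded])
  have form: "cinner u (?Q u) - cinner y (?Q y) \<in> \<real>\<^sub>\<le>\<^sub>0 \<longleftrightarrow> inner u (?Q u) - inner y (?Q y) \<le> 0" for u y
    using Im_cinner_symmetric[of ?Q, OF symQ bounded_clinear_scaleC[OF Q]]
    by (simp add: complex_nonpos_Reals_iff Re_cinner)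
  have energy: "inner (?Q u - ?Q y) (u + y) = inner u (?Q u) - inner y (?Q y)" for u y
    using symQ[of u y] by (simp add: inner_add_right inner_diff_left inner_diff_right symQ inner_commute)
  have "(\<forall>u y. What (u, y) = 0 \<longrightarrow> inner u (?Q u) - inner y (?Q y) \<le> 0) \<longleftrightarrow> dissip"
  proof
    assume *: "\<forall>u y. What (u, y) = 0 \<longrightarrow> inner u (?Q u) - inner y (?Q y) \<le> 0"
    show dissip
      unfolding dissip_def
    proof (intro allI impI)
      fix f e assume W0: "W_op P What (f, e) = 0"
      obtain u y where "(f, e) = (?Q u - ?Q y, u + y)"
        using W_op_substitution(3)[where P = P, OF P P_bij What_bounded] by blast
      then have fe: "f = ?Q u - ?Q y" "e = u + y" by auto
      have "What (u, y) = 0"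
        using W0 W_op_substitution(2)[where P = P, OF P P_bij What_bounded, of u y] by (simp add: fe)
      then show "inner f e \<le> 0" unfolding fe energy using * by blast
    qed
  next
    assume *: dissip
    show "\<forall>u y. What (u, y) = 0 \<longrightarrow> inner u (?Q u) - inner y (?Q y) \<le> 0"
    proof (intro allI impI)
      fix u y assume "What (u, y) = 0"
      then have "W_op P What (?Q u - ?Q y, u + y) = 0"
        using W_op_substitution(2)[where P = P, OF P P_bij What_bounded, of u y] by simp
      then show "inner u (?Q u) - inner y (?Q y) \<le> 0"
        unfolding energy[symmetric] using * by (simp add: dissip_def)
    qed
  qed
  then have S2: "(\<forall>x\<in>op_domain What. inner (diff_op N P x) x \<le> 0) \<longleftrightarrow> op_nonpos (Re_op (P 0)) \<and> dissip"
    and S5: "(\<forall>u y. What (u, y) = 0 \<longrightarrow> cinner u (?Q u) - cinner y (?Q y) \<in> \<real>\<^sub>\<le>\<^sub>0) \<longleftrightarrow> dissip"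
    using dissipative_iff_boundary[where P = P, OF P adj What_bounded] op_nonpos_Re_op_iff[of "P 0"] P[of 0]
    unfolding N form by auto
  show ?thesis
    unfolding Let_def Re_cinner S1 S2 S5 diag_def[symmetric] contr_def[symmetric] nonneg_def[symmetric]
    using boundary_conditions_equivalent by blast
qed

end
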